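(* There exists an infinite discrete group $G$ with a cocompact classifying space for proper actions $\underline{E}G$ such that the map $$\varepsilon_G\colon \mathrm{KO}^0_G(\underline{E}G)\to \lim_{G/H\in\mathcal{O}_{\mathcal{F}}G}RO(H)$$ is not surjective.
   Context: For a discrete group $G$, let $\mathcal{F}$ be the family of finite subgroups of $G$. The orbit category $\mathcal{O}_{\mathcal{F}}G$ has objects the transitive $G$-sets $G/H$ with $H\in\mathcal{F}$ and morphisms the $G$-equivariant maps. A classifying space for proper actions $\underline{E}G$ is a $G$-CW-complex all of whose isotropy groups are finite and such that the fixed point set $\underline{E}G^H$ is contractible for every $H\in\mathcal{F}$; it is cocompact if $G\backslash\underline{E}G$ is compact. $RO(H)$ is the real representation ring of $H$ (Grothendieck group of finite dimensional real representations); $G/H\mapsto RO(H)$ is a contravariant functor on $\mathcal{O}_{\mathcal{F}}G$ (a map $G/H\to G/K$, $eH\mapsto gK$, induces the pullback along $h\mapsto g^{-1}hg$). A real $G$-vector bundle over a $G$-CW-complex $X$ is a real vector bundle $\pi\colon E\to X$ with a $G$-action on $E$ such that $\pi$ is $G$-equivariant and each $g\in G$ acts by a bundle isomorphism. For a cocompact $X$ with finite isotropy, $\mathrm{KO}^0_G(X)$ is the Grothendieck group of the monoid (under direct sum) of isomorphism classes of real $G$-vector bundles over $X$. The homomorphism $\varepsilon_G$ sends the class of a real $G$-vector bundle $E\to\underline{E}G$ to the collection whose $H$-component is the class of the $H$-representation on the fiber $E_x$ for any $x\in\underline{E}G^H$ (independent of $x$ since $\underline{E}G^H$ is connected). *)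

theory Defs
  imports
    "HOL-Analysis.Analysis"
    "HOL-Algebra.Left_Coset"
    "HOL-Algebra.Group_Action"
    "Jordan_Normal_Form.VS_Connect"
begin

text \<open>
  Isomorphism classes are formed inside a fixed type of points: the members of a class all live on
  one type, while isomorphisms and direct sums may relate objects on different types. Representations
  in \<open>RO\<close> have type \<open>'v\<close> and total spaces in \<open>KO\<close> have type \<open>'e\<close>. If these types have at least the
  cardinality of the continuum, and of the base space in the case of \<open>'e\<close>, then every
  finite-dimensional representation, respectively every G-vector bundle, has an isomorphic copy there.
\<close>

section \<open>Grothendieck group of a commutative monoid\<close>

definition groth_rel :: "('m, 'b) monoid_scheme \<Rightarrow> (('m \<times> 'm) \<times> ('m \<times> 'm)) set" where
  "groth_rel M = {((a, b), (c, d)).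
     a \<in> carrier M \<and> b \<in> carrier M \<and> c \<in> carrier M \<and> d \<in> carrier M \<and>
     (\<exists>k\<in>carrier M. a \<otimes>\<^bsub>M\<^esub> d \<otimes>\<^bsub>M\<^esub> k = c \<otimes>\<^bsub>M\<^esub> b \<otimes>\<^bsub>M\<^esub> k)}"

text \<open>The class of \<open>(a, b)\<close> is the formal difference of \<open>a\<close> and \<open>b\<close>.\<close>

definition groth :: "('m, 'b) monoid_scheme \<Rightarrow> ('m \<times> 'm) set monoid" where
  "groth M = \<lparr>carrier = (carrier M \<times> carrier M) // groth_rel M,
     mult = (\<lambda>A B. \<Union>(a, b)\<in>A. \<Union>(c, d)\<in>B. groth_rel M `` {(a \<otimes>\<^bsub>M\<^esub> c, b \<otimes>\<^bsub>M\<^esub> d)}),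
     one = groth_rel M `` {(\<one>\<^bsub>M\<^esub>, \<one>\<^bsub>M\<^esub>)}\<rparr>"

text \<open>The map induced by a monoid homomorphism \<open>f\<close> into \<open>N\<close>.\<close>

definition groth_map :: "('n, 'b) monoid_scheme \<Rightarrow> ('m \<Rightarrow> 'n) \<Rightarrow> ('m \<times> 'm) set \<Rightarrow> ('n \<times> 'n) set" where
  "groth_map N f A = (\<Union>(a, b)\<in>A. groth_rel N `` {(f a, f b)})"

section \<open>Real representations and the representation ring\<close>

type_synonym ('g, 'v) rep = "(real, 'v) module \<times> ('g \<Rightarrow> 'v \<Rightarrow> 'v)"

definition real_rep :: "('g, 'b) monoid_scheme \<Rightarrow> ('g, 'v) rep \<Rightarrow> bool" where
  "real_rep G = (\<lambda>(V, \<rho>).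
     vectorspace class_ring V \<and> vectorspace.fin_dim class_ring V \<and>
     group_action G (carrier V) \<rho> \<and>
     (\<forall>g\<in>carrier G. \<rho> g \<in> module_hom class_ring V V))"

definition rep_iso :: "('g, 'b) monoid_scheme \<Rightarrow> ('g, 'v) rep \<Rightarrow> ('g, 'w) rep \<Rightarrow> bool" where
  "rep_iso G = (\<lambda>(V, \<rho>) (W, \<sigma>). \<exists>f\<in>module_hom class_ring V W.
     bij_betw f (carrier V) (carrier W) \<and>
     (\<forall>g\<in>carrier G. \<forall>v\<in>carrier V. f (\<rho> g v) = \<sigma> g (f v)))"

definition rep_sum :: "('g, 'v) rep \<Rightarrow> ('g, 'w) rep \<Rightarrow> ('g, 'v \<times> 'w) rep" where
  "rep_sum = (\<lambda>(V, \<rho>) (W, \<sigma>).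
     (direct_sum V W, \<lambda>g. \<lambda>p\<in>carrier V \<times> carrier W. (\<rho> g (fst p), \<sigma> g (snd p))))"

definition rep_class :: "('g, 'b) monoid_scheme \<Rightarrow> ('g, 'v) rep \<Rightarrow> ('g, 'w) rep set" where
  "rep_class G R = {S. real_rep G S \<and> rep_iso G R S}"

definition rep_monoid :: "('g, 'b) monoid_scheme \<Rightarrow> ('g, 'v) rep set monoid" where
  "rep_monoid G = \<lparr>carrier = rep_class G ` {R :: ('g, 'v) rep. real_rep G R},
     mult = (\<lambda>A B. \<Union>R\<in>A. \<Union>S\<in>B. rep_class G (rep_sum R S)),
     one = {R. real_rep G R \<and> carrier (fst R) = {\<zero>\<^bsub>fst R\<^esub>}}\<rparr>"

definition RO :: "('g, 'b) monoid_scheme \<Rightarrow> (('g, 'v) rep set \<times> ('g, 'v) rep set) set monoid" where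
  "RO G = groth (rep_monoid G)"

section \<open>The orbit category and the limit of the representation rings\<close>

definition finite_subgroups :: "('g, 'b) monoid_scheme \<Rightarrow> 'g set set" where
  "finite_subgroups G = {H. subgroup H G \<and> finite H}"

definition orbit_cat_hom :: "('g, 'b) monoid_scheme \<Rightarrow> 'g set \<Rightarrow> 'g set \<Rightarrow> ('g set \<Rightarrow> 'g set) set" where
  "orbit_cat_hom G H K = {f \<in> lcosets\<^bsub>G\<^esub> H \<rightarrow>\<^sub>E lcosets\<^bsub>G\<^esub> K.
     \<forall>g\<in>carrier G. \<forall>C\<in>lcosets\<^bsub>G\<^esub> H. f (g <#\<^bsub>G\<^esub> C) = g <#\<^bsub>G\<^esub> f C}"

definition rep_pullback :: "('h \<Rightarrow> 'k) \<Rightarrow> ('k, 'v) rep \<Rightarrow> ('h, 'v) rep" where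
  "rep_pullback \<phi> = (\<lambda>(V, \<rho>). (V, \<lambda>h. \<rho> (\<phi> h)))"

text \<open>\<open>RO(K) \<rightarrow> RO(H)\<close> for the morphism \<open>eH \<mapsto> gK\<close>.\<close>

definition RO_map ::
  "('g, 'b) monoid_scheme \<Rightarrow> 'g set \<Rightarrow> 'g \<Rightarrow>
     (('g, 'v) rep set \<times> ('g, 'v) rep set) set \<Rightarrow> (('g, 'v) rep set \<times> ('g, 'v) rep set) set" where
  "RO_map G H g = groth_map (rep_monoid (G\<lparr>carrier := H\<rparr>))
     (\<lambda>c. \<Union>R\<in>c. rep_class (G\<lparr>carrier := H\<rparr>)
        (rep_pullback (\<lambda>h. inv\<^bsub>G\<^esub> g \<otimes>\<^bsub>G\<^esub> h \<otimes>\<^bsub>G\<^esub> g) R))"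

definition lim_RO ::
  "('g, 'b) monoid_scheme \<Rightarrow> ('g set \<Rightarrow> (('g, 'v) rep set \<times> ('g, 'v) rep set) set) set" where
  "lim_RO G = {r \<in> (\<Pi>\<^sub>E H\<in>finite_subgroups G. carrier (RO (G\<lparr>carrier := H\<rparr>))).
     \<forall>H\<in>finite_subgroups G. \<forall>K\<in>finite_subgroups G. \<forall>f\<in>orbit_cat_hom G H K.
       \<forall>g\<in>carrier G. f H = g <#\<^bsub>G\<^esub> K \<longrightarrow> RO_map G H g (r K) = r H}"

section \<open>G-CW-complexes and classifying spaces for proper actions\<close>

definition G_space :: "('g, 'b) monoid_scheme \<Rightarrow> 'x topology \<Rightarrow> ('g \<Rightarrow> 'x \<Rightarrow> 'x) \<Rightarrow> bool" where
  "G_space G X \<phi> \<longleftrightarrow> group_action G (topspace X) \<phi> \<and> (\<forall>g\<in>carrier G. continuous_map X X (\<phi> g))"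

definition fixed_points :: "'x topology \<Rightarrow> ('g \<Rightarrow> 'x \<Rightarrow> 'x) \<Rightarrow> 'g set \<Rightarrow> 'x set" where
  "fixed_points X \<phi> H = {x \<in> topspace X. \<forall>h\<in>H. \<phi> h x = x}"

definition disc :: "nat \<Rightarrow> (nat \<Rightarrow> real) topology" where
  "disc n = subtopology (Euclidean_space n) {x. (\<Sum>i<n. (x i)\<^sup>2) \<le> 1}"

definition disc_interior :: "nat \<Rightarrow> (nat \<Rightarrow> real) set" where
  "disc_interior n = {x \<in> topspace (Euclidean_space n). (\<Sum>i<n. (x i)\<^sup>2) < 1}"

definition disc_boundary :: "nat \<Rightarrow> (nat \<Rightarrow> real) set" where
  "disc_boundary n = {x \<in> topspace (Euclidean_space n). (\<Sum>i<n. (x i)\<^sup>2) = 1}"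

definition equiv_cell :: "('g, 'b) monoid_scheme \<Rightarrow> 'g set \<Rightarrow> nat \<Rightarrow> ('g set \<times> (nat \<Rightarrow> real)) topology" where
  "equiv_cell G H n = prod_topology (discrete_topology (lcosets\<^bsub>G\<^esub> H)) (disc n)"

text \<open>
  \<open>B\<close> is the pushout of \<open>A \<leftarrow> \<Coprod>\<^sub>i G/S\<^sub>i \<times> S\<^sup>n\<^sup>-\<^sup>1 \<rightarrow> \<Coprod>\<^sub>i G/S\<^sub>i \<times> D\<^sup>n\<close>, written out: as a set it is \<open>A\<close> together
  with the open cells, and it carries the final topology. Distinct cells have disjoint nonempty
  interiors, so points of the space suffice as indices.
\<close>

definition attaches_cells ::
  "('g, 'b) monoid_scheme \<Rightarrow> 'x topology \<Rightarrow> ('g \<Rightarrow> 'x \<Rightarrow> 'x) \<Rightarrow> nat \<Rightarrow> 'x set \<Rightarrow> 'x set \<Rightarrow> bool" where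
  "attaches_cells G X \<phi> n A B \<longleftrightarrow>
     A \<subseteq> B \<and>
     (\<exists>(I :: 'x set) (S :: 'x \<Rightarrow> 'g set) (Q :: 'x \<Rightarrow> 'g set \<times> (nat \<Rightarrow> real) \<Rightarrow> 'x).
        (\<forall>i\<in>I. subgroup (S i) G \<and>
           continuous_map (equiv_cell G (S i) n) (subtopology X B) (Q i) \<and>
           (\<forall>g\<in>carrier G. \<forall>C\<in>lcosets\<^bsub>G\<^esub> (S i). \<forall>v\<in>topspace (disc n).
              Q i (g <#\<^bsub>G\<^esub> C, v) = \<phi> g (Q i (C, v))) \<and>
           Q i ` ((lcosets\<^bsub>G\<^esub> (S i)) \<times> disc_boundary n) \<subseteq> A) \<and>
        bij_betw (\<lambda>(i, p). Q i p) (SIGMA i:I. (lcosets\<^bsub>G\<^esub> (S i)) \<times> disc_interior n) (B - A) \<and>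
        (\<forall>F\<subseteq>B. closedin (subtopology X B) F \<longleftrightarrow>
           closedin (subtopology X A) (F \<inter> A) \<and>
           (\<forall>i\<in>I. closedin (equiv_cell G (S i) n)
              {p \<in> topspace (equiv_cell G (S i) n). Q i p \<in> F})))"

definition G_CW_complex :: "('g, 'b) monoid_scheme \<Rightarrow> 'x topology \<Rightarrow> ('g \<Rightarrow> 'x \<Rightarrow> 'x) \<Rightarrow> bool" where
  "G_CW_complex G X \<phi> \<longleftrightarrow> G_space G X \<phi> \<and>
     (\<exists>sk :: nat \<Rightarrow> 'x set.
        (\<Union>n. sk n) = topspace X \<and>
        attaches_cells G X \<phi> 0 {} (sk 0) \<and>
        (\<forall>n. attaches_cells G X \<phi> (Suc n) (sk n) (sk (Suc n))) \<and>
        (\<forall>F\<subseteq>topspace X. closedin X F \<longleftrightarrow> (\<forall>n. closedin (subtopology X (sk n)) (F \<inter> sk n))))"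

text \<open>\<^const>\<open>contractible_space\<close> holds for the empty space, which is not contractible here.\<close>

definition classifying_space_proper ::
  "('g, 'b) monoid_scheme \<Rightarrow> 'x topology \<Rightarrow> ('g \<Rightarrow> 'x \<Rightarrow> 'x) \<Rightarrow> bool" where
  "classifying_space_proper G X \<phi> \<longleftrightarrow>
     G_CW_complex G X \<phi> \<and>
     (\<forall>x\<in>topspace X. finite (stabilizer G \<phi> x)) \<and>
     (\<forall>H\<in>finite_subgroups G. fixed_points X \<phi> H \<noteq> {} \<and>
        contractible_space (subtopology X (fixed_points X \<phi> H)))"

definition orbit_space :: "('g, 'b) monoid_scheme \<Rightarrow> 'x topology \<Rightarrow> ('g \<Rightarrow> 'x \<Rightarrow> 'x) \<Rightarrow> 'x set topology" where
  "orbit_space G X \<phi> = topology (\<lambda>U. U \<subseteq> Group_Action.orbits G (topspace X) \<phi> \<and>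
     openin X {x \<in> topspace X. Group_Action.orbit G \<phi> x \<in> U})"

lemma openin_orbit_space:
  "openin (orbit_space G X \<phi>) U \<longleftrightarrow> U \<subseteq> Group_Action.orbits G (topspace X) \<phi> \<and>
     openin X {x \<in> topspace X. Group_Action.orbit G \<phi> x \<in> U}"
proof -
  have "istopology (\<lambda>U. U \<subseteq> Group_Action.orbits G (topspace X) \<phi> \<and>
     openin X {x \<in> topspace X. Group_Action.orbit G \<phi> x \<in> U})"
    (is "istopology (\<lambda>U. U \<subseteq> ?O \<and> openin X (?p U))")
    unfolding istopology_def
  proof (intro conjI allI impI)
    fix S T assume "S \<subseteq> ?O \<and> openin X (?p S)" "T \<subseteq> ?O \<and> openin X (?p T)"
    moreover have "?p (S \<inter> T) = ?p S \<inter> ?p T" by blast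
    ultimately show "S \<inter> T \<subseteq> ?O" "openin X (?p (S \<inter> T))" by auto
  next
    fix \<K> assume "\<forall>K\<in>\<K>. K \<subseteq> ?O \<and> openin X (?p K)"
    moreover have "?p (\<Union>\<K>) = \<Union>(?p ` \<K>)" by blast
    ultimately show "\<Union>\<K> \<subseteq> ?O" "openin X (?p (\<Union>\<K>))" by auto
  qed
  then show ?thesis by (simp add: orbit_space_def)
qed

lemma quotient_map_orbit_space:
  "quotient_map X (orbit_space G X \<phi>) (Group_Action.orbit G \<phi>)"
proof -
  have "openin (orbit_space G X \<phi>) (Group_Action.orbits G (topspace X) \<phi>)"
    by (auto simp: openin_orbit_space orbits_def intro: openin_subopen[THEN iffD2])
  then have "topspace (orbit_space G X \<phi>) = Group_Action.orbits G (topspace X) \<phi>"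
    by (metis openin_orbit_space openin_subset openin_topspace subset_antisym)
  then show ?thesis
    by (auto simp: quotient_map_def openin_orbit_space orbits_def)
qed

definition cocompact :: "('g, 'b) monoid_scheme \<Rightarrow> 'x topology \<Rightarrow> ('g \<Rightarrow> 'x \<Rightarrow> 'x) \<Rightarrow> bool" where
  "cocompact G X \<phi> \<longleftrightarrow> compact_space (orbit_space G X \<phi>)"

section \<open>Real G-vector bundles and equivariant KO-theory\<close>

record ('g, 'x, 'e) gvb =
  total :: "'e topology"
  proj :: "'e \<Rightarrow> 'x"
  fib :: "'x \<Rightarrow> (real, 'e) module"
  act :: "'g \<Rightarrow> 'e \<Rightarrow> 'e"

definition Rn :: "nat \<Rightarrow> (real, nat \<Rightarrow> real) module" where
  "Rn n = \<lparr>carrier = topspace (Euclidean_space n), mult = undefined, one = undefined,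
     zero = (\<lambda>i. 0), add = (\<lambda>v w i. v i + w i), smult = (\<lambda>c v i. c * v i)\<rparr>"

definition real_vector_bundle :: "'x topology \<Rightarrow> ('g, 'x, 'e) gvb \<Rightarrow> bool" where
  "real_vector_bundle X E \<longleftrightarrow>
     continuous_map (total E) X (proj E) \<and>
     (\<forall>x\<in>topspace X. vectorspace class_ring (fib E x) \<and>
        carrier (fib E x) = {e \<in> topspace (total E). proj E e = x}) \<and>
     (\<forall>x\<in>topspace X. \<exists>U n h. openin X U \<and> x \<in> U \<and>
        homeomorphic_map (subtopology (total E) {e \<in> topspace (total E). proj E e \<in> U})
          (prod_topology (subtopology X U) (Euclidean_space n)) h \<and>
        (\<forall>e\<in>topspace (total E). proj E e \<in> U \<longrightarrow> fst (h e) = proj E e) \<and>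
        (\<forall>y\<in>U. snd \<circ> h \<in> module_hom class_ring (fib E y) (Rn n)))"

definition G_vector_bundle ::
  "('g, 'b) monoid_scheme \<Rightarrow> 'x topology \<Rightarrow> ('g \<Rightarrow> 'x \<Rightarrow> 'x) \<Rightarrow> ('g, 'x, 'e) gvb \<Rightarrow> bool" where
  "G_vector_bundle G X \<phi> E \<longleftrightarrow>
     real_vector_bundle X E \<and>
     G_space G (total E) (act E) \<and>
     (\<forall>g\<in>carrier G. \<forall>e\<in>topspace (total E). proj E (act E g e) = \<phi> g (proj E e)) \<and>
     (\<forall>g\<in>carrier G. \<forall>x\<in>topspace X. act E g \<in> module_hom class_ring (fib E x) (fib E (\<phi> g x)))"

definition gvb_iso ::
  "('g, 'b) monoid_scheme \<Rightarrow> 'x topology \<Rightarrow> ('g, 'x, 'e) gvb \<Rightarrow> ('g, 'x, 'f) gvb \<Rightarrow> bool" where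
  "gvb_iso G X E F \<longleftrightarrow> (\<exists>f. homeomorphic_map (total E) (total F) f \<and>
     (\<forall>e\<in>topspace (total E). proj F (f e) = proj E e) \<and>
     (\<forall>x\<in>topspace X. f \<in> module_hom class_ring (fib E x) (fib F x)) \<and>
     (\<forall>g\<in>carrier G. \<forall>e\<in>topspace (total E). f (act E g e) = act F g (f e)))"

definition gvb_sum :: "('g, 'x, 'e) gvb \<Rightarrow> ('g, 'x, 'f) gvb \<Rightarrow> ('g, 'x, 'e \<times> 'f) gvb" where
  "gvb_sum E F =
     (let T = {p \<in> topspace (total E) \<times> topspace (total F). proj E (fst p) = proj F (snd p)} in
      \<lparr>total = subtopology (prod_topology (total E) (total F)) T,
       proj = (\<lambda>p. proj E (fst p)),
       fib = (\<lambda>x. direct_sum (fib E x) (fib F x)),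
       act = (\<lambda>g. \<lambda>p\<in>T. (act E g (fst p), act F g (snd p)))\<rparr>)"

definition gvb_class ::
  "('g, 'b) monoid_scheme \<Rightarrow> 'x topology \<Rightarrow> ('g \<Rightarrow> 'x \<Rightarrow> 'x) \<Rightarrow> ('g, 'x, 'e) gvb \<Rightarrow> ('g, 'x, 'f) gvb set" where
  "gvb_class G X \<phi> E = {F. G_vector_bundle G X \<phi> F \<and> gvb_iso G X E F}"

definition gvb_monoid ::
  "('g, 'b) monoid_scheme \<Rightarrow> 'x topology \<Rightarrow> ('g \<Rightarrow> 'x \<Rightarrow> 'x) \<Rightarrow> ('g, 'x, 'e) gvb set monoid" where
  "gvb_monoid G X \<phi> =
     \<lparr>carrier = gvb_class G X \<phi> ` {E :: ('g, 'x, 'e) gvb. G_vector_bundle G X \<phi> E},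
      mult = (\<lambda>A B. \<Union>E\<in>A. \<Union>F\<in>B. gvb_class G X \<phi> (gvb_sum E F)),
      one = {E. G_vector_bundle G X \<phi> E \<and>
               (\<forall>x\<in>topspace X. carrier (fib E x) = {\<zero>\<^bsub>fib E x\<^esub>})}\<rparr>"

definition KO ::
  "('g, 'b) monoid_scheme \<Rightarrow> 'x topology \<Rightarrow> ('g \<Rightarrow> 'x \<Rightarrow> 'x) \<Rightarrow>
     (('g, 'x, 'e) gvb set \<times> ('g, 'x, 'e) gvb set) set monoid" where
  "KO G X \<phi> = groth (gvb_monoid G X \<phi>)"

section \<open>The comparison map\<close>

definition fibre_rep :: "('g, 'x, 'e) gvb \<Rightarrow> 'x \<Rightarrow> ('g, 'e) rep" where
  "fibre_rep E x = (fib E x, \<lambda>h. restrict (act E h) (carrier (fib E x)))"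

text \<open>
  All points of the fixed point set of \<open>H\<close> give isomorphic fibre representations, so the unions below
  amount to choosing representatives.
\<close>

definition fibre_class ::
  "('g, 'b) monoid_scheme \<Rightarrow> 'x topology \<Rightarrow> ('g \<Rightarrow> 'x \<Rightarrow> 'x) \<Rightarrow> 'g set \<Rightarrow>
     ('g, 'x, 'e) gvb set \<Rightarrow> ('g, 'v) rep set" where
  "fibre_class G X \<phi> H c =
     (\<Union>E\<in>c. \<Union>x\<in>fixed_points X \<phi> H. rep_class (G\<lparr>carrier := H\<rparr>) (fibre_rep E x))"

definition eps ::
  "('g, 'b) monoid_scheme \<Rightarrow> 'x topology \<Rightarrow> ('g \<Rightarrow> 'x \<Rightarrow> 'x) \<Rightarrow>
     (('g, 'x, 'e) gvb set \<times> ('g, 'x, 'e) gvb set) set \<Rightarrow>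
     'g set \<Rightarrow> (('g, 'v) rep set \<times> ('g, 'v) rep set) set" where
  "eps G X \<phi> \<xi> = (\<lambda>H\<in>finite_subgroups G.
     groth_map (rep_monoid (G\<lparr>carrier := H\<rparr>)) (fibre_class G X \<phi> H) \<xi>)"

end

theory Submission
  imports Defs
begin

text \<open>
  Let \<open>G\<close> be the central extension of \<open>\<int>\<^sup>2 = \<langle>a, b\<rangle>\<close> by \<open>{1, z}\<close> with \<open>a b = z b a\<close>. The plane, with \<open>G\<close> acting through
  translations, is a cocompact classifying space for proper actions, and the finite subgroups are
  \<open>1\<close> and \<open>{1, z}\<close>. Restricting the sign representation of \<open>{1, z}\<close> gives an element of the limit, on which
  the determinant of \<open>z\<close> is \<open>-1\<close>. For a \<open>G\<close>-vector bundle the determinant of \<open>z\<close> on every fibre is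
  positive: the bundle is orientable over a unit square, \<open>a\<close> and \<open>b\<close> change the orientation by a
  constant sign along an edge, and comparing the two ways around the square shows that \<open>z\<close>
  preserves the orientation. As the determinant is multiplicative, this persists for formal
  differences of bundles.
\<close>

text \<open>Conceptually, the orientations of the fibres form a double cover of the plane. The plane
  is simply connected, so the cover is trivial and \<open>G\<close> acts on its two sheets through a
  homomorphism to {1, -1}, which kills the commutator \<open>z\<close>. Only a piece of this
  argument is carried out: an orientation over one unit square, and the signs of two generators
  along its edges. The obstacle is that a bundle offers nothing but local charts. One chart is fixed
  at each point, without any compatibility between them. Changes of chart and group elements are
  then recorded as signs of determinants relative to these arbitrary frames. The cocycle identity
  for such signs holds only near each point, which is why orientability of the square needs a gluing
  argument by bisection. The sign representation is compatible over the orbit category because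
  \<open>z\<close> is central: conjugation is the identity on every finite subgroup, so all
  structure maps are plain restrictions.\<close>

abbreviation lin :: "(real, 'v) module \<Rightarrow> (real, 'w) module \<Rightarrow> ('v \<Rightarrow> 'w) set" where
  "lin \<equiv> module_hom class_ring"

abbreviation vs :: "(real, 'v) module \<Rightarrow> bool" where
  "vs \<equiv> vectorspace class_ring"

lemma lin_iff:
  "f \<in> lin V W \<longleftrightarrow> (\<forall>v\<in>carrier V. f v \<in> carrier W) \<and>
     (\<forall>v\<in>carrier V. \<forall>w\<in>carrier V. f (v \<oplus>\<^bsub>V\<^esub> w) = f v \<oplus>\<^bsub>W\<^esub> f w) \<and>
     (\<forall>r. \<forall>v\<in>carrier V. f (r \<odot>\<^bsub>V\<^esub> v) = r \<odot>\<^bsub>W\<^esub> f v)"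
  by (simp add: module_hom_def Pi_def) blast

lemma vs_module: "vs V \<Longrightarrow> Module.module class_ring V"
  by (simp add: vectorspace_def)

lemma vs_closed:
  assumes "vs V"
  shows "v \<in> carrier V \<Longrightarrow> w \<in> carrier V \<Longrightarrow> v \<oplus>\<^bsub>V\<^esub> w \<in> carrier V"
    and "v \<in> carrier V \<Longrightarrow> r \<odot>\<^bsub>V\<^esub> v \<in> carrier V"
    and "\<zero>\<^bsub>V\<^esub> \<in> carrier V"
proof -
  interpret vectorspace class_ring V by fact
  show "v \<in> carrier V \<Longrightarrow> w \<in> carrier V \<Longrightarrow> v \<oplus>\<^bsub>V\<^esub> w \<in> carrier V"
    and "v \<in> carrier V \<Longrightarrow> r \<odot>\<^bsub>V\<^esub> v \<in> carrier V"
    and "\<zero>\<^bsub>V\<^esub> \<in> carrier V"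
    by auto
qed

lemma lin_comp: "f \<in> lin V W \<Longrightarrow> g \<in> lin W U \<Longrightarrow> g \<circ> f \<in> lin V U"
  by (auto simp: lin_iff)

lemma lin_id: "id \<in> lin V V" "(\<lambda>v. v) \<in> lin V V"
  by (auto simp: lin_iff)

text \<open>Membership in \<open>lin\<close> constrains values on the carrier only, so a composition
  may be exchanged for its restricted version, as group actions require.\<close>

lemma lin_cong:
  assumes "vs V" "\<And>v. v \<in> carrier V \<Longrightarrow> f v = g v" "f \<in> lin V W"
  shows "g \<in> lin V W"
  using assms(3) by (simp add: lin_iff vs_closed[OF assms(1)] assms(2)[symmetric])

lemma lin_inv_into:
  assumes "vs V" "f \<in> lin V W" "bij_betw f (carrier V) (carrier W)"
  shows "inv_into (carrier V) f \<in> lin W V"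
  unfolding lin_iff
proof (intro conjI ballI allI)
  let ?g = "inv_into (carrier V) f"
  have g: "?g w \<in> carrier V" "f (?g w) = w" if "w \<in> carrier W" for w
    using assms(3) that by (auto simp: bij_betw_def inv_into_into f_inv_into_f)
  have gf: "?g (f v) = v" if "v \<in> carrier V" for v
    using assms(3) that by (simp add: bij_betw_inv_into_left)
  show "?g w \<in> carrier V" if "w \<in> carrier W" for w using g that by blast
  fix v w assume vw: "v \<in> carrier W" "w \<in> carrier W"
  then show "?g (v \<oplus>\<^bsub>W\<^esub> w) = ?g v \<oplus>\<^bsub>V\<^esub> ?g w"
    using g[of v] g[of w] gf[of "?g v \<oplus>\<^bsub>V\<^esub> ?g w"] vs_closed[OF assms(1)] assms(2)
    by (auto simp: lin_iff)
next
  let ?g = "inv_into (carrier V) f"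
  fix r v assume v: "v \<in> carrier W"
  have g: "?g v \<in> carrier V" "f (?g v) = v"
    using assms(3) v by (auto simp: bij_betw_def inv_into_into f_inv_into_f)
  have "?g (f (r \<odot>\<^bsub>V\<^esub> ?g v)) = r \<odot>\<^bsub>V\<^esub> ?g v"
    using assms(1,3) g vs_closed by (metis bij_betw_inv_into_left)
  then show "?g (r \<odot>\<^bsub>W\<^esub> v) = r \<odot>\<^bsub>V\<^esub> ?g v"
    using g assms(2) by (auto simp: lin_iff)
qed

section \<open>Coordinates and determinants\<close>

lemma carrier_Rn: "carrier (Rn n) = {x. \<forall>i\<ge>n. x i = 0}"
  by (auto simp: Rn_def topspace_Euclidean_space)

lemma Rn_simps:
  "x \<oplus>\<^bsub>Rn n\<^esub> y = (\<lambda>i. x i + y i)" "c \<odot>\<^bsub>Rn n\<^esub> x = (\<lambda>i. c * x i)" "\<zero>\<^bsub>Rn n\<^esub> = (\<lambda>i. 0)"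
  by (simp_all add: Rn_def)

lemma lin_zero: "f \<in> lin V W \<Longrightarrow> vs V \<Longrightarrow> vs W \<Longrightarrow> f \<zero>\<^bsub>V\<^esub> = \<zero>\<^bsub>W\<^esub>"
  by (rule mod_hom.f0_is_0[of class_ring]) (simp add: mod_hom_def mod_hom_axioms_def vs_module)

lemma vs_Rn: "vs (Rn n)"
proof (rule vs_criteria)
  show "field (class_ring :: real ring)" by (rule class_field)
  show "\<forall>v\<in>carrier (Rn n). \<exists>neg_v\<in>carrier (Rn n). v \<oplus>\<^bsub>Rn n\<^esub> neg_v = \<zero>\<^bsub>Rn n\<^esub>"
  proof
    fix v assume "v \<in> carrier (Rn n)"
    then show "\<exists>neg_v\<in>carrier (Rn n). v \<oplus>\<^bsub>Rn n\<^esub> neg_v = \<zero>\<^bsub>Rn n\<^esub>"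
      by (intro bexI[of _ "\<lambda>i. - v i"]) (auto simp: carrier_Rn Rn_simps)
  qed
qed (simp_all add: carrier_Rn Rn_simps fun_eq_iff distrib_left distrib_right add.assoc mult.assoc)

definition std :: "nat \<Rightarrow> nat \<Rightarrow> real" where
  "std j = (\<lambda>i. if i = j then 1 else 0)"

lemma std_carrier: "j < n \<Longrightarrow> std j \<in> carrier (Rn n)"
  by (auto simp: carrier_Rn std_def)

lemma lin_Rn_step:
  assumes "f \<in> lin (Rn n) W" "x \<in> carrier (Rn n)" "j < n"
  shows "f (x \<oplus>\<^bsub>Rn n\<^esub> c \<odot>\<^bsub>Rn n\<^esub> std j) = f x \<oplus>\<^bsub>W\<^esub> c \<odot>\<^bsub>W\<^esub> f (std j)"
proof -
  have "std j \<in> carrier (Rn n)" "c \<odot>\<^bsub>Rn n\<^esub> std j \<in> carrier (Rn n)"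
    using std_carrier[OF assms(3)] vs_closed(2)[OF vs_Rn] by auto
  then show ?thesis
    using module_hom_add[OF assms(1,2), of "c \<odot>\<^bsub>Rn n\<^esub> std j"] module_hom_smult[OF assms(1), of c "std j"] by simp
qed

text \<open>Adding one multiple of a basis vector at a time is exactly the step that linearity can
  process; this replaces basis expansions.\<close>

lemma Rn_induct [consumes 1, case_names zero step]:
  assumes "x \<in> carrier (Rn n)"
    and "P (\<lambda>i. 0)"
    and "\<And>x c j. x \<in> carrier (Rn n) \<Longrightarrow> j < n \<Longrightarrow> P x \<Longrightarrow> P (x \<oplus>\<^bsub>Rn n\<^esub> c \<odot>\<^bsub>Rn n\<^esub> std j)"
  shows "P x"
proof -
  \<comment> \<open>Induction on the number \<open>k\<close> of leading coordinates that may be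
    nonzero, with \<open>n\<close> fixed, so that all intermediate vectors stay in
    \<open>Rn n\<close>.\<close>
  have "k \<le> n \<Longrightarrow> \<forall>i\<ge>k. x i = 0 \<Longrightarrow> P x" for k x
  proof (induction k arbitrary: x)
    case 0
    then have "x = (\<lambda>i. 0)" by auto
    then show ?case using assms(2) by simp
  next
    case (Suc k)
    let ?y = "x(k := 0)"
    have y: "\<forall>i\<ge>k. ?y i = 0" using Suc.prems by (auto simp: le_Suc_eq Suc_le_eq)
    then have "P ?y" using Suc by auto
    moreover have "?y \<in> carrier (Rn n)" using y Suc.prems by (auto simp: carrier_Rn)
    ultimately have "P (?y \<oplus>\<^bsub>Rn n\<^esub> x k \<odot>\<^bsub>Rn n\<^esub> std k)" using assms(3) Suc.prems by auto
    moreover have "?y \<oplus>\<^bsub>Rn n\<^esub> x k \<odot>\<^bsub>Rn n\<^esub> std k = x" by (auto simp: std_def Rn_simps)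
    ultimately show ?case by simp
  qed
  then show ?thesis using assms(1) by (auto simp: carrier_Rn)
qed

lemma lin_Rn_expand:
  assumes "f \<in> lin (Rn n) (Rn m)" "x \<in> carrier (Rn n)"
  shows "f x i = (\<Sum>j<n. x j * f (std j) i)"
  using assms(2)
proof (induction x rule: Rn_induct)
  case zero
  show ?case using lin_zero[OF assms(1) vs_Rn vs_Rn] by (simp add: Rn_simps)
next
  case (step x c j)
  have "f (x \<oplus>\<^bsub>Rn n\<^esub> c \<odot>\<^bsub>Rn n\<^esub> std j) = f x \<oplus>\<^bsub>Rn m\<^esub> c \<odot>\<^bsub>Rn m\<^esub> f (std j)"
    by (rule lin_Rn_step[OF assms(1) step(1,2)])
  moreover have "(\<Sum>k<n. (x k + c * std j k) * f (std k) i)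
      = (\<Sum>k<n. x k * f (std k) i) + (\<Sum>k<n. if k = j then c * f (std j) i else 0)"
    unfolding sum.distrib[symmetric] by (rule sum.cong) (auto simp: std_def algebra_simps)
  ultimately show ?case using step by (simp add: Rn_simps)
qed

definition lmat :: "nat \<Rightarrow> nat \<Rightarrow> ((nat \<Rightarrow> real) \<Rightarrow> nat \<Rightarrow> real) \<Rightarrow> real mat" where
  "lmat m n f = mat m n (\<lambda>(i, j). f (std j) i)"

lemma lmat_carrier [simp]: "lmat m n f \<in> carrier_mat m n"
  by (simp add: lmat_def)

lemma lmat_comp:
  assumes "f \<in> lin (Rn n) (Rn m)" "g \<in> lin (Rn m) (Rn l)"
  shows "lmat l n (g \<circ> f) = lmat l m g * lmat m n f"
proof (rule eq_matI)
  fix i j assume "i < dim_row (lmat l m g * lmat m n f)" "j < dim_col (lmat l m g * lmat m n f)"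
  then have ij: "i < l" "j < n" by (auto simp: lmat_def)
  have "f (std j) \<in> carrier (Rn m)" using assms(1) std_carrier[OF ij(2)] by (auto simp: lin_iff)
  then show "lmat l n (g \<circ> f) $$ (i, j) = (lmat l m g * lmat m n f) $$ (i, j)"
    using ij lin_Rn_expand[OF assms(2), of "f (std j)" i]
    by (simp add: lmat_def times_mat_def scalar_prod_def mult.commute lessThan_atLeast0)
qed (auto simp: lmat_def)

lemma lmat_id:
  assumes "\<And>v. v \<in> carrier (Rn n) \<Longrightarrow> f v = v"
  shows "lmat n n f = 1\<^sub>m n"
  by (rule eq_matI) (auto simp: lmat_def assms std_carrier, auto simp: std_def)

definition ldet :: "nat \<Rightarrow> ((nat \<Rightarrow> real) \<Rightarrow> nat \<Rightarrow> real) \<Rightarrow> real" where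
  "ldet n f = Determinant.det (lmat n n f)"

lemma ldet_cong: "(\<And>v. v \<in> carrier (Rn n) \<Longrightarrow> f v = g v) \<Longrightarrow> ldet n f = ldet n g"
  unfolding ldet_def lmat_def by (intro arg_cong[of _ _ Determinant.det] cong_mat) (auto simp: std_carrier)

lemma ldet_comp:
  assumes "f \<in> lin (Rn n) (Rn n)" "g \<in> lin (Rn n) (Rn n)"
  shows "ldet n (g \<circ> f) = ldet n g * ldet n f"
  unfolding ldet_def lmat_comp[OF assms] by (rule det_mult[of _ n]) auto

lemma ldet_id: "(\<And>v. v \<in> carrier (Rn n) \<Longrightarrow> f v = v) \<Longrightarrow> ldet n f = 1"
  by (simp add: ldet_def lmat_id)

text \<open>A trace argument: for an inverse \<open>g\<close>, the composites on both sides are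
  identities with traces \<open>m\<close> and \<open>n\<close>, and both traces are the same double
  sum of products of matrix entries.\<close>

lemma Rn_iso_dim:
  assumes f: "f \<in> lin (Rn n) (Rn m)" "bij_betw f (carrier (Rn n)) (carrier (Rn m))"
  shows "n = m"
proof -
  let ?g = "inv_into (carrier (Rn n)) f"
  have g: "?g \<in> lin (Rn m) (Rn n)" by (rule lin_inv_into[OF vs_Rn f])
  have fg: "(f \<circ> ?g) v = v" if "v \<in> carrier (Rn m)" for v
    using f(2) that by (simp add: bij_betw_inv_into_right)
  have gf: "(?g \<circ> f) v = v" if "v \<in> carrier (Rn n)" for v
    using f(2) that by (simp add: bij_betw_inv_into_left)
  have 1: "(\<Sum>j<n. f (std j) i * ?g (std i) j) = 1" if "i < m" for i
  proof -
    have "?g (std i) \<in> carrier (Rn n)" using g std_carrier[OF that] by (auto simp: lin_iff)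
    from lin_Rn_expand[OF f(1) this, of i] show ?thesis
      using fg[OF std_carrier[OF that]] by (simp add: std_def mult.commute)
  qed
  have 2: "(\<Sum>i<m. f (std j) i * ?g (std i) j) = 1" if "j < n" for j
  proof -
    have "f (std j) \<in> carrier (Rn m)" using f std_carrier[OF that] by (auto simp: lin_iff)
    from lin_Rn_expand[OF g this, of j] show ?thesis
      using gf[OF std_carrier[OF that]] by (simp add: std_def)
  qed
  have "real m = (\<Sum>i<m. \<Sum>j<n. f (std j) i * ?g (std i) j)" using 1 by simp
  also have "\<dots> = (\<Sum>j<n. \<Sum>i<m. f (std j) i * ?g (std i) j)" by (rule sum.swap)
  also have "\<dots> = real n" using 2 by simp
  finally show ?thesis by simp
qed

text \<open>By the Leibniz formula the determinant is a polynomial in the matrix entries.\<close>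

lemma ldet_continuous:
  assumes "\<And>i j. i < n \<Longrightarrow> j < n \<Longrightarrow> continuous_map X euclideanreal (\<lambda>x. f x (std j) i)"
  shows "continuous_map X euclideanreal (\<lambda>x. ldet n (f x))"
proof -
  let ?P = "{p. p permutes {0..<n}}"
  have p: "p i < n" if "p \<in> ?P" "i \<in> {0..<n}" for p i
    using that permutes_in_image[of p "{0..<n}" i] by simp
  have "ldet n (f x) = (\<Sum>p\<in>?P. signof p * (\<Prod>i = 0..<n. f x (std (p i)) i))" for x
  proof -
    have "ldet n (f x) = (\<Sum>p\<in>?P. signof p * (\<Prod>i = 0..<n. lmat n n (f x) $$ (i, p i)))"
      by (simp add: ldet_def Determinant.det_def lmat_def)
    also have "\<dots> = (\<Sum>p\<in>?P. signof p * (\<Prod>i = 0..<n. f x (std (p i)) i))"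
      by (intro sum.cong prod.cong refl arg_cong2[of _ _ _ _ "(*)"]) (simp add: lmat_def p)
    finally show ?thesis .
  qed
  moreover have "continuous_map X euclideanreal
     (\<lambda>x. \<Sum>p\<in>?P. signof p * (\<Prod>i = 0..<n. f x (std (p i)) i))"
  proof (intro continuous_map_sum continuous_map_real_mult continuous_map_prod)
    show "continuous_map X euclideanreal (\<lambda>x. f x (std (p i)) i)" if "p \<in> ?P" "i \<in> {0..<n}" for p i
      using that p by (intro assms) auto
  qed (simp_all add: finite_permutations)
  ultimately show ?thesis by simp
qed

section \<open>Frames\<close>

text \<open>An isomorphism with \<open>Rn n\<close> serves both purposes at hand: it witnesses
  finite dimension of a representation, and it is what a bundle chart induces on each fibre.\<close>

definition frame :: "(real, 'v) module \<Rightarrow> nat \<Rightarrow> ('v \<Rightarrow> nat \<Rightarrow> real) \<Rightarrow> bool" where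
  "frame V n h \<longleftrightarrow> vs V \<and> h \<in> lin V (Rn n) \<and> bij_betw h (carrier V) (carrier (Rn n))"

lemma frame_inv:
  assumes "frame V n h"
  shows "inv_into (carrier V) h \<in> lin (Rn n) V"
    and "bij_betw (inv_into (carrier V) h) (carrier (Rn n)) (carrier V)"
    and "v \<in> carrier V \<Longrightarrow> inv_into (carrier V) h (h v) = v"
    and "x \<in> carrier (Rn n) \<Longrightarrow> h (inv_into (carrier V) h x) = x"
    and "x \<in> carrier (Rn n) \<Longrightarrow> inv_into (carrier V) h x \<in> carrier V"
    and "v \<in> carrier V \<Longrightarrow> h v \<in> carrier (Rn n)"
  using assms lin_inv_into[of V h "Rn n"] bij_betw_inv_into[of h "carrier V" "carrier (Rn n)"]
  by (auto simp: frame_def bij_betw_inv_into_left bij_betw_inv_into_right inv_into_into bij_betw_def)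

lemma frame_Rn: "frame (Rn n) n (\<lambda>v. v)"
  by (auto simp: frame_def vs_Rn lin_id bij_betw_def)

lemma frame_comp:
  assumes "frame W n h" "vs V" "f \<in> lin V W" "bij_betw f (carrier V) (carrier W)"
  shows "frame V n (h \<circ> f)"
  using assms by (auto simp: frame_def intro: lin_comp bij_betw_trans)

lemma frame_dim_eq:
  assumes "frame V n h" "frame W m k" "T \<in> lin V W" "bij_betw T (carrier V) (carrier W)"
  shows "n = m"
proof (rule Rn_iso_dim)
  show "k \<circ> (T \<circ> inv_into (carrier V) h) \<in> lin (Rn n) (Rn m)"
    using assms frame_inv(1)[OF assms(1)] by (intro lin_comp) (auto simp: frame_def)
  show "bij_betw (k \<circ> (T \<circ> inv_into (carrier V) h)) (carrier (Rn n)) (carrier (Rn m))"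
    using assms frame_inv(2)[OF assms(1)] by (auto simp: frame_def intro: bij_betw_trans)
qed

lemma vs_span_submodule:
  assumes "vs V" "A \<subseteq> carrier V"
  shows "submodule class_ring (LinearCombinations.module.span class_ring V A) V"
  using LinearCombinations.module.span_is_submodule[OF vs_module[OF assms(1)] assms(2)] .

lemma frame_fin_dim:
  assumes fr: "frame V n h"
  shows "vectorspace.fin_dim class_ring V"
proof -
  have V: "vs V" using fr by (simp add: frame_def)
  interpret vectorspace class_ring V by fact
  let ?g = "inv_into (carrier V) h"
  let ?A = "?g ` std ` {..<n}"
  have A: "?A \<subseteq> carrier V" "finite ?A" using frame_inv(5)[OF fr] std_carrier by auto
  have S: "\<zero>\<^bsub>V\<^esub> \<in> span ?A" "span ?A \<subseteq> carrier V"
    "v \<in> span ?A \<Longrightarrow> w \<in> span ?A \<Longrightarrow> v \<oplus>\<^bsub>V\<^esub> w \<in> span ?A" "v \<in> span ?A \<Longrightarrow> c \<odot>\<^bsub>V\<^esub> v \<in> span ?A" for v w c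
    using vs_span_submodule[OF V A(1)] by (auto simp: submodule_def)
  have "?g x \<in> span ?A" if "x \<in> carrier (Rn n)" for x
    using that
  proof (induction x rule: Rn_induct)
    case zero
    show ?case using lin_zero[OF frame_inv(1)[OF fr] vs_Rn V] S(1) by (simp add: Rn_simps)
  next
    case (step x c j)
    have "?g (x \<oplus>\<^bsub>Rn n\<^esub> c \<odot>\<^bsub>Rn n\<^esub> std j) = ?g x \<oplus>\<^bsub>V\<^esub> c \<odot>\<^bsub>V\<^esub> ?g (std j)"
      by (rule lin_Rn_step[OF frame_inv(1)[OF fr] step(1,2)])
    moreover have "?g (std j) \<in> span ?A" using in_own_span[OF A(1)] step by blast
    ultimately show ?case using step S(3,4) by simp
  qed
  then have "?g (h v) \<in> span ?A" if "v \<in> carrier V" for v using frame_inv(6)[OF fr that] by blast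
  then have "carrier V \<subseteq> span ?A" using frame_inv(3)[OF fr] by auto
  then have "span ?A = carrier V" by (rule subset_antisym[OF S(2)])
  then show ?thesis unfolding fin_dim_def by (intro exI[of _ ?A] conjI A)
qed

lemma fin_dim_frame:
  assumes V: "vs V" and "vectorspace.fin_dim class_ring V"
  obtains n h where "frame V n h"
proof -
  interpret vectorspace class_ring V by fact
  obtain A where A: "finite A" "basis A" using finite_basis_exists assms(2) by blast
  then have Ac: "A \<subseteq> carrier V" by (simp add: basis_def)
  obtain \<beta> where \<beta>: "bij_betw \<beta> {..<card A} A"
    using A(1) ex_bij_betw_nat_finite lessThan_atLeast0 by metis
  define n where "n = card A"
  define \<gamma> where "\<gamma> = inv_into {..<n} \<beta>"
  have \<gamma>: "\<gamma> a < n" "\<beta> (\<gamma> a) = a" if "a \<in> A" for a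
    using \<beta> that bij_betw_inv_into_right[OF \<beta>] bij_betw_inv_into[OF \<beta>]
    by (auto simp: \<gamma>_def n_def bij_betw_def)
  have \<gamma>\<beta>: "\<gamma> (\<beta> i) = i" "\<beta> i \<in> A" if "i < n" for i
    using \<beta> that by (auto simp: \<gamma>_def n_def bij_betw_def)
  define g where "g = (\<lambda>x :: nat \<Rightarrow> real. lincomb (\<lambda>a. x (\<gamma> a)) A)"
  have crit: "\<exists>!a. a \<in> A \<rightarrow>\<^sub>E UNIV \<and> lincomb a A = v" if "v \<in> carrier V" for v
    using basis_criterion[OF A(1) Ac] A(2) that by auto
  have gc: "g x \<in> carrier V" for x unfolding g_def by (rule lincomb_closed) (use Ac in auto)
  have "g \<in> lin (Rn n) V"
    unfolding lin_iff
  proof (intro conjI ballI allI)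
    show "g x \<in> carrier V" for x by (rule gc)
    show "g (x \<oplus>\<^bsub>Rn n\<^esub> y) = g x \<oplus>\<^bsub>V\<^esub> g y" for x y
      using lincomb_sum[OF A(1) Ac, of "\<lambda>a. x (\<gamma> a)" "\<lambda>a. y (\<gamma> a)"] by (simp add: g_def Rn_simps)
    show "g (r \<odot>\<^bsub>Rn n\<^esub> x) = r \<odot>\<^bsub>V\<^esub> g x" for r x
      using lincomb_smult[OF Ac, of "\<lambda>a. x (\<gamma> a)" r] by (simp add: g_def Rn_simps)
  qed
  moreover have "bij_betw g (carrier (Rn n)) (carrier V)"
  proof (rule bij_betwI')
    fix x y assume xy: "x \<in> carrier (Rn n)" "y \<in> carrier (Rn n)"
    show "(g x = g y) = (x = y)"
    proof
      assume eq: "g x = g y"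
      \<comment> \<open>Coefficients are unique only among functions extensional on
        \<open>A\<close>, so they are restricted before being compared.\<close>
      let ?r = "\<lambda>x. restrict (\<lambda>a. x (\<gamma> a)) A"
      have "lincomb (?r x) A = g x" "lincomb (?r y) A = g y" for x y
        unfolding g_def using Ac by (auto intro!: lincomb_cong)
      then have req: "?r x = ?r y"
        using crit[OF gc[of x]] eq by (metis (no_types, lifting) UNIV_I restrict_PiE_iff)
      have "x i = y i" if "i < n" for i
        using fun_cong[OF req, of "\<beta> i"] \<gamma>\<beta>[OF that] by simp
      then show "x = y" using xy by (intro ext) (metis (mono_tags) carrier_Rn mem_Collect_eq not_le)
    qed auto
  next
    show "g x \<in> carrier V" for x by (rule gc)
  next
    fix v assume "v \<in> carrier V"
    then obtain a where a: "lincomb a A = v" using crit by blast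
    let ?x = "\<lambda>i. if i < n then a (\<beta> i) else 0"
    have "g ?x = lincomb a A"
      unfolding g_def using Ac \<gamma> by (intro lincomb_cong) auto
    then show "\<exists>x\<in>carrier (Rn n). v = g x"
      using a by (intro bexI[of _ ?x]) (auto simp: carrier_Rn)
  qed
  ultimately have "frame V n (inv_into (carrier (Rn n)) g)"
    unfolding frame_def by (intro conjI V lin_inv_into[OF vs_Rn] bij_betw_inv_into)
  then show thesis by (rule that)
qed

text \<open>The determinant of the matrix of \<open>T\<close> in a frame of the source and a frame
  of the target. Between different fibres its value depends on both frames, and its sign is
  meaningful only relative to them.\<close>

definition rdet :: "nat \<Rightarrow> (real, 'v) module \<Rightarrow> ('v \<Rightarrow> nat \<Rightarrow> real) \<Rightarrow> ('w \<Rightarrow> nat \<Rightarrow> real) \<Rightarrow> ('v \<Rightarrow> 'w) \<Rightarrow> real" where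
  "rdet n V h k T = ldet n (k \<circ> T \<circ> inv_into (carrier V) h)"

lemma rdet_comp:
  assumes "frame V n h" "frame W n k" "frame U n l" "T \<in> lin V W" "S \<in> lin W U"
  shows "rdet n V h l (S \<circ> T) = rdet n W k l S * rdet n V h k T"
proof -
  have h: "inv_into (carrier V) h \<in> lin (Rn n) V" "inv_into (carrier W) k \<in> lin (Rn n) W"
    using assms frame_inv(1) by blast+
  have kl: "k \<in> lin W (Rn n)" "l \<in> lin U (Rn n)" using assms by (auto simp: frame_def)
  have "ldet n (l \<circ> (S \<circ> T) \<circ> inv_into (carrier V) h)
      = ldet n ((l \<circ> S \<circ> inv_into (carrier W) k) \<circ> (k \<circ> T \<circ> inv_into (carrier V) h))"
    by (rule ldet_cong) (use h assms frame_inv(3)[OF assms(2)] in \<open>auto simp: lin_iff\<close>)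
  also have "\<dots> = ldet n (l \<circ> S \<circ> inv_into (carrier W) k) * ldet n (k \<circ> T \<circ> inv_into (carrier V) h)"
    using h kl assms by (intro ldet_comp lin_comp) auto
  finally show ?thesis by (simp add: rdet_def)
qed

lemma rdet_id:
  assumes "frame V n h" "\<And>v. v \<in> carrier V \<Longrightarrow> T v = v"
  shows "rdet n V h h T = 1"
  unfolding rdet_def by (rule ldet_id) (use assms frame_inv[OF assms(1)] in auto)

lemma rdet_cong: "frame V n h \<Longrightarrow> (\<And>v. v \<in> carrier V \<Longrightarrow> T v = S v) \<Longrightarrow> rdet n V h k T = rdet n V h k S"
  unfolding rdet_def by (rule ldet_cong) (simp add: frame_inv(5))

lemma rdet_nonzero:
  assumes "frame V n h" "frame W n k" "T \<in> lin V W" "bij_betw T (carrier V) (carrier W)"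
  shows "rdet n V h k T \<noteq> 0"
proof -
  have V: "vs V" using assms by (simp add: frame_def)
  have "rdet n V h h (inv_into (carrier V) T \<circ> T)
      = rdet n W k h (inv_into (carrier V) T) * rdet n V h k T"
    by (rule rdet_comp[OF assms(1,2,1,3) lin_inv_into[OF V assms(3,4)]])
  moreover have "rdet n V h h (inv_into (carrier V) T \<circ> T) = 1"
    by (rule rdet_id[OF assms(1)]) (use assms(4) in \<open>simp add: bij_betw_inv_into_left\<close>)
  ultimately show ?thesis by auto
qed

section \<open>A determinant of endomorphisms that does not depend on the frame\<close>

definition vdet :: "(real, 'v) module \<Rightarrow> ('v \<Rightarrow> 'v) \<Rightarrow> real" where
  "vdet V T = (case SOME p. frame V (fst p) (snd p) of (n, h) \<Rightarrow> rdet n V h h T)"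

text \<open>Taking determinants of \<open>f o T = S o f\<close> puts the nonzero determinant of
  \<open>f\<close> on both sides, where it cancels. The frames must first be shown to have equal
  length.\<close>

lemma rdet_conj:
  assumes fr: "frame V n h" "frame W m k" and f: "f \<in> lin V W" "bij_betw f (carrier V) (carrier W)"
    and T: "T \<in> lin V V" and S: "S \<in> lin W W" and eq: "\<And>v. v \<in> carrier V \<Longrightarrow> f (T v) = S (f v)"
  shows "rdet n V h h T = rdet m W k k S"
proof -
  have nm: "m = n" using frame_dim_eq[OF fr f] by simp
  note fr2 = fr(2)[unfolded nm]
  have "rdet n V h k (f \<circ> T) = rdet n V h k (S \<circ> f)" by (rule rdet_cong[OF fr(1)]) (use eq in auto)
  then have "rdet n V h k f * rdet n V h h T = rdet n W k k S * rdet n V h k f"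
    using rdet_comp[OF fr(1,1) fr2 T f(1)] rdet_comp[OF fr(1) fr2 fr2 f(1) S] by simp
  then show ?thesis using rdet_nonzero[OF fr(1) fr2 f] nm by simp
qed

lemma vdet_eq:
  assumes "frame V n h" "T \<in> lin V V"
  shows "vdet V T = rdet n V h h T"
proof -
  obtain m k where p: "(SOME p. frame V (fst p) (snd p)) = (m, k)" by fastforce
  then have "frame V m k" using someI[of "\<lambda>p. frame V (fst p) (snd p)" "(n, h)"] assms by simp
  then have "rdet m V k k T = rdet n V h h T"
    using rdet_conj[of V m k V n h "\<lambda>v. v"] assms by (simp add: lin_id bij_betw_def)
  then show ?thesis by (simp add: vdet_def p)
qed

lemma vdet_conj:
  assumes "frame V n h" "frame W m k" "f \<in> lin V W" "bij_betw f (carrier V) (carrier W)"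
    and "T \<in> lin V V" "S \<in> lin W W" "\<And>v. v \<in> carrier V \<Longrightarrow> f (T v) = S (f v)"
  shows "vdet V T = vdet W S"
  using vdet_eq[OF assms(1,5)] vdet_eq[OF assms(2,6)] rdet_conj[OF assms] by simp

lemma direct_sum_simps [simp]:
  "carrier (direct_sum V W) = carrier V \<times> carrier W"
  "p \<oplus>\<^bsub>direct_sum V W\<^esub> q = (fst p \<oplus>\<^bsub>V\<^esub> fst q, snd p \<oplus>\<^bsub>W\<^esub> snd q)"
  "r \<odot>\<^bsub>direct_sum V W\<^esub> p = (r \<odot>\<^bsub>V\<^esub> fst p, r \<odot>\<^bsub>W\<^esub> snd p)"
  "\<zero>\<^bsub>direct_sum V W\<^esub> = (\<zero>\<^bsub>V\<^esub>, \<zero>\<^bsub>W\<^esub>)"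
  by (simp_all add: direct_sum_def)

definition sum_frame ::
  "nat \<Rightarrow> ('v \<Rightarrow> nat \<Rightarrow> real) \<Rightarrow> ('w \<Rightarrow> nat \<Rightarrow> real) \<Rightarrow> 'v \<times> 'w \<Rightarrow> nat \<Rightarrow> real" where
  "sum_frame n h k = (\<lambda>(v, w) i. if i < n then h v i else k w (i - n))"

lemma frame_sum:
  assumes "frame V n h" "frame W m k"
  shows "frame (direct_sum V W) (n + m) (sum_frame n h k)"
  unfolding frame_def
proof (intro conjI)
  show "vs (direct_sum V W)" using assms by (auto simp: frame_def intro: direct_sum_is_vs)
  show "sum_frame n h k \<in> lin (direct_sum V W) (Rn (n + m))"
    using assms by (auto simp: frame_def lin_iff sum_frame_def carrier_Rn Rn_simps)
  show "bij_betw (sum_frame n h k) (carrier (direct_sum V W)) (carrier (Rn (n + m)))"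
  proof (rule bij_betwI)
    let ?g = "\<lambda>x. (inv_into (carrier V) h (\<lambda>i. if i < n then x i else 0),
        inv_into (carrier W) k (\<lambda>i. x (n + i)))"
    show "sum_frame n h k \<in> carrier (direct_sum V W) \<rightarrow> carrier (Rn (n + m))"
      using frame_inv(6)[OF assms(1)] frame_inv(6)[OF assms(2)]
      by (auto simp: sum_frame_def carrier_Rn)
    have c: "(\<lambda>i. if i < n then x i else 0) \<in> carrier (Rn n)" "(\<lambda>i. x (n + i)) \<in> carrier (Rn m)"
      if "x \<in> carrier (Rn (n + m))" for x
      using that by (auto simp: carrier_Rn)
    show "?g \<in> carrier (Rn (n + m)) \<rightarrow> carrier (direct_sum V W)"
      by (intro Pi_I) (simp add: c frame_inv(5)[OF assms(1)] frame_inv(5)[OF assms(2)])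
    show "sum_frame n h k (?g x) = x" if "x \<in> carrier (Rn (n + m))" for x
      by (simp add: sum_frame_def frame_inv(4)[OF assms(1) c(1)[OF that]]
          frame_inv(4)[OF assms(2) c(2)[OF that]] fun_eq_iff)
    show "?g (sum_frame n h k p) = p" if pc: "p \<in> carrier (direct_sum V W)" for p
    proof -
      obtain v w where p: "p = (v, w)" "v \<in> carrier V" "w \<in> carrier W" using pc by auto
      have "(\<lambda>i. if i < n then sum_frame n h k p i else 0) = h v"
        "(\<lambda>i. sum_frame n h k p (n + i)) = k w"
        using frame_inv(6)[OF assms(1) p(2)] by (auto simp: sum_frame_def p carrier_Rn fun_eq_iff)
      then show ?thesis using p frame_inv(3)[OF assms(1)] frame_inv(3)[OF assms(2)] by simp
    qed
  qed
qed

lemma lin_sum: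
  assumes "T \<in> lin V V" "S \<in> lin W W" "vs V" "vs W"
  shows "(\<lambda>p\<in>carrier V \<times> carrier W. (T (fst p), S (snd p))) \<in> lin (direct_sum V W) (direct_sum V W)"
  using assms(1,2) unfolding lin_iff direct_sum_simps
  by (intro conjI ballI allI) (auto simp: vs_closed[OF assms(3)] vs_closed[OF assms(4)])

text \<open>In the concatenated frame the matrix is block diagonal.\<close>

lemma vdet_sum:
  assumes fr: "frame V n h" "frame W m k" and T: "T \<in> lin V V" and S: "S \<in> lin W W"
  shows "vdet (direct_sum V W) (\<lambda>p\<in>carrier V \<times> carrier W. (T (fst p), S (snd p))) = vdet V T * vdet W S"
proof -
  let ?R = "\<lambda>p\<in>carrier V \<times> carrier W. (T (fst p), S (snd p))"
  let ?h = "sum_frame n h k"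
  let ?D = "direct_sum V W"
  let ?T = "h \<circ> T \<circ> inv_into (carrier V) h" and ?S = "k \<circ> S \<circ> inv_into (carrier W) k"
  note fs = frame_sum[OF fr]
  have "?R \<in> lin ?D ?D" by (rule lin_sum[OF T S]) (use fr in \<open>auto simp: frame_def\<close>)
  then have v: "vdet ?D ?R = rdet (n + m) ?D ?h ?h ?R" by (rule vdet_eq[OF fs])
  have B: "lmat (n + m) (n + m) (?h \<circ> ?R \<circ> inv_into (carrier ?D) ?h)
    = four_block_mat (lmat n n ?T) (0\<^sub>m n m) (0\<^sub>m m n) (lmat m m ?S)"
  proof (rule eq_matI)
    fix i j
    assume "i < dim_row (four_block_mat (lmat n n ?T) (0\<^sub>m n m) (0\<^sub>m m n) (lmat m m ?S))"
      "j < dim_col (four_block_mat (lmat n n ?T) (0\<^sub>m n m) (0\<^sub>m m n) (lmat m m ?S))"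
    then have ij: "i < n + m" "j < n + m" by (auto simp: lmat_def)
    have z0: "h \<zero>\<^bsub>V\<^esub> = (\<lambda>i. 0)" "k \<zero>\<^bsub>W\<^esub> = (\<lambda>i. 0)" "T \<zero>\<^bsub>V\<^esub> = \<zero>\<^bsub>V\<^esub>" "S \<zero>\<^bsub>W\<^esub> = \<zero>\<^bsub>W\<^esub>"
      using lin_zero[OF _ _ vs_Rn, of h V n] lin_zero[OF _ _ vs_Rn, of k W m] lin_zero[OF T] lin_zero[OF S] fr
      by (auto simp: frame_def Rn_simps)
    have V0: "\<zero>\<^bsub>V\<^esub> \<in> carrier V" "\<zero>\<^bsub>W\<^esub> \<in> carrier W" using fr vs_closed(3) by (auto simp: frame_def)
    \<comment> \<open>The inverse of the concatenated frame is evaluated by exhibiting a preimage of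
      \<open>std j\<close>: a vector with zero second component for \<open>j < n\<close>, with zero
      first component otherwise.\<close>
    have inv: "inv_into (carrier ?D) ?h (std j) = p" if "?h p = std j" "p \<in> carrier ?D" for p
      using frame_inv(3)[OF fs that(2)] that(1) by simp
    show "lmat (n + m) (n + m) (?h \<circ> ?R \<circ> inv_into (carrier ?D) ?h) $$ (i, j) =
        four_block_mat (lmat n n ?T) (0\<^sub>m n m) (0\<^sub>m m n) (lmat m m ?S) $$ (i, j)"
    proof (cases "j < n")
      case True
      let ?v = "inv_into (carrier V) h (std j)"
      have v: "?v \<in> carrier V" "h ?v = std j" using frame_inv(4,5)[OF fr(1) std_carrier[OF True]] by auto
      have "inv_into (carrier ?D) ?h (std j) = (?v, \<zero>\<^bsub>W\<^esub>)"
        by (rule inv) (use v V0 True in \<open>auto simp: sum_frame_def z0 std_def\<close>)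
      then show ?thesis using ij True v V0 by (simp add: lmat_def sum_frame_def z0)
    next
      case False
      let ?w = "inv_into (carrier W) k (std (j - n))"
      have j: "j - n < m" using False ij by auto
      have w: "?w \<in> carrier W" "k ?w = std (j - n)" using frame_inv(4,5)[OF fr(2) std_carrier[OF j]] by auto
      have "inv_into (carrier ?D) ?h (std j) = (\<zero>\<^bsub>V\<^esub>, ?w)"
        by (rule inv) (simp_all add: sum_frame_def z0 w V0 fun_eq_iff, use False in \<open>auto simp: std_def\<close>)
      then show ?thesis using ij False w V0 by (simp add: lmat_def sum_frame_def z0)
    qed
  qed (auto simp: lmat_def)
  have "vdet ?D ?R = ldet n ?T * ldet m ?S"
    unfolding v rdet_def ldet_def B by (rule det_four_block_mat_upper_right_zero) auto
  also have "\<dots> = vdet V T * vdet W S"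
    using vdet_eq[OF fr(1) T] vdet_eq[OF fr(2) S] by (simp add: rdet_def)
  finally show ?thesis .
qed

section \<open>Representations up to isomorphism\<close>

text \<open>\<open>group_action\<close> is a homomorphism into the group of bijections of
  \<open>E\<close>, whose elements are extensional; this turns it into pointwise conditions that can
  be checked by simplification.\<close>

lemma group_action_iff:
  assumes "Group.group G"
  shows "group_action G E \<phi> \<longleftrightarrow>
    (\<forall>g\<in>carrier G. \<phi> g \<in> extensional E \<and> (\<forall>x\<in>E. \<phi> g x \<in> E)) \<and>
    (\<forall>x\<in>E. \<phi> \<one>\<^bsub>G\<^esub> x = x) \<and>
    (\<forall>g\<in>carrier G. \<forall>h\<in>carrier G. \<forall>x\<in>E. \<phi> (g \<otimes>\<^bsub>G\<^esub> h) x = \<phi> g (\<phi> h x))" (is "?L \<longleftrightarrow> ?R")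
proof
  assume ?L
  then interpret group_action G E \<phi> .
  have "\<phi> g \<in> extensional E" if "g \<in> carrier G" for g
    using bij_prop0[OF that] by (simp add: Bij_def)
  moreover have "\<phi> \<one>\<^bsub>G\<^esub> x = x" if "x \<in> E" for x
    using fun_cong[OF id_eq_one, of x] that by simp
  ultimately show ?R
    using element_image composition_rule by blast
next
  interpret Group.group G by fact
  assume R: ?R
  have bij: "bij_betw (\<phi> g) E E" if "g \<in> carrier G" for g
  proof (rule bij_betwI[of _ _ _ "\<phi> (inv\<^bsub>G\<^esub> g)"])
    show "\<phi> (inv\<^bsub>G\<^esub> g) (\<phi> g x) = x" if "x \<in> E" for x
      using R \<open>g \<in> carrier G\<close> that inv_closed l_inv by metis
    show "\<phi> g (\<phi> (inv\<^bsub>G\<^esub> g) x) = x" if "x \<in> E" for x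
      using R \<open>g \<in> carrier G\<close> that inv_closed r_inv by metis
  qed (use R that in auto)
  then have Bij: "\<phi> g \<in> Bij E" if "g \<in> carrier G" for g
    using R that by (simp add: Bij_def)
  have "\<phi> (g \<otimes>\<^bsub>G\<^esub> h) = compose E (\<phi> g) (\<phi> h)" if "g \<in> carrier G" "h \<in> carrier G" for g h
  proof (rule extensionalityI[of _ E])
    show "\<phi> (g \<otimes>\<^bsub>G\<^esub> h) \<in> extensional E" using R that by simp
    show "\<phi> (g \<otimes>\<^bsub>G\<^esub> h) x = compose E (\<phi> g) (\<phi> h) x" if "x \<in> E" for x
      using R \<open>g \<in> carrier G\<close> \<open>h \<in> carrier G\<close> that by (simp add: compose_def)
  qed simp
  then have "\<phi> \<in> hom G (BijGroup E)"
    using Bij by (simp add: hom_def BijGroup_def)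
  then show ?L
    by (simp add: group_action_def group_hom_def group_hom_axioms_def group_BijGroup is_group)
qed

lemma real_rep_iff:
  assumes "Group.group G"
  shows "real_rep G (V, \<rho>) \<longleftrightarrow> (\<exists>n h. frame V n h) \<and>
    (\<forall>g\<in>carrier G. \<rho> g \<in> extensional (carrier V) \<and> \<rho> g \<in> lin V V) \<and>
    (\<forall>v\<in>carrier V. \<rho> \<one>\<^bsub>G\<^esub> v = v) \<and>
    (\<forall>g\<in>carrier G. \<forall>h\<in>carrier G. \<forall>v\<in>carrier V. \<rho> (g \<otimes>\<^bsub>G\<^esub> h) v = \<rho> g (\<rho> h v))"
proof -
  have "vs V \<and> vectorspace.fin_dim class_ring V \<longleftrightarrow> (\<exists>n h. frame V n h)"
    using fin_dim_frame frame_fin_dim by (metis frame_def)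
  moreover have "\<rho> g \<in> lin V V \<Longrightarrow> v \<in> carrier V \<Longrightarrow> \<rho> g v \<in> carrier V" for g v
    by (simp add: lin_iff)
  ultimately show ?thesis
    unfolding real_rep_def prod.case group_action_iff[OF assms] by blast
qed

lemma rep_iso_refl: "rep_iso G R R"
  by (auto simp: rep_iso_def lin_id bij_betw_def intro!: bexI[of _ "\<lambda>v. v"] split: prod.splits)

lemma rep_iso_trans:
  assumes "rep_iso G R S" "rep_iso G S T"
  shows "rep_iso G R T"
proof -
  obtain U \<rho> V \<sigma> W \<tau> where e: "R = (U, \<rho>)" "S = (V, \<sigma>)" "T = (W, \<tau>)" by (metis prod.exhaust)
  obtain f g where f: "f \<in> lin U V" "bij_betw f (carrier U) (carrier V)"
    "\<forall>x\<in>carrier G. \<forall>v\<in>carrier U. f (\<rho> x v) = \<sigma> x (f v)"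
    and g: "g \<in> lin V W" "bij_betw g (carrier V) (carrier W)"
    "\<forall>x\<in>carrier G. \<forall>v\<in>carrier V. g (\<sigma> x v) = \<tau> x (g v)"
    using assms by (auto simp: rep_iso_def e)
  have "f v \<in> carrier V" if "v \<in> carrier U" for v using f that by (simp add: lin_iff)
  then show ?thesis
    unfolding rep_iso_def e prod.case using f g
    by (intro bexI[of _ "g \<circ> f"]) (auto intro: lin_comp bij_betw_trans)
qed

lemma rep_iso_sym:
  assumes G: "Group.group G" and R: "real_rep G R" and iso: "rep_iso G R S"
  shows "rep_iso G S R"
proof -
  obtain V \<rho> W \<sigma> where e: "R = (V, \<rho>)" "S = (W, \<sigma>)" by (metis prod.exhaust)
  obtain f where f: "f \<in> lin V W" "bij_betw f (carrier V) (carrier W)"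
    "\<forall>x\<in>carrier G. \<forall>v\<in>carrier V. f (\<rho> x v) = \<sigma> x (f v)"
    using iso by (auto simp: rep_iso_def e)
  let ?g = "inv_into (carrier V) f"
  have V: "vs V" using R real_rep_iff[OF G] by (auto simp: e frame_def)
  have "?g (\<sigma> x w) = \<rho> x (?g w)" if x: "x \<in> carrier G" and w: "w \<in> carrier W" for x w
  proof -
    have g: "?g w \<in> carrier V" "f (?g w) = w"
      using f(2) w by (auto simp: bij_betw_def inv_into_into f_inv_into_f)
    then have "\<rho> x (?g w) \<in> carrier V" using R[unfolded e real_rep_iff[OF G]] x by (auto simp: lin_iff)
    then show ?thesis using f(2,3) g x by (metis bij_betw_inv_into_left)
  qed
  then show ?thesis
    unfolding rep_iso_def e prod.case
    by (intro bexI[of _ ?g] conjI lin_inv_into[OF V f(1,2)] bij_betw_inv_into[OF f(2)]) auto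
qed

lemma rep_sum_simps: "rep_sum (V, \<rho>) (W, \<sigma>) =
    (direct_sum V W, \<lambda>g. \<lambda>p\<in>carrier V \<times> carrier W. (\<rho> g (fst p), \<sigma> g (snd p)))"
  by (simp add: rep_sum_def)

lemma real_rep_sum:
  assumes G: "Group.group G" and R: "real_rep G R" and S: "real_rep G S"
  shows "real_rep G (rep_sum R S)"
proof -
  obtain V \<rho> W \<sigma> where e: "R = (V, \<rho>)" "S = (W, \<sigma>)" by (metis prod.exhaust)
  note r = R[unfolded e real_rep_iff[OF G]] and s = S[unfolded e real_rep_iff[OF G]]
  obtain n h m k where fr: "frame V n h" "frame W m k" using r s by blast
  then have v: "vs V" "vs W" by (auto simp: frame_def)
  have c: "\<rho> g v \<in> carrier V" "\<sigma> g w \<in> carrier W"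
    if "g \<in> carrier G" "v \<in> carrier V" "w \<in> carrier W" for g v w
    using r s that by (auto simp: lin_iff)
  show ?thesis
    unfolding e rep_sum_simps real_rep_iff[OF G]
    using frame_sum[OF fr] r s c v by (auto intro!: lin_sum)
qed

lemma rep_iso_sum:
  assumes "rep_iso G R R'" "rep_iso G S S'"
  shows "rep_iso G (rep_sum R S) (rep_sum R' S')"
proof -
  obtain V \<rho> W \<sigma> V' \<rho>' W' \<sigma>' where e: "R = (V, \<rho>)" "S = (W, \<sigma>)" "R' = (V', \<rho>')" "S' = (W', \<sigma>')"
    by (metis prod.exhaust)
  obtain f g where f: "f \<in> lin V V'" "bij_betw f (carrier V) (carrier V')"
    "\<forall>x\<in>carrier G. \<forall>v\<in>carrier V. f (\<rho> x v) = \<rho>' x (f v)"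
    and g: "g \<in> lin W W'" "bij_betw g (carrier W) (carrier W')"
    "\<forall>x\<in>carrier G. \<forall>v\<in>carrier W. g (\<sigma> x v) = \<sigma>' x (g v)"
    using assms by (auto simp: rep_iso_def e)
  have "map_prod f g \<in> lin (direct_sum V W) (direct_sum V' W')"
    using f g by (auto simp: lin_iff)
  moreover have "bij_betw (map_prod f g) (carrier V \<times> carrier W) (carrier V' \<times> carrier W')"
    using f g by (intro bij_betw_map_prod)
  moreover have "f v \<in> carrier V'" "g w \<in> carrier W'" if "v \<in> carrier V" "w \<in> carrier W" for v w
    using f g that by (auto simp: lin_iff)
  ultimately show ?thesis
    unfolding rep_iso_def e rep_sum_simps prod.case using f g
    by (intro bexI[of _ "map_prod f g"]) auto
qed

lemma rep_iso_sum_swap: "rep_iso G (rep_sum R S) (rep_sum S R)"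
proof -
  obtain V \<rho> W \<sigma> where e: "R = (V, \<rho>)" "S = (W, \<sigma>)" by (metis prod.exhaust)
  have "bij_betw prod.swap (carrier V \<times> carrier W) (carrier W \<times> carrier V)"
    by (rule bij_betwI[of _ _ _ prod.swap]) auto
  then show ?thesis
    unfolding rep_iso_def e rep_sum_simps prod.case
    by (intro bexI[of _ prod.swap]) (auto simp: lin_iff)
qed

lemma rep_iso_sum_assoc:
  assumes "Group.group G" "real_rep G R" "real_rep G S" "real_rep G T"
  shows "rep_iso G (rep_sum (rep_sum R S) T) (rep_sum R (rep_sum S T))"
proof -
  obtain U \<rho> V \<sigma> W \<tau> where e: "R = (U, \<rho>)" "S = (V, \<sigma>)" "T = (W, \<tau>)" by (metis prod.exhaust)
  let ?f = "\<lambda>((u, v), w). (u, (v, w))"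
  have "bij_betw ?f ((carrier U \<times> carrier V) \<times> carrier W) (carrier U \<times> (carrier V \<times> carrier W))"
    by (rule bij_betwI[of _ _ _ "\<lambda>(u, (v, w)). ((u, v), w)"]) auto
  then show ?thesis
    unfolding rep_iso_def e rep_sum_simps prod.case
    by (intro bexI[of _ ?f]) (auto simp: lin_iff)
qed

definition zero_rep :: "('g, nat \<Rightarrow> real) rep" where
  "zero_rep = (Rn 0, \<lambda>g. \<lambda>v\<in>carrier (Rn 0). v)"

lemma real_rep_zero: "Group.group G \<Longrightarrow> real_rep G zero_rep"
  using frame_Rn[of 0] by (auto simp: zero_rep_def real_rep_iff lin_iff vs_closed[OF vs_Rn])

lemma carrier_Rn_0: "carrier (Rn 0) = {\<lambda>i. 0}"
  by (auto simp: carrier_Rn)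

text \<open>The unit of \<open>rep_monoid\<close> is given as a set of zero-dimensional
  representations; this makes it an isomorphism class like all other elements.\<close>

lemma rep_iso_zero_iff:
  assumes G: "Group.group G" and R: "real_rep G R"
  shows "rep_iso G zero_rep R \<longleftrightarrow> carrier (fst R) = {\<zero>\<^bsub>fst R\<^esub>}"
proof -
  obtain V \<rho> where e: "R = (V, \<rho>)" by (metis prod.exhaust)
  note r = R[unfolded e real_rep_iff[OF G]]
  have V: "vs V" using r by (auto simp: frame_def)
  note z = vs_closed(3)[OF V]
  show ?thesis
  proof
    assume "rep_iso G zero_rep R"
    then obtain f where f: "f \<in> lin (Rn 0) V" "bij_betw f (carrier (Rn 0)) (carrier V)"
      by (auto simp: rep_iso_def e zero_rep_def)
    then have "carrier V = {f (\<lambda>i. 0)}" by (simp add: carrier_Rn_0 bij_betw_def)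
    then show "carrier (fst R) = {\<zero>\<^bsub>fst R\<^esub>}" using z by (simp add: e)
  next
    assume "carrier (fst R) = {\<zero>\<^bsub>fst R\<^esub>}"
    then have c: "carrier V = {\<zero>\<^bsub>V\<^esub>}" by (simp add: e)
    have "\<rho> g v \<in> carrier V" if "g \<in> carrier G" "v \<in> carrier V" for g v
      using r that by (auto simp: lin_iff)
    then show "rep_iso G zero_rep R"
      unfolding rep_iso_def e zero_rep_def prod.case carrier_Rn_0 lin_iff
      using c vs_closed(1)[OF V z z] vs_closed(2)[OF V z]
      by (intro bexI[of _ "\<lambda>_. \<zero>\<^bsub>V\<^esub>"]) (auto simp: bij_betw_def lin_iff)
  qed
qed

lemma rep_iso_sum_zero:
  assumes G: "Group.group G" and R: "real_rep G R"
  shows "rep_iso G (rep_sum R zero_rep) R"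
proof -
  obtain V \<rho> where e: "R = (V, \<rho>)" by (metis prod.exhaust)
  have "bij_betw fst (carrier V \<times> carrier (Rn 0)) (carrier V)"
    by (auto simp: bij_betw_def inj_on_def carrier_Rn_0 image_iff)
  then show ?thesis
    unfolding rep_iso_def e zero_rep_def rep_sum_simps prod.case
    by (intro bexI[of _ fst]) (auto simp: lin_iff)
qed

text \<open>Transport along a frame. Sums of representations live on product types, and the copy
  shows that their classes on \<open>nat => real\<close> are nonempty.\<close>

lemma rep_copy:
  assumes G: "Group.group G" and R: "real_rep G R"
  obtains S :: "('g, nat \<Rightarrow> real) rep" where "real_rep G S" "rep_iso G R S"
proof -
  obtain V \<rho> where e: "R = (V, \<rho>)" by (metis prod.exhaust)
  note r = R[unfolded e real_rep_iff[OF G]]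
  obtain n h where fr: "frame V n h" using r by blast
  have V: "vs V" and h: "h \<in> lin V (Rn n)" using fr by (auto simp: frame_def)
  let ?g = "inv_into (carrier V) h"
  let ?s = "\<lambda>x. \<lambda>v\<in>carrier (Rn n). h (\<rho> x (?g v))"
  have c: "\<rho> x v \<in> carrier V" if "x \<in> carrier G" "v \<in> carrier V" for x v
    using r that by (auto simp: lin_iff)
  have "?s x \<in> lin (Rn n) (Rn n)" if "x \<in> carrier G" for x
  proof (rule lin_cong[OF vs_Rn])
    show "h \<circ> (\<rho> x \<circ> ?g) \<in> lin (Rn n) (Rn n)"
      using r that frame_inv(1)[OF fr] h by (intro lin_comp) auto
  qed auto
  moreover have "\<exists>n' h'. frame (Rn n) n' h'" using frame_Rn by blast
  ultimately have "real_rep G (Rn n, ?s)"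
    unfolding real_rep_iff[OF G] using r c by (simp add: frame_inv[OF fr])
  moreover have "rep_iso G R (Rn n, ?s)"
    unfolding rep_iso_def e prod.case using c fr
    by (intro bexI[of _ h]) (auto simp: frame_inv[OF fr], auto simp: frame_def)
  ultimately show thesis by (rule that)
qed

lemma rep_class_refl: "real_rep G R \<Longrightarrow> R \<in> rep_class G R"
  by (simp add: rep_class_def rep_iso_refl)

lemma rep_class_nonempty:
  assumes G: "Group.group G" and R: "real_rep G R"
  shows "rep_class G R \<noteq> ({} :: ('g, nat \<Rightarrow> real) rep set)"
  by (rule rep_copy[OF G R]) (auto simp: rep_class_def)

lemma rep_class_eq:
  assumes "Group.group G" "real_rep G R" "rep_iso G R S"
  shows "rep_class G R = rep_class G S"
  unfolding rep_class_def
  using rep_iso_trans[OF assms(3)] rep_iso_trans[OF rep_iso_sym[OF assms]] by blast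

lemma rep_class_eqD:
  assumes "Group.group G" "real_rep G R" "S \<in> rep_class G R"
  shows "rep_class G S = rep_class G R" "real_rep G S" "rep_iso G R S"
  using assms rep_class_eq[of G R S] by (auto simp: rep_class_def)

section \<open>The commutative monoid of isomorphism classes of representations\<close>

abbreviation RM :: "('g, 'b) monoid_scheme \<Rightarrow> ('g, nat \<Rightarrow> real) rep set monoid" where
  "RM \<equiv> rep_monoid"

lemma RM_carrier: "c \<in> carrier (RM G) \<longleftrightarrow> (\<exists>R :: ('g, nat \<Rightarrow> real) rep. real_rep G R \<and> c = rep_class G R)"
  for G :: "('g, 'b) monoid_scheme"
  unfolding rep_monoid_def by (simp add: image_iff Bex_def)

lemma RM_carrierI:
  assumes G: "Group.group G" and R: "real_rep G R"
  shows "rep_class G R \<in> carrier (RM G)"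
  by (rule rep_copy[OF G R]) (use rep_class_eq[OF G R] RM_carrier in blast)

text \<open>All sets in the union that defines the product coincide, and nonemptiness of the two
  classes keeps the union from collapsing to the empty set.\<close>

lemma RM_mult:
  assumes G: "Group.group G" and R: "real_rep G R" and S: "real_rep G S"
  shows "rep_class G R \<otimes>\<^bsub>RM G\<^esub> rep_class G S = rep_class G (rep_sum R S)"
proof -
  have eq: "rep_class G (rep_sum R' S') = (rep_class G (rep_sum R S) :: ('a, nat \<Rightarrow> real) rep set)"
    if "R' \<in> rep_class G R" "S' \<in> rep_class G S" for R' S' :: "('a, nat \<Rightarrow> real) rep"
    using rep_class_eqD[OF G R that(1)] rep_class_eqD[OF G S that(2)]
    by (intro rep_class_eq[symmetric, OF G real_rep_sum[OF G R S]] rep_iso_sum) auto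
  let ?A = "rep_class G R :: ('a, nat \<Rightarrow> real) rep set" and ?B = "rep_class G S :: ('a, nat \<Rightarrow> real) rep set"
    and ?C = "rep_class G (rep_sum R S) :: ('a, nat \<Rightarrow> real) rep set"
  have "?A \<noteq> {}" "?B \<noteq> {}"
    by (rule rep_class_nonempty[OF G R], rule rep_class_nonempty[OF G S])
  moreover have "(\<Union>R'\<in>?A. \<Union>S'\<in>?B. rep_class G (rep_sum R' S')) = (\<Union>R'\<in>?A. \<Union>S'\<in>?B. ?C)"
    by (intro SUP_cong refl eq)
  ultimately show ?thesis by (simp add: rep_monoid_def)
qed

lemma RM_one: "Group.group G \<Longrightarrow> \<one>\<^bsub>RM G\<^esub> = rep_class G zero_rep"
  using rep_iso_zero_iff[of G] by (auto simp: rep_monoid_def rep_class_def)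

lemma comm_monoid_RM:
  assumes G: "Group.group G"
  shows "comm_monoid (RM G)"
proof (rule comm_monoidI)
  show "\<one>\<^bsub>RM G\<^esub> \<in> carrier (RM G)"
    using RM_carrierI[OF G real_rep_zero[OF G]] RM_one[OF G] by metis
next
  fix a b assume "a \<in> carrier (RM G)" "b \<in> carrier (RM G)"
  then obtain R S :: "(_, nat \<Rightarrow> real) rep" where "real_rep G R" "a = rep_class G R" "real_rep G S" "b = rep_class G S"
    unfolding RM_carrier by blast
  then show "a \<otimes>\<^bsub>RM G\<^esub> b \<in> carrier (RM G)" "a \<otimes>\<^bsub>RM G\<^esub> b = b \<otimes>\<^bsub>RM G\<^esub> a"
    using RM_mult[OF G] RM_carrierI[OF G real_rep_sum[OF G]] rep_class_eq[OF G real_rep_sum[OF G] rep_iso_sum_swap]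
    by metis+
next
  fix a b c assume "a \<in> carrier (RM G)" "b \<in> carrier (RM G)" "c \<in> carrier (RM G)"
  then obtain R S T :: "(_, nat \<Rightarrow> real) rep" where r: "real_rep G R" "a = rep_class G R" "real_rep G S" "b = rep_class G S"
    "real_rep G T" "c = rep_class G T"
    unfolding RM_carrier by blast
  note rs = real_rep_sum[OF G]
  have "a \<otimes>\<^bsub>RM G\<^esub> b \<otimes>\<^bsub>RM G\<^esub> c = rep_class G (rep_sum (rep_sum R S) T)"
    using r RM_mult[OF G rs, of R S T] RM_mult[OF G, of R S] by simp
  moreover have "a \<otimes>\<^bsub>RM G\<^esub> (b \<otimes>\<^bsub>RM G\<^esub> c) = rep_class G (rep_sum R (rep_sum S T))"
    using r RM_mult[OF G _ rs, of R S T] RM_mult[OF G, of S T] by simp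
  ultimately show "a \<otimes>\<^bsub>RM G\<^esub> b \<otimes>\<^bsub>RM G\<^esub> c = a \<otimes>\<^bsub>RM G\<^esub> (b \<otimes>\<^bsub>RM G\<^esub> c)"
    using rep_class_eq[OF G _ rep_iso_sum_assoc[OF G]] rs r by metis
next
  fix a assume "a \<in> carrier (RM G)"
  then obtain R :: "(_, nat \<Rightarrow> real) rep" where r: "real_rep G R" "a = rep_class G R"
    unfolding RM_carrier by blast
  have "\<one>\<^bsub>RM G\<^esub> \<otimes>\<^bsub>RM G\<^esub> a = rep_class G (rep_sum zero_rep R)"
    using r RM_mult[OF G real_rep_zero[OF G]] RM_one[OF G] by metis
  also have "\<dots> = rep_class G (rep_sum R zero_rep)"
    by (rule rep_class_eq[OF G real_rep_sum[OF G real_rep_zero[OF G] r(1)] rep_iso_sum_swap])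
  also have "\<dots> = rep_class G R"
    by (rule rep_class_eq[OF G real_rep_sum[OF G r(1) real_rep_zero[OF G]] rep_iso_sum_zero[OF G r(1)]])
  finally show "\<one>\<^bsub>RM G\<^esub> \<otimes>\<^bsub>RM G\<^esub> a = a" using r by simp
qed

section \<open>Formal differences\<close>

lemma groth_rel_iff: "((a, b), (c, d)) \<in> groth_rel M \<longleftrightarrow>
     a \<in> carrier M \<and> b \<in> carrier M \<and> c \<in> carrier M \<and> d \<in> carrier M \<and>
     (\<exists>k\<in>carrier M. a \<otimes>\<^bsub>M\<^esub> d \<otimes>\<^bsub>M\<^esub> k = c \<otimes>\<^bsub>M\<^esub> b \<otimes>\<^bsub>M\<^esub> k)"
  by (simp add: groth_rel_def)

lemma equiv_groth_rel:
  assumes "comm_monoid M"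
  shows "equiv (carrier M \<times> carrier M) (groth_rel M)"
proof -
  interpret comm_monoid M by fact
  show ?thesis
  proof (rule equivI)
    show "groth_rel M \<subseteq> (carrier M \<times> carrier M) \<times> (carrier M \<times> carrier M)"
      by (auto simp: groth_rel_def)
    show "refl_on (carrier M \<times> carrier M) (groth_rel M)"
      by (auto simp: refl_on_def groth_rel_iff)
    show "sym (groth_rel M)"
      by (rule symI) (auto simp: groth_rel_def intro: sym)
    show "trans (groth_rel M)"
    proof (rule transI)
      fix x y z assume "(x, y) \<in> groth_rel M" "(y, z) \<in> groth_rel M"
      then obtain a b c d e f k l where x: "x = (a, b)" "y = (c, d)" "z = (e, f)"
        and c: "a \<in> carrier M" "b \<in> carrier M" "c \<in> carrier M" "d \<in> carrier M" "e \<in> carrier M"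
          "f \<in> carrier M" "k \<in> carrier M" "l \<in> carrier M"
        and 1: "a \<otimes>\<^bsub>M\<^esub> d \<otimes>\<^bsub>M\<^esub> k = c \<otimes>\<^bsub>M\<^esub> b \<otimes>\<^bsub>M\<^esub> k" and 2: "c \<otimes>\<^bsub>M\<^esub> f \<otimes>\<^bsub>M\<^esub> l = e \<otimes>\<^bsub>M\<^esub> d \<otimes>\<^bsub>M\<^esub> l"
        by (cases x, cases y, cases z) (auto simp: groth_rel_iff)
      \<comment> \<open>The witness for the composite is the product of both given witnesses with
        the middle entry \<open>d\<close>, which has to be cancelled.\<close>
      have "a \<otimes>\<^bsub>M\<^esub> f \<otimes>\<^bsub>M\<^esub> (d \<otimes>\<^bsub>M\<^esub> k \<otimes>\<^bsub>M\<^esub> l) = (a \<otimes>\<^bsub>M\<^esub> d \<otimes>\<^bsub>M\<^esub> k) \<otimes>\<^bsub>M\<^esub> (f \<otimes>\<^bsub>M\<^esub> l)"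
        using c by (simp add: m_ac)
      also have "\<dots> = (c \<otimes>\<^bsub>M\<^esub> f \<otimes>\<^bsub>M\<^esub> l) \<otimes>\<^bsub>M\<^esub> (b \<otimes>\<^bsub>M\<^esub> k)"
        unfolding 1 using c by (simp add: m_ac)
      also have "\<dots> = e \<otimes>\<^bsub>M\<^esub> b \<otimes>\<^bsub>M\<^esub> (d \<otimes>\<^bsub>M\<^esub> k \<otimes>\<^bsub>M\<^esub> l)"
        unfolding 2 using c by (simp add: m_ac)
      finally show "(x, z) \<in> groth_rel M"
        using c unfolding x groth_rel_iff by blast
    qed
  qed
qed

lemma groth_map_class:
  assumes M: "comm_monoid M" and N: "comm_monoid N" and F: "F \<in> hom M N"
    and ab: "a \<in> carrier M" "b \<in> carrier M"
  shows "groth_map N F (groth_rel M `` {(a, b)}) = groth_rel N `` {(F a, F b)}"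
proof -
  interpret M: comm_monoid M by fact
  have Fc: "F x \<in> carrier N" and Fm: "F (x \<otimes>\<^bsub>M\<^esub> y) = F x \<otimes>\<^bsub>N\<^esub> F y"
    if "x \<in> carrier M" "y \<in> carrier M" for x y
    using F that by (auto simp: hom_def)
  have "groth_rel N `` {(F c, F d)} = groth_rel N `` {(F a, F b)}" if cd: "((a, b), (c, d)) \<in> groth_rel M" for c d
  proof -
    obtain k where c: "c \<in> carrier M" "d \<in> carrier M" "k \<in> carrier M"
      and eq: "a \<otimes>\<^bsub>M\<^esub> d \<otimes>\<^bsub>M\<^esub> k = c \<otimes>\<^bsub>M\<^esub> b \<otimes>\<^bsub>M\<^esub> k" using cd by (auto simp: groth_rel_iff)
    have "F a \<otimes>\<^bsub>N\<^esub> F d \<otimes>\<^bsub>N\<^esub> F k = F c \<otimes>\<^bsub>N\<^esub> F b \<otimes>\<^bsub>N\<^esub> F k"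
      using arg_cong[OF eq, of F] ab c by (simp add: Fm)
    then have "((F a, F b), (F c, F d)) \<in> groth_rel N"
      using ab c Fc unfolding groth_rel_iff by blast
    then show ?thesis using equiv_class_eq[OF equiv_groth_rel[OF N]] by blast
  qed
  moreover have "((a, b), (a, b)) \<in> groth_rel M" using ab by (auto simp: groth_rel_iff)
  ultimately show ?thesis unfolding groth_map_def by fastforce
qed

section \<open>Pullback of representations along group homomorphisms\<close>

lemma rep_pullback_iso:
  assumes "\<phi> \<in> hom L M" "rep_iso M R S"
  shows "rep_iso L (rep_pullback \<phi> R) (rep_pullback \<phi> S)"
  using assms by (fastforce simp: rep_iso_def rep_pullback_def hom_def split: prod.splits)

lemma real_rep_pullback:
  assumes L: "Group.group L" and M: "Group.group M" and \<phi>: "\<phi> \<in> hom L M" and R: "real_rep M R"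
  shows "real_rep L (rep_pullback \<phi> R)"
proof -
  obtain V \<rho> where e: "R = (V, \<rho>)" by (metis prod.exhaust)
  have "\<phi> \<one>\<^bsub>L\<^esub> = \<one>\<^bsub>M\<^esub>" using hom_one[OF \<phi> L M] .
  then show ?thesis
    using R \<phi> unfolding e rep_pullback_def prod.case real_rep_iff[OF M] real_rep_iff[OF L]
    by (auto simp: hom_def Pi_iff)
qed

text \<open>The function that \<open>RO_map\<close> passes to \<open>groth_map\<close>, for an
  arbitrary homomorphism in place of conjugation.\<close>

definition pullback_class ::
  "('h, 'b) monoid_scheme \<Rightarrow> ('h \<Rightarrow> 'k) \<Rightarrow> ('k, nat \<Rightarrow> real) rep set \<Rightarrow> ('h, nat \<Rightarrow> real) rep set" where
  "pullback_class L \<phi> c = (\<Union>R\<in>c. rep_class L (rep_pullback \<phi> R))"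

lemma pullback_class_eq:
  assumes L: "Group.group L" and M: "Group.group M" and \<phi>: "\<phi> \<in> hom L M" and R: "real_rep M R"
  shows "pullback_class L \<phi> (rep_class M R) = rep_class L (rep_pullback \<phi> R)"
proof -
  have "rep_class L (rep_pullback \<phi> S) = (rep_class L (rep_pullback \<phi> R) :: ('a, nat \<Rightarrow> real) rep set)"
    if "S \<in> rep_class M R" for S :: "('c, nat \<Rightarrow> real) rep"
    using rep_class_eqD[OF M R that]
      rep_class_eq[OF L real_rep_pullback[OF L M \<phi> R] rep_pullback_iso[OF \<phi>]] by metis
  moreover have "rep_class M R \<noteq> ({} :: ('c, nat \<Rightarrow> real) rep set)" by (rule rep_class_nonempty[OF M R])
  ultimately show ?thesis unfolding pullback_class_def by blast
qed

lemma pullback_class_hom: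
  assumes L: "Group.group L" and M: "Group.group M" and \<phi>: "\<phi> \<in> hom L M"
  shows "pullback_class L \<phi> \<in> hom (RM M) (RM L)"
    and "pullback_class L \<phi> \<one>\<^bsub>RM M\<^esub> = \<one>\<^bsub>RM L\<^esub>"
proof -
  show "pullback_class L \<phi> \<in> hom (RM M) (RM L)"
  proof (rule homI)
    fix a assume "a \<in> carrier (RM M)"
    then obtain R :: "(_, nat \<Rightarrow> real) rep" where "real_rep M R" "a = rep_class M R" unfolding RM_carrier by blast
    then show "pullback_class L \<phi> a \<in> carrier (RM L)"
      using pullback_class_eq[OF L M \<phi>] RM_carrierI[OF L real_rep_pullback[OF L M \<phi>]] by metis
    fix b assume "b \<in> carrier (RM M)"
    then obtain S :: "(_, nat \<Rightarrow> real) rep" where S: "real_rep M S" "b = rep_class M S" unfolding RM_carrier by blast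
    note R = \<open>real_rep M R\<close> \<open>a = rep_class M R\<close>
    have "rep_pullback \<phi> (rep_sum R S) = rep_sum (rep_pullback \<phi> R) (rep_pullback \<phi> S)"
      by (simp add: rep_pullback_def rep_sum_def split: prod.splits)
    then have "pullback_class L \<phi> (rep_class M (rep_sum R S))
        = rep_class L (rep_sum (rep_pullback \<phi> R) (rep_pullback \<phi> S))"
      using pullback_class_eq[OF L M \<phi> real_rep_sum[OF M R(1) S(1)]] by simp
    then show "pullback_class L \<phi> (a \<otimes>\<^bsub>RM M\<^esub> b) = pullback_class L \<phi> a \<otimes>\<^bsub>RM L\<^esub> pullback_class L \<phi> b"
      using R S by (simp add: RM_mult[OF M] RM_mult[OF L] pullback_class_eq[OF L M \<phi>] real_rep_pullback[OF L M \<phi>])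
  qed
  have "rep_pullback \<phi> zero_rep = zero_rep" by (simp add: rep_pullback_def zero_rep_def)
  then show "pullback_class L \<phi> \<one>\<^bsub>RM M\<^esub> = \<one>\<^bsub>RM L\<^esub>"
    using pullback_class_eq[OF L M \<phi> real_rep_zero[OF M]] by (simp add: RM_one L M)
qed

section \<open>The determinant of a group element\<close>

lemma vdet_rep_iso:
  assumes "rep_iso G (V, \<rho>) (W, \<sigma>)" "z \<in> carrier G" "frame W m k" "vs V"
    and "\<rho> z \<in> lin V V" "\<sigma> z \<in> lin W W"
  shows "vdet V (\<rho> z) = vdet W (\<sigma> z)"
proof -
  obtain f where f: "f \<in> lin V W" "bij_betw f (carrier V) (carrier W)"
    "\<forall>x\<in>carrier G. \<forall>v\<in>carrier V. f (\<rho> x v) = \<sigma> x (f v)"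
    using assms(1) by (auto simp: rep_iso_def)
  show ?thesis
    by (rule vdet_conj[OF frame_comp[OF assms(3,4) f(1,2)] assms(3) f(1,2) assms(5,6)])
      (use f assms in auto)
qed

definition rep_det :: "'g \<Rightarrow> ('g, 'v) rep \<Rightarrow> real" where
  "rep_det z R = vdet (fst R) (snd R z)"

lemma rep_det_iso:
  assumes G: "Group.group G" and z: "z \<in> carrier G"
    and "real_rep G R" "real_rep G S" "rep_iso G R S"
  shows "rep_det z R = rep_det z S"
proof -
  obtain V \<rho> W \<sigma> where e: "R = (V, \<rho>)" "S = (W, \<sigma>)" by (metis prod.exhaust)
  show ?thesis
    using assms(3-5) z vdet_rep_iso[of G V \<rho> W \<sigma> z] unfolding e real_rep_iff[OF G]
    by (auto simp: rep_det_def frame_def)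
qed

lemma rep_det_sum:
  assumes G: "Group.group G" and z: "z \<in> carrier G" and "real_rep G R" "real_rep G S"
  shows "rep_det z (rep_sum R S) = rep_det z R * rep_det z S"
proof -
  obtain V \<rho> W \<sigma> where e: "R = (V, \<rho>)" "S = (W, \<sigma>)" by (metis prod.exhaust)
  show ?thesis
    using assms(3,4) z vdet_sum unfolding e real_rep_iff[OF G] rep_sum_simps
    by (fastforce simp: rep_det_def)
qed

lemma rep_det_nonzero:
  assumes G: "Group.group G" and z: "z \<in> carrier G" and R: "real_rep G R"
  shows "rep_det z R \<noteq> 0"
proof -
  interpret Group.group G by fact
  obtain V \<rho> where e: "R = (V, \<rho>)" by (metis prod.exhaust)
  note r = R[unfolded e real_rep_iff[OF G]]
  obtain n h where fr: "frame V n h" using r by blast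
  have "bij_betw (\<rho> z) (carrier V) (carrier V)"
    using R group_action.bij_prop0[of G "carrier V" \<rho> z] z by (auto simp: e real_rep_def Bij_def)
  then show ?thesis
    using vdet_eq[OF fr] rdet_nonzero[OF fr fr] r z by (simp add: rep_det_def e)
qed

text \<open>The determinant of \<open>z\<close> is multiplicative, so its sign is an invariant of virtual representations.\<close>

lemma groth_det_contradiction:
  assumes G: "Group.group G" and z: "z \<in> carrier G"
    and rel: "((a, b), (rep_class G S, \<one>\<^bsub>RM G\<^esub>)) \<in> groth_rel (RM G)"
    and pos: "\<And>R. R \<in> a \<Longrightarrow> rep_det z R > 0" "\<And>R. R \<in> b \<Longrightarrow> rep_det z R > 0"
    and S: "real_rep G S" "rep_det z S < 0"
  shows False
proof -
  obtain k where "a \<in> carrier (RM G)" "b \<in> carrier (RM G)" "k \<in> carrier (RM G)"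
    and eq: "a \<otimes>\<^bsub>RM G\<^esub> \<one>\<^bsub>RM G\<^esub> \<otimes>\<^bsub>RM G\<^esub> k = rep_class G S \<otimes>\<^bsub>RM G\<^esub> b \<otimes>\<^bsub>RM G\<^esub> k"
    using rel unfolding groth_rel_iff by blast
  then obtain A B K :: "(_, nat \<Rightarrow> real) rep" where r: "real_rep G A" "a = rep_class G A" "real_rep G B" "b = rep_class G B"
    "real_rep G K" "k = rep_class G K"
    unfolding RM_carrier by blast
  interpret RM: comm_monoid "RM G" by (rule comm_monoid_RM[OF G])
  note rs = real_rep_sum[OF G]
  have "rep_class G (rep_sum A K) = (rep_class G (rep_sum (rep_sum S B) K) :: ('a, nat \<Rightarrow> real) rep set)"
    using eq r S RM_carrierI[OF G r(1)] by (simp add: RM_mult[OF G] rs)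
  \<comment> \<open>The two sums live on different product types, so their isomorphism is not read
    off directly: a common member \<open>Q\<close> of their classes on \<open>nat => real\<close>
    mediates between them.\<close>
  moreover obtain Q :: "('a, nat \<Rightarrow> real) rep" where Q: "Q \<in> rep_class G (rep_sum A K)" "real_rep G Q"
    using rep_class_nonempty[OF G rs[OF r(1,5)]] rep_class_eqD(2)[OF G rs[OF r(1,5)]] by blast
  ultimately have "rep_iso G (rep_sum A K) Q" "rep_iso G (rep_sum (rep_sum S B) K) Q"
    by (auto simp: rep_class_def)
  then have "rep_det z (rep_sum A K) = rep_det z (rep_sum (rep_sum S B) K)"
    using rep_det_iso[OF G z rs[OF r(1,5)] Q(2)] rep_det_iso[OF G z rs[OF rs[OF S(1) r(3)] r(5)] Q(2)] by simp
  then have "rep_det z A * rep_det z K = rep_det z S * rep_det z B * rep_det z K"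
    using r S by (simp add: rep_det_sum[OF G z] real_rep_sum[OF G])
  then have "rep_det z A = rep_det z S * rep_det z B"
    using rep_det_nonzero[OF G z r(5)] by simp
  moreover have "rep_det z A > 0" "rep_det z B > 0"
    using pos(1)[of A] pos(2)[of B] rep_class_refl[OF r(1)] rep_class_refl[OF r(3)] r(2,4) by simp_all
  ultimately show False using S(2) by (simp add: zero_less_mult_iff)
qed

section \<open>Orientations over a rectangle\<close>

text \<open>Every point is thought to carry a reference orientation, and \<open>k x y\<close>
  compares the one at \<open>y\<close> with the one at \<open>x\<close> when \<open>y\<close> is
  near \<open>x\<close>. The sign \<open>r x\<close> tells whether the chosen orientation agrees
  with the reference one; the condition is continuity of the choice.\<close>

definition oriented :: "('a::topological_space \<Rightarrow> 'a \<Rightarrow> real) \<Rightarrow> 'a set \<Rightarrow> ('a \<Rightarrow> real) \<Rightarrow> bool" where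
  "oriented k S r \<longleftrightarrow> (\<forall>x\<in>S. r x \<in> {1, - 1} \<and> (\<forall>\<^sub>F y in at x within S. r y * k x y = r x))"

definition orientable :: "('a::topological_space \<Rightarrow> 'a \<Rightarrow> real) \<Rightarrow> 'a set \<Rightarrow> bool" where
  "orientable k S \<longleftrightarrow> (\<exists>r. oriented k S r)"

text \<open>The identity is asked only for \<open>y\<close> near \<open>x\<close> and then
  \<open>w\<close> near \<open>y\<close>, since \<open>k x y\<close> has no meaning outside the
  chart domain at \<open>x\<close>.\<close>

definition sign_cocycle :: "('a::topological_space \<Rightarrow> 'a \<Rightarrow> real) \<Rightarrow> bool" where
  "sign_cocycle k \<longleftrightarrow>
     (\<forall>x. \<forall>\<^sub>F y in nhds x. k x y \<in> {1, - 1} \<and> (\<forall>\<^sub>F w in nhds y. k x w = k x y * k y w))"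

lemma oriented_subset: "oriented k T r \<Longrightarrow> S \<subseteq> T \<Longrightarrow> oriented k S r"
  unfolding oriented_def by (meson at_le filter_leD subsetD)

lemma orientable_subset: "orientable k T \<Longrightarrow> S \<subseteq> T \<Longrightarrow> orientable k S"
  unfolding orientable_def using oriented_subset by blast

text \<open>Near \<open>x\<close> the function \<open>k x\<close> is itself an orientation: it
  transports the reference orientation at \<open>x\<close>. Continuity is the cocycle identity
  multiplied by \<open>k y w\<close>, whose square is 1.\<close>

lemma orientable_ball:
  fixes k :: "'a::metric_space \<Rightarrow> 'a \<Rightarrow> real"
  assumes k: "sign_cocycle k"
  obtains e where "e > 0" "orientable k (ball x e)"
proof -
  obtain e where e: "e > 0" and b: "\<And>y. dist y x < e \<Longrightarrow>
      k x y \<in> {1, - 1} \<and> (\<forall>\<^sub>F w in nhds y. k x w = k x y * k y w)"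
    using k unfolding sign_cocycle_def eventually_nhds_metric[of _ x for x] by meson
  have "oriented k (ball x e) (k x)"
    unfolding oriented_def
  proof (intro ballI conjI)
    fix y assume "y \<in> ball x e"
    then have y: "k x y \<in> {1, - 1}" "\<forall>\<^sub>F w in nhds y. k x w = k x y * k y w"
      using b[of y] by (auto simp: dist_commute)
    show "k x y \<in> {1, - 1}" by fact
    have "\<forall>\<^sub>F w in nhds y. k y w \<in> {1, - 1} \<and> (\<forall>\<^sub>F u in nhds w. k y u = k y w * k w u)"
      using k unfolding sign_cocycle_def by blast
    then have "\<forall>\<^sub>F w in nhds y. k x w * k y w = k x y"
      using y(2) by eventually_elim auto
    then show "\<forall>\<^sub>F w in at y within ball x e. k x w * k y w = k x y"
      by (simp add: eventually_at_filter eventually_mono)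
  qed
  then show thesis using that e unfolding orientable_def by blast
qed

text \<open>On the overlap both orientations change by the same factor \<open>k\<close>, so their
  quotient is locally constant, hence constant by connectedness; rescaling one of them by this sign
  makes them agree.\<close>

lemma orientable_Un:
  fixes k :: "'a::t1_space \<Rightarrow> 'a \<Rightarrow> real"
  assumes S: "closed S" "orientable k S" and T: "closed T" "orientable k T" and con: "connected (S \<inter> T)"
  shows "orientable k (S \<union> T)"
proof -
  obtain r s where r: "oriented k S r" and s: "oriented k T s" using S T by (auto simp: orientable_def)
  have ST: "\<forall>\<^sub>F y in at x within S \<inter> T. r y * k x y = r x \<and> s y * k x y = s x" if "x \<in> S \<inter> T" for x
    using oriented_subset[OF r, of "S \<inter> T"] oriented_subset[OF s, of "S \<inter> T"] that
    by (auto simp: oriented_def eventually_conj_iff)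
  have pm: "r x \<in> {1, - 1}" if "x \<in> S" for x using r that by (auto simp: oriented_def)
  have pm': "s x \<in> {1, - 1}" if "x \<in> T" for x using s that by (auto simp: oriented_def)
  have "\<exists>c\<in>{1, - 1}. \<forall>x\<in>S \<inter> T. r x = c * s x"
  proof (cases "S \<inter> T = {}")
    case False
    then obtain x where x: "x \<in> S \<inter> T" by blast
    have "r x * s x = r y * s y" if y: "y \<in> S \<inter> T" for y
    proof (rule connected_local_const[OF con x y, of "\<lambda>x. r x * s x"], intro ballI)
      fix a assume a: "a \<in> S \<inter> T"
      have "\<forall>\<^sub>F y in at a within S \<inter> T. y \<in> S \<inter> T" by (simp add: eventually_at_filter)
      then show "\<forall>\<^sub>F b in at a within S \<inter> T. r a * s a = r b * s b"
        using ST[OF a]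
      proof eventually_elim
        case (elim b)
        then have "r a * s a = (r b * k a b) * (s b * k a b)" by simp
          then have "r a * s a = (r b * s b) * (k a b * k a b)" by (simp only: ac_simps)
          moreover have "r a \<in> {1, - 1}" "r b \<in> {1, - 1}" using pm a elim by auto
          then have "k a b * k a b = 1" using elim by auto
          ultimately show ?case by simp
      qed
    qed
    moreover have "r y = (r y * s y) * s y" if "y \<in> S \<inter> T" for y
      using pm'[of y] that by auto
    ultimately have "\<forall>y\<in>S \<inter> T. r y = (r x * s x) * s y" by simp
    moreover have "r x * s x \<in> {1, - 1}" using pm[of x] pm'[of x] x by auto
    ultimately show ?thesis by blast
  qed auto
  then obtain c where c: "c \<in> {1, - 1}" "\<And>x. x \<in> S \<Longrightarrow> x \<in> T \<Longrightarrow> r x = c * s x" by blast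
  let ?q = "\<lambda>x. if x \<in> S then r x else c * s x"
  have q: "?q x = c * s x" if "x \<in> T" for x using c(2) that by simp
  have "oriented k (S \<union> T) ?q"
    unfolding oriented_def
  proof (intro ballI conjI)
    fix x assume x: "x \<in> S \<union> T"
    show "?q x \<in> {1, - 1}" using x pm[of x] pm'[of x] c(1) by auto
    \<comment> \<open>The filter within the union is the supremum of the filters within
      \<open>S\<close> and \<open>T\<close>, so the two are treated separately. A point outside the
      closed set \<open>S\<close> has a neighbourhood missing \<open>S\<close>, which makes the
      first condition vacuous there.\<close>
    have 1: "\<forall>\<^sub>F y in at x within S. ?q y * k x y = ?q x"
    proof (cases "x \<in> S")
      case True
      then have "\<forall>\<^sub>F y in at x within S. r y * k x y = r x" using r by (auto simp: oriented_def)
      then show ?thesis using True by (auto simp: eventually_at_filter elim: eventually_mono)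
    next
      case False
      have "\<forall>\<^sub>F y in nhds x. y \<in> - S" by (rule eventually_nhds_in_open) (use S False in auto)
      then show ?thesis by (auto simp: eventually_at_filter elim: eventually_mono)
    qed
    have 2: "\<forall>\<^sub>F y in at x within T. ?q y * k x y = ?q x"
    proof (cases "x \<in> T")
      case True
      then have "\<forall>\<^sub>F y in at x within T. s y * k x y = s x" using s by (auto simp: oriented_def)
      then have "\<forall>\<^sub>F y in at x within T. (c * s y) * k x y = c * s x" by eventually_elim simp
      then show ?thesis using True q by (auto simp: eventually_at_filter elim: eventually_mono)
    next
      case False
      have "\<forall>\<^sub>F y in nhds x. y \<in> - T" by (rule eventually_nhds_in_open) (use T False in auto)
      then show ?thesis by (auto simp: eventually_at_filter elim: eventually_mono)
    qed
    show "\<forall>\<^sub>F y in at x within S \<union> T. ?q y * k x y = ?q x"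
      using 1 2 by (simp add: at_within_union eventually_sup)
  qed
  then show ?thesis by (auto simp: orientable_def)
qed

text \<open>Two bisections. At a fixed height, small pieces are glued along vertical segments to a
  strip of positive height over the whole base; then such strips are glued along horizontal
  segments. All overlaps are segments, hence connected.\<close>

lemma orientable_rectangle:
  fixes k :: "real \<times> real \<Rightarrow> real \<times> real \<Rightarrow> real"
  assumes k: "sign_cocycle k" and "a \<le> b" "c \<le> d"
  shows "orientable k ({a..b} \<times> {c..d})"
proof -
  have strip: "\<exists>e>0. orientable k ({a..b} \<times> {y - e..y + e})" for y
    using \<open>a \<le> b\<close>
  proof (induction rule: Bolzano)
    case (trans a b c)
    then obtain e f where e: "e > 0" "orientable k ({a..b} \<times> {y - e..y + e})"
      and f: "f > 0" "orientable k ({b..c} \<times> {y - f..y + f})" by blast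
    define g where "g = min e f"
    have "orientable k ({a..b} \<times> {y - g..y + g} \<union> {b..c} \<times> {y - g..y + g})"
    proof (rule orientable_Un)
      show "orientable k ({a..b} \<times> {y - g..y + g})" "orientable k ({b..c} \<times> {y - g..y + g})"
        by (rule orientable_subset[OF e(2)], force simp: g_def, rule orientable_subset[OF f(2)], force simp: g_def)
      have "({a..b} \<times> {y - g..y + g}) \<inter> ({b..c} \<times> {y - g..y + g}) = {b} \<times> {y - g..y + g}"
        using trans by auto
      then show "connected (({a..b} \<times> {y - g..y + g}) \<inter> ({b..c} \<times> {y - g..y + g}))"
        by (simp add: connected_Times)
    qed (auto intro: closed_Times)
    moreover have "{a..b} \<times> {y - g..y + g} \<union> {b..c} \<times> {y - g..y + g} = {a..c} \<times> {y - g..y + g}"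
      using trans by auto
    ultimately show ?case using e f by (intro exI[of _ g]) (auto simp: g_def)
  next
    case (local x)
    obtain e where e: "e > 0" "orientable k (ball (x, y) e)" by (rule orientable_ball[OF k])
    show ?case
    proof (rule exI[of _ "e / 2"], intro conjI allI impI)
      fix a b assume ab: "a \<le> x \<and> x \<le> b \<and> b - a < e / 2"
      \<comment> \<open>Both coordinate distances stay strictly below \<open>e / 2\<close>, so the
        Euclidean distance, at most their sum, is below \<open>e\<close>. The value
        \<open>e / 3\<close> keeps this strict on the closed strip.\<close>
      have "{a..b} \<times> {y - e / 3..y + e / 3} \<subseteq> ball (x, y) e"
      proof (clarsimp simp: dist_Pair_Pair)
        fix u v assume "a \<le> u" "u \<le> b" "y - e / 3 \<le> v" "v \<le> y + e / 3"
        then have "dist x u < e / 2" "dist y v < e / 2" using ab e(1) unfolding dist_real_def by linarith+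
        then show "sqrt ((dist x u)\<^sup>2 + (dist y v)\<^sup>2) < e"
          using sqrt_sum_squares_le_sum[of "dist x u" "dist y v"] by simp
      qed
      then show "\<exists>e>0. orientable k ({a..b} \<times> {y - e..y + e})"
        using e orientable_subset by (intro exI[of _ "e / 3"]) auto
    qed (use e in auto)
  qed
  show ?thesis
    using \<open>c \<le> d\<close>
  proof (induction rule: Bolzano)
    case (trans c d e)
    have "orientable k ({a..b} \<times> {c..d} \<union> {a..b} \<times> {d..e})"
    proof (rule orientable_Un)
      have "({a..b} \<times> {c..d}) \<inter> ({a..b} \<times> {d..e}) = {a..b} \<times> {d}"
        using trans by auto
      then show "connected (({a..b} \<times> {c..d}) \<inter> ({a..b} \<times> {d..e}))"
        by (simp add: connected_Times)
    qed (use trans in \<open>auto intro: closed_Times\<close>)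
    moreover have "{a..b} \<times> {c..d} \<union> {a..b} \<times> {d..e} = {a..b} \<times> {c..e}"
      using trans by auto
    ultimately show ?case by simp
  next
    case (local y)
    obtain e where e: "e > 0" "orientable k ({a..b} \<times> {y - e..y + e})" using strip by blast
    show ?case
    proof (intro exI[of _ e] conjI allI impI)
      fix c d assume "c \<le> y \<and> y \<le> d \<and> d - c < e"
      then show "orientable k ({a..b} \<times> {c..d})"
        by (intro orientable_subset[OF e(2)]) auto
    qed (rule e(1))
  qed
qed

text \<open>If \<open>\<alpha> p\<close> is the sign of a lift of the translation by
  \<open>v\<close> in reference orientations, then \<open>\<alpha> p * r p * r (p + v)\<close> is
  its sign in the chosen orientations. The factors \<open>k\<close> cancel in it, so it is locally
  constant on the connected set \<open>S\<close>.\<close>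

lemma orientation_shift_const:
  fixes k :: "'a::real_normed_vector \<Rightarrow> 'a \<Rightarrow> real"
  assumes r: "oriented k R r" and S: "connected S" "S \<subseteq> R" "(\<lambda>p. p + v) ` S \<subseteq> R"
    and \<alpha>: "\<And>p. p \<in> S \<Longrightarrow> \<alpha> p \<in> {1, - 1}"
      "\<And>p. p \<in> S \<Longrightarrow> \<forall>\<^sub>F q in nhds p. \<alpha> q = k (p + v) (q + v) * \<alpha> p * k p q"
    and pq: "p \<in> S" "q \<in> S"
  shows "\<alpha> p * r p * r (p + v) = \<alpha> q * r q * r (q + v)"
proof (rule connected_local_const[OF S(1) pq, of "\<lambda>p. \<alpha> p * r p * r (p + v)"], intro ballI)
  fix p assume p: "p \<in> S"
  have "\<forall>\<^sub>F q in at p within S. r q * k p q = r p"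
    using oriented_subset[OF r S(2)] p by (auto simp: oriented_def)
  moreover have "\<forall>\<^sub>F q in at p within S. r (q + v) * k (p + v) (q + v) = r (p + v)"
  proof -
    \<comment> \<open>Continuity at \<open>p + v\<close> is pulled back along the translation; as
      punctured filters are involved, injectivity of the translation enters.\<close>
    have "filterlim (\<lambda>p. p + v) (at (p + v) within R) (at p within S)"
      unfolding filterlim_at
    proof
      show "((\<lambda>p. p + v) \<longlongrightarrow> p + v) (at p within S)" by (intro tendsto_intros)
      show "\<forall>\<^sub>F x in at p within S. x + v \<in> R \<and> x + v \<noteq> p + v"
        unfolding eventually_at_filter using S(3) by (auto intro!: always_eventually)
    qed
    moreover have "\<forall>\<^sub>F q in at (p + v) within R. r q * k (p + v) q = r (p + v)"
      using r S(3) p by (auto simp: oriented_def)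
    ultimately show ?thesis by (auto simp: filterlim_iff)
  qed
  moreover have "\<forall>\<^sub>F q in at p within S. \<alpha> q = k (p + v) (q + v) * \<alpha> p * k p q"
    using \<alpha>(2)[OF p] by (simp add: eventually_at_filter eventually_mono)
  ultimately show "\<forall>\<^sub>F q in at p within S. \<alpha> p * r p * r (p + v) = \<alpha> q * r q * r (q + v)"
    by eventually_elim (simp add: algebra_simps)
qed

text \<open>The sign of the first map is constant along the left edge, which it moves to the right
  edge, and that of the second along the bottom edge, which it moves to the top. In the product of
  the two equalities every corner value of \<open>r\<close> occurs twice and drops out; what remains
  is \<open>rel\<close> with \<open>\<zeta> = 1\<close>.\<close>

lemma commutator_sign:
  fixes k :: "real \<times> real \<Rightarrow> real \<times> real \<Rightarrow> real"
  assumes k: "sign_cocycle k"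
    and \<alpha>: "\<And>p. \<alpha> p \<in> {1, - 1}"
      "\<And>p. \<forall>\<^sub>F q in nhds p. \<alpha> q = k (p + (1, 0)) (q + (1, 0)) * \<alpha> p * k p q"
    and \<beta>: "\<And>p. \<beta> p \<in> {1, - 1}"
      "\<And>p. \<forall>\<^sub>F q in nhds p. \<beta> q = k (p + (0, 1)) (q + (0, 1)) * \<beta> p * k p q"
    and rel: "\<alpha> (s, t + 1) * \<beta> (s, t) = \<zeta> * \<beta> (s + 1, t) * \<alpha> (s, t)"
  shows "\<zeta> = 1"
proof -
  obtain r where r: "oriented k ({s..s + 1} \<times> {t..t + 1}) r"
    using orientable_rectangle[OF k, of s "s + 1" t "t + 1"] by (auto simp: orientable_def)
  have "\<alpha> (s, t + 1) * r (s, t + 1) * r ((s, t + 1) + (1, 0)) = \<alpha> (s, t) * r (s, t) * r ((s, t) + (1, 0))"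
    by (rule orientation_shift_const[OF r, of "{s} \<times> {t..t + 1}"])
      (use \<alpha> in \<open>auto simp: connected_Times\<close>)
  moreover have "\<beta> (s + 1, t) * r (s + 1, t) * r ((s + 1, t) + (0, 1)) = \<beta> (s, t) * r (s, t) * r ((s, t) + (0, 1))"
    by (rule orientation_shift_const[OF r, of "{s..s + 1} \<times> {t}"])
      (use \<beta> in \<open>auto simp: connected_Times\<close>)
  moreover have "r (s, t) \<in> {1, - 1}" "r (s + 1, t) \<in> {1, - 1}" "r (s, t + 1) \<in> {1, - 1}" "r (s + 1, t + 1) \<in> {1, - 1}"
    using r by (auto simp: oriented_def)
  ultimately show ?thesis
    using rel \<alpha>(1)[of "(s, t)"] \<alpha>(1)[of "(s, t + 1)"] \<beta>(1)[of "(s, t)"] \<beta>(1)[of "(s + 1, t)"] by auto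
qed

section \<open>Determinants in local trivialisations\<close>

text \<open>The local triviality clause of \<open>real_vector_bundle\<close>, named so that charts
  can be chosen and passed around.\<close>

definition triv :: "'x topology \<Rightarrow> ('g, 'x, 'e) gvb \<Rightarrow> 'x set \<Rightarrow> nat \<Rightarrow> ('e \<Rightarrow> 'x \<times> (nat \<Rightarrow> real)) \<Rightarrow> bool" where
  "triv X E U n h \<longleftrightarrow> openin X U \<and>
     homeomorphic_map (subtopology (total E) {e \<in> topspace (total E). proj E e \<in> U})
       (prod_topology (subtopology X U) (Euclidean_space n)) h \<and>
     (\<forall>e\<in>topspace (total E). proj E e \<in> U \<longrightarrow> fst (h e) = proj E e) \<and>
     (\<forall>y\<in>U. snd \<circ> h \<in> lin (fib E y) (Rn n))"

lemma real_vector_bundle_triv: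
  assumes "real_vector_bundle X E" "x \<in> topspace X"
  obtains U n h where "triv X E U n h" "x \<in> U"
  using assms unfolding real_vector_bundle_def triv_def by blast

lemma fib_simps:
  assumes "real_vector_bundle X E" "x \<in> topspace X"
  shows "vs (fib E x)" "carrier (fib E x) = {e \<in> topspace (total E). proj E e = x}"
  using assms by (auto simp: real_vector_bundle_def)

text \<open>Charts are only required to be linear on fibres; bijectivity there comes from the
  homeomorphism. A single continuous \<open>g\<close> yields the inverse frames of all fibres over
  \<open>U\<close>, which is what makes determinants vary continuously.\<close>

lemma triv_inverse:
  assumes E: "real_vector_bundle X E" and tr: "triv X E U n h"
  obtains g where "continuous_map (prod_topology (subtopology X U) (Euclidean_space n)) (total E) g"
    and "\<And>y. y \<in> U \<Longrightarrow> frame (fib E y) n (snd \<circ> h)"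
    and "\<And>y w. y \<in> U \<Longrightarrow> w \<in> carrier (Rn n) \<Longrightarrow> inv_into (carrier (fib E y)) (snd \<circ> h) w = g (y, w)"
proof -
  let ?T = "{e \<in> topspace (total E). proj E e \<in> U}"
  let ?P = "prod_topology (subtopology X U) (Euclidean_space n)"
  have UX: "U \<subseteq> topspace X" using tr openin_subset by (auto simp: triv_def)
  have "homeomorphic_map (subtopology (total E) ?T) ?P h" using tr by (simp add: triv_def)
  then obtain g where g: "homeomorphic_maps (subtopology (total E) ?T) ?P h g"
    unfolding homeomorphic_map_maps by (rule exE)
  have hc: "continuous_map (subtopology (total E) ?T) ?P h"
    and gc: "continuous_map ?P (subtopology (total E) ?T) g"
    using g unfolding homeomorphic_maps_def by blast+
  have gh: "g (h e) = e" if "e \<in> ?T" for e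
    using g that unfolding homeomorphic_maps_def by simp
  have hg: "h (g p) = p" if "p \<in> topspace ?P" for p
    using g that unfolding homeomorphic_maps_def by blast
  have P: "topspace ?P = U \<times> carrier (Rn n)" using UX by (auto simp: Rn_def)
  have gT: "g (y, w) \<in> carrier (fib E y)" "h (g (y, w)) = (y, w)" if "y \<in> U" "w \<in> carrier (Rn n)" for y w
  proof -
    have p: "(y, w) \<in> topspace ?P" using P that by simp
    then have "g (y, w) \<in> ?T" using continuous_map_image_subset_topspace[OF gc] by auto
    moreover show "h (g (y, w)) = (y, w)" using hg p by simp
    moreover have "fst (h (g (y, w))) = proj E (g (y, w))" using calculation(1) tr by (simp add: triv_def)
    ultimately show "g (y, w) \<in> carrier (fib E y)" using that UX fib_simps[OF E] by auto
  qed
  have hfst: "h e = (y, snd (h e))" "e \<in> ?T" if "y \<in> U" "e \<in> carrier (fib E y)" for y e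
  proof -
    show "e \<in> ?T" using that UX fib_simps(2)[OF E, of y] by auto
    then have "fst (h e) = y" using tr that UX fib_simps(2)[OF E, of y] by (auto simp: triv_def)
    then show "h e = (y, snd (h e))" by (simp add: prod_eq_iff)
  qed
  have hlin: "snd \<circ> h \<in> lin (fib E y) (Rn n)" if "y \<in> U" for y using tr that by (auto simp: triv_def)
  have fr: "frame (fib E y) n (snd \<circ> h)" if y: "y \<in> U" for y
    unfolding frame_def
  proof (intro conjI hlin y)
    show "vs (fib E y)" using fib_simps[OF E] UX y by blast
    show "bij_betw (snd \<circ> h) (carrier (fib E y)) (carrier (Rn n))"
    proof (rule bij_betwI[of _ _ _ "\<lambda>w. g (y, w)"])
      show "snd \<circ> h \<in> carrier (fib E y) \<rightarrow> carrier (Rn n)" using hlin[OF y] by (auto simp: lin_iff)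
      show "(\<lambda>w. g (y, w)) \<in> carrier (Rn n) \<rightarrow> carrier (fib E y)" using gT y by auto
      show "g (y, (snd \<circ> h) e) = e" if "e \<in> carrier (fib E y)" for e
        using hfst[OF y that] gh[of e] by simp
      show "(snd \<circ> h) (g (y, w)) = w" if "w \<in> carrier (Rn n)" for w using gT y that by simp
    qed
  qed
  show thesis
  proof (rule that[of g])
    show "continuous_map ?P (total E) g" using gc continuous_map_in_subtopology by blast
    show "frame (fib E y) n (snd \<circ> h)" if "y \<in> U" for y by (rule fr[OF that])
    show "inv_into (carrier (fib E y)) (snd \<circ> h) w = g (y, w)" if "y \<in> U" "w \<in> carrier (Rn n)" for y w
      using frame_inv(3)[OF fr[OF that(1)] gT(1)[OF that]] gT(2)[OF that] by simp
  qed
qed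

lemma triv_frame: "real_vector_bundle X E \<Longrightarrow> triv X E U n h \<Longrightarrow> y \<in> U \<Longrightarrow> frame (fib E y) n (snd \<circ> h)"
  by (rule triv_inverse)

text \<open>Each matrix entry is a composite of continuous maps: the local section given by a basis
  vector, then \<open>T\<close>, then the second chart, then a coordinate. With \<open>T\<close> the
  identity this covers changes of chart, with \<open>T\<close> a group element it covers the
  action.\<close>

lemma rdet_continuous:
  assumes E: "real_vector_bundle X E" and tr: "triv X E U n h" "triv X E U' n h'"
    and T: "continuous_map (total E) (total E) T" and \<psi>: "continuous_map X X \<psi>"
    and T\<psi>: "\<And>e. e \<in> topspace (total E) \<Longrightarrow> proj E (T e) = \<psi> (proj E e)"
    and W: "openin X W" "W \<subseteq> U" "\<psi> ` W \<subseteq> U'"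
  shows "continuous_map (subtopology X W) euclideanreal
    (\<lambda>y. rdet n (fib E y) (snd \<circ> h) (snd \<circ> h') T)"
proof -
  obtain g where g: "continuous_map (prod_topology (subtopology X U) (Euclidean_space n)) (total E) g"
    and gi: "\<And>y w. y \<in> U \<Longrightarrow> w \<in> carrier (Rn n) \<Longrightarrow> inv_into (carrier (fib E y)) (snd \<circ> h) w = g (y, w)"
    using triv_inverse[OF E tr(1)] by metis
  have WX: "W \<subseteq> topspace X" using W(1) openin_subset by blast
  have "continuous_map (subtopology X W) euclideanreal (\<lambda>y. snd (h' (T (g (y, std j)))) i)" if "j < n" for i j
  proof -
    have sj: "std j \<in> topspace (Euclidean_space n)" using std_carrier[OF that] by (simp add: Rn_def)
    have "continuous_map (subtopology X W) (prod_topology (subtopology X U) (Euclidean_space n)) (\<lambda>y. (y, std j))"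
      using W(2) sj by (intro continuous_map_pairedI) (auto simp: continuous_map_in_subtopology Int_absorb1 WX)
    then have c1: "continuous_map (subtopology X W) (total E) (\<lambda>y. g (y, std j))"
      using continuous_map_compose[OF _ g] by (simp add: o_def)
    have gE: "proj E (g (y, std j)) = y" if "y \<in> W" for y
      using frame_inv(5)[OF triv_frame[OF E tr(1)] std_carrier[OF \<open>j < n\<close>], of y] gi[of y "std j"]
        std_carrier[OF \<open>j < n\<close>] fib_simps(2)[OF E, of y] W WX that by auto
    have c2: "continuous_map (subtopology X W) (total E) (\<lambda>y. T (g (y, std j)))"
      using continuous_map_compose[OF c1 T] by (simp add: o_def)
    have gtop: "g (y, std j) \<in> topspace (total E)" if "y \<in> W" for y
      using c1 that WX by (auto simp: continuous_map_def Pi_iff)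
    have c3: "continuous_map (subtopology X W) (subtopology (total E) {e \<in> topspace (total E). proj E e \<in> U'})
        (\<lambda>y. T (g (y, std j)))"
      unfolding continuous_map_in_subtopology
    proof (intro conjI c2 Pi_I)
      fix y assume "y \<in> topspace (subtopology X W)"
      then have y: "y \<in> W" by simp
      have "T (g (y, std j)) \<in> topspace (total E)" using c2 y WX by (auto simp: continuous_map_def Pi_iff)
      moreover have "proj E (T (g (y, std j))) = \<psi> y" using T\<psi>[OF gtop[OF y]] gE[OF y] by simp
      ultimately show "T (g (y, std j)) \<in> {e \<in> topspace (total E). proj E e \<in> U'}" using W(3) y by auto
    qed
    have c4: "continuous_map (subtopology (total E) {e \<in> topspace (total E). proj E e \<in> U'})
        (prod_topology (subtopology X U') (Euclidean_space n)) h'"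
      using tr(2) homeomorphic_imp_continuous_map by (auto simp: triv_def)
    have "continuous_map (subtopology X W) (Euclidean_space n) (\<lambda>y. snd (h' (T (g (y, std j)))))"
      using continuous_map_compose[OF continuous_map_compose[OF c3 c4] continuous_map_snd] by (simp add: o_def)
    then have "continuous_map (subtopology X W) (powertop_real UNIV) (\<lambda>y. snd (h' (T (g (y, std j)))))"
      unfolding Euclidean_space_def continuous_map_in_subtopology by blast
    then show ?thesis by (simp add: continuous_map_componentwise_UNIV)
  qed
  then have c: "continuous_map (subtopology X W) euclideanreal
      (\<lambda>y. ldet n (\<lambda>w. snd (h' (T (g (y, w))))))"
    by (intro ldet_continuous) auto
  have "ldet n (\<lambda>w. snd (h' (T (g (y, w))))) = rdet n (fib E y) (snd \<circ> h) (snd \<circ> h') T"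
    if "y \<in> topspace (subtopology X W)" for y
    unfolding rdet_def by (rule ldet_cong) (use gi W that in auto)
  then show ?thesis by (rule continuous_map_eq[OF c])
qed

text \<open>The neighbourhood is the set where \<open>f w * f y\<close> is positive.\<close>

lemma sgn_locally_constant:
  assumes f: "continuous_map (subtopology X W) euclideanreal f" and W: "openin X W" "y \<in> W" and "f y \<noteq> 0"
  obtains V where "openin X V" "y \<in> V" "V \<subseteq> W" "\<And>w. w \<in> V \<Longrightarrow> sgn (f w) = sgn (f y)"
proof -
  let ?V = "{w \<in> topspace (subtopology X W). f w * f y \<in> {0<..}}"
  have WX: "W \<subseteq> topspace X" using W(1) openin_subset by blast
  have "continuous_map (subtopology X W) euclideanreal (\<lambda>w. f w * f y)"
    using f by (intro continuous_map_real_mult) auto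
  then have "openin (subtopology X W) ?V"
    by (rule openin_continuous_map_preimage) auto
  then have 1: "openin X ?V" using W(1) openin_trans_full by blast
  have 2: "y \<in> ?V" using W assms(4) WX by (auto simp: zero_less_mult_iff)
  have 3: "sgn (f w) = sgn (f y)" if "w \<in> ?V" for w
    using that by (auto simp: zero_less_mult_iff sgn_if)
  have 4: "?V \<subseteq> W" by auto
  show thesis by (rule that[OF 1 2 4 3])
qed

section \<open>Signs of the action on a bundle\<close>

locale G_bundle =
  fixes G :: "('g, 'b) monoid_scheme" and X :: "'x topology" and \<phi> :: "'g \<Rightarrow> 'x \<Rightarrow> 'x"
    and E :: "('g, 'x, 'e) gvb"
  assumes group: "Group.group G" and space: "G_space G X \<phi>" and gvb: "G_vector_bundle G X \<phi> E"
begin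

lemma vb: "real_vector_bundle X E"
  using gvb by (simp add: G_vector_bundle_def)

lemma action_X:
  assumes "g \<in> carrier G" "x \<in> topspace X"
  shows "\<phi> g x \<in> topspace X" "h \<in> carrier G \<Longrightarrow> \<phi> (h \<otimes>\<^bsub>G\<^esub> g) x = \<phi> h (\<phi> g x)"
    "\<phi> (inv\<^bsub>G\<^esub> g) (\<phi> g x) = x"
proof -
  interpret group_action G "topspace X" \<phi> using space by (simp add: G_space_def)
  show "\<phi> g x \<in> topspace X" using assms element_image by blast
  show "h \<in> carrier G \<Longrightarrow> \<phi> (h \<otimes>\<^bsub>G\<^esub> g) x = \<phi> h (\<phi> g x)"
    using assms composition_rule by blast
  show "\<phi> (inv\<^bsub>G\<^esub> g) (\<phi> g x) = x" using assms orbit_sym_aux by blast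
qed

lemma action_E:
  assumes "g \<in> carrier G" "e \<in> topspace (total E)"
  shows "act E g e \<in> topspace (total E)" "h \<in> carrier G \<Longrightarrow> act E (h \<otimes>\<^bsub>G\<^esub> g) e = act E h (act E g e)"
    "act E (inv\<^bsub>G\<^esub> g) (act E g e) = e" "proj E (act E g e) = \<phi> g (proj E e)"
proof -
  interpret group_action G "topspace (total E)" "act E"
    using gvb by (simp add: G_vector_bundle_def G_space_def)
  show "act E g e \<in> topspace (total E)" using assms element_image by blast
  show "h \<in> carrier G \<Longrightarrow> act E (h \<otimes>\<^bsub>G\<^esub> g) e = act E h (act E g e)"
    using assms composition_rule by blast
  show "act E (inv\<^bsub>G\<^esub> g) (act E g e) = e" using assms orbit_sym_aux by blast
  show "proj E (act E g e) = \<phi> g (proj E e)" using gvb assms by (simp add: G_vector_bundle_def)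
qed

lemma act_lin: "g \<in> carrier G \<Longrightarrow> x \<in> topspace X \<Longrightarrow> act E g \<in> lin (fib E x) (fib E (\<phi> g x))"
  using gvb by (simp add: G_vector_bundle_def)

lemma act_bij:
  assumes g: "g \<in> carrier G" and x: "x \<in> topspace X"
  shows "bij_betw (act E g) (carrier (fib E x)) (carrier (fib E (\<phi> g x)))"
proof -
  interpret Group.group G by (rule group)
  note f = fib_simps(2)[OF vb x] fib_simps(2)[OF vb action_X(1)[OF g x]]
  have i: "inv\<^bsub>G\<^esub> g \<in> carrier G" "inv\<^bsub>G\<^esub> (inv\<^bsub>G\<^esub> g) = g" using g by auto
  show ?thesis
  proof (rule bij_betwI[of _ _ _ "act E (inv\<^bsub>G\<^esub> g)"])
    show "act E g \<in> carrier (fib E x) \<rightarrow> carrier (fib E (\<phi> g x))"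
      unfolding f by (simp add: action_E[OF g])
    show "act E (inv\<^bsub>G\<^esub> g) \<in> carrier (fib E (\<phi> g x)) \<rightarrow> carrier (fib E x)"
      unfolding f by (simp add: action_E[OF i(1)] action_X[OF g x])
    show "act E (inv\<^bsub>G\<^esub> g) (act E g e) = e" if "e \<in> carrier (fib E x)" for e
      using that unfolding f by (simp add: action_E[OF g])
    show "act E g (act E (inv\<^bsub>G\<^esub> g) e) = e" if "e \<in> carrier (fib E (\<phi> g x))" for e
      using that action_E(3)[OF i(1), of e] i(2) unfolding f by simp
  qed
qed

text \<open>One arbitrary chart per point. The reference orientation at \<open>x\<close> is the one
  given by \<open>coord x\<close> on the fibre over \<open>x\<close>; it may jump from point to
  point, and \<open>trans_sign\<close> records the jumps.\<close>

definition chart :: "'x \<Rightarrow> 'x set \<times> nat \<times> ('e \<Rightarrow> 'x \<times> (nat \<Rightarrow> real))" where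
  "chart x = (SOME c. triv X E (fst c) (fst (snd c)) (snd (snd c)) \<and> x \<in> fst c)"

definition cdom :: "'x \<Rightarrow> 'x set" where "cdom x = fst (chart x)"

definition crank :: "'x \<Rightarrow> nat" where "crank x = fst (snd (chart x))"

definition coord :: "'x \<Rightarrow> 'e \<Rightarrow> nat \<Rightarrow> real" where "coord x = snd \<circ> snd (snd (chart x))"

lemma chart:
  assumes "x \<in> topspace X"
  shows "triv X E (cdom x) (crank x) (snd (snd (chart x)))" "x \<in> cdom x" "openin X (cdom x)" "cdom x \<subseteq> topspace X"
proof -
  obtain U n h where "triv X E U n h" "x \<in> U" using real_vector_bundle_triv[OF vb assms] .
  then have "triv X E (cdom x) (crank x) (snd (snd (chart x))) \<and> x \<in> cdom x"
    unfolding cdom_def crank_def chart_def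
    by (intro someI[of "\<lambda>c. triv X E (fst c) (fst (snd c)) (snd (snd c)) \<and> x \<in> fst c" "(U, n, h)"]) simp
  then show "triv X E (cdom x) (crank x) (snd (snd (chart x)))" "x \<in> cdom x" "openin X (cdom x)" "cdom x \<subseteq> topspace X"
    using openin_subset by (auto simp: triv_def)
qed

lemma frame_coord: "x \<in> topspace X \<Longrightarrow> y \<in> cdom x \<Longrightarrow> frame (fib E y) (crank x) (coord x)"
  unfolding coord_def using triv_frame[OF vb chart(1)] by blast

lemma rank_eq: "x \<in> topspace X \<Longrightarrow> y \<in> cdom x \<Longrightarrow> crank y = crank x"
  by (rule frame_dim_eq[OF frame_coord frame_coord, where T = "\<lambda>v. v"])
    (use chart(2,4) in \<open>auto simp: lin_id bij_betw_def subset_iff\<close>)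

text \<open>Justifies the single size \<open>crank x\<close> used for both frames in
  \<open>act_sign\<close>.\<close>

lemma rank_act: "g \<in> carrier G \<Longrightarrow> x \<in> topspace X \<Longrightarrow> crank (\<phi> g x) = crank x"
  by (rule sym, rule frame_dim_eq[OF frame_coord frame_coord act_lin act_bij])
    (use chart action_X in auto)

text \<open>Over the fibre at \<open>y\<close>, compares the chart chosen at \<open>y\<close> with
  the chart chosen at \<open>x\<close>; meaningful for \<open>y\<close> in \<open>cdom x\<close>.
  These signs become the cocycle \<open>k\<close>.\<close>

definition trans_sign :: "'x \<Rightarrow> 'x \<Rightarrow> real" where
  "trans_sign x y = sgn (rdet (crank y) (fib E y) (coord y) (coord x) (\<lambda>v. v))"

definition act_sign :: "'g \<Rightarrow> 'x \<Rightarrow> real" where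
  "act_sign g x = sgn (rdet (crank x) (fib E x) (coord x) (coord (\<phi> g x)) (act E g))"

lemma rdet_trans_nonzero:
  assumes "x \<in> topspace X" "y \<in> topspace X" "w \<in> cdom x" "w \<in> cdom y"
  shows "rdet (crank w) (fib E w) (coord y) (coord x) (\<lambda>v. v) \<noteq> 0"
proof (rule rdet_nonzero[of _ _ _ "fib E w"])
  show "frame (fib E w) (crank w) (coord y)" "frame (fib E w) (crank w) (coord x)"
    using frame_coord rank_eq assms by metis+
qed (auto simp: lin_id bij_betw_def)

lemma trans_sign_values: "x \<in> topspace X \<Longrightarrow> y \<in> cdom x \<Longrightarrow> trans_sign x y \<in> {1, - 1}"
  unfolding trans_sign_def using rdet_trans_nonzero[of x y y] chart[of x] chart[of y]
  by (auto simp: sgn_if)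

lemma act_sign_values:
  assumes g: "g \<in> carrier G" and x: "x \<in> topspace X"
  shows "act_sign g x \<in> {1, - 1}"
proof -
  have "rdet (crank x) (fib E x) (coord x) (coord (\<phi> g x)) (act E g) \<noteq> 0"
  proof (rule rdet_nonzero[OF _ _ act_lin[OF g x] act_bij[OF g x]])
    show "frame (fib E x) (crank x) (coord x)" using frame_coord chart x by blast
    show "frame (fib E (\<phi> g x)) (crank x) (coord (\<phi> g x))"
      using frame_coord[of "\<phi> g x" "\<phi> g x"] chart action_X(1)[OF g x] rank_act[OF g x] by simp
  qed
  then show ?thesis by (auto simp: act_sign_def sgn_if)
qed

text \<open>Over \<open>w\<close>, pass from the chart at \<open>w\<close> to that at
  \<open>x\<close> through the chart at \<open>y\<close>. The second passage is between two fixed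
  charts, so its sign is constant for \<open>w\<close> near \<open>y\<close>.\<close>

lemma trans_sign_local:
  assumes x: "x \<in> topspace X" and y: "y \<in> cdom x"
  obtains V where "openin X V" "y \<in> V" "\<And>w. w \<in> V \<Longrightarrow> trans_sign x w = trans_sign x y * trans_sign y w"
proof -
  have yX: "y \<in> topspace X" using chart[OF x] y by blast
  let ?W = "cdom x \<inter> cdom y"
  have W: "openin X ?W" "y \<in> ?W" using chart[OF x] chart[OF yX] y by auto
  have "continuous_map (subtopology X ?W) euclideanreal
      (\<lambda>w. rdet (crank y) (fib E w) (coord y) (coord x) (\<lambda>v. v))"
    unfolding coord_def using chart(1)[OF x, folded rank_eq[OF x y]]
    by (intro rdet_continuous[OF vb chart(1)[OF yX] _ _ continuous_map_id[unfolded id_def]]) (use W in auto)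
  then obtain V where V: "openin X V" "y \<in> V" "V \<subseteq> ?W" and c: "\<And>w. w \<in> V \<Longrightarrow>
      sgn (rdet (crank y) (fib E w) (coord y) (coord x) (\<lambda>v. v)) = trans_sign x y"
    using sgn_locally_constant[OF _ W] rdet_trans_nonzero[OF x yX y] W unfolding trans_sign_def by blast
  have "trans_sign x w = trans_sign x y * trans_sign y w" if w: "w \<in> V" for w
  proof -
    have wW: "w \<in> cdom x" "w \<in> cdom y" "w \<in> topspace X" using V w chart[OF x] by auto
    have r: "crank w = crank y" "crank x = crank y" using rank_eq[OF yX wW(2)] rank_eq[OF x y] by auto
    have "rdet (crank y) (fib E w) (coord w) (coord x) ((\<lambda>v. v) \<circ> (\<lambda>v. v))
        = rdet (crank y) (fib E w) (coord y) (coord x) (\<lambda>v. v) * rdet (crank y) (fib E w) (coord w) (coord y) (\<lambda>v. v)"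
      using frame_coord[OF wW(3), of w] chart(2)[OF wW(3)] frame_coord[OF yX wW(2)] frame_coord[OF x wW(1)] r
      by (intro rdet_comp lin_id(2)) (auto simp: lin_id(2))
    then show ?thesis using c[OF w] r by (simp add: trans_sign_def sgn_mult o_def)
  qed
  then show thesis using that V by blast
qed

text \<open>The determinant of \<open>g\<close> from the chart at \<open>w\<close> to the chart at
  \<open>\<phi> g x\<close> is computed in two ways, changing charts before \<open>g\<close> or
  after it. In the first way \<open>g\<close> is measured between two fixed charts, so that factor
  has constant sign near \<open>x\<close>.\<close>

lemma act_sign_local:
  assumes g: "g \<in> carrier G" and x: "x \<in> topspace X"
  obtains V where "openin X V" "x \<in> V"
    "\<And>w. w \<in> V \<Longrightarrow> act_sign g w = trans_sign (\<phi> g x) (\<phi> g w) * act_sign g x * trans_sign x w"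
proof -
  let ?y = "\<phi> g x"
  have yX: "?y \<in> topspace X" by (rule action_X(1)[OF g x])
  have gc: "continuous_map X X (\<phi> g)" using space g by (simp add: G_space_def)
  have Tc: "continuous_map (total E) (total E) (act E g)"
    using gvb g by (simp add: G_vector_bundle_def G_space_def)
  let ?W = "cdom x \<inter> {w \<in> topspace X. \<phi> g w \<in> cdom ?y}"
  have "openin X {w \<in> topspace X. \<phi> g w \<in> cdom ?y}"
    using openin_continuous_map_preimage[OF gc chart(3)[OF yX]] .
  then have W: "openin X ?W" "x \<in> ?W" using chart[OF x] chart[OF yX] x by auto
  have "continuous_map (subtopology X ?W) euclideanreal
      (\<lambda>w. rdet (crank x) (fib E w) (coord x) (coord ?y) (act E g))"
    unfolding coord_def using chart(1)[OF yX, unfolded rank_act[OF g x]]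
    by (intro rdet_continuous[OF vb chart(1)[OF x] _ Tc gc]) (use W action_E(4)[OF g] in auto)
  moreover have nz: "rdet (crank x) (fib E x) (coord x) (coord ?y) (act E g) \<noteq> 0"
    using act_sign_values[OF g x] by (auto simp: act_sign_def)
  ultimately obtain V where V: "openin X V" "x \<in> V" "V \<subseteq> ?W" and c: "\<And>w. w \<in> V \<Longrightarrow>
      sgn (rdet (crank x) (fib E w) (coord x) (coord ?y) (act E g)) = act_sign g x"
    using sgn_locally_constant[OF _ W] unfolding act_sign_def by blast
  have "act_sign g w = trans_sign ?y (\<phi> g w) * act_sign g x * trans_sign x w" if w: "w \<in> V" for w
  proof -
    let ?v = "\<phi> g w"
    have wW: "w \<in> cdom x" "w \<in> topspace X" "?v \<in> cdom ?y" using V w chart[OF x] by auto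
    have vX: "?v \<in> topspace X" by (rule action_X(1)[OF g wW(2)])
    have r: "crank w = crank x" "crank ?v = crank x" "crank ?y = crank x"
      using rank_eq[OF x wW(1)] rank_act[OF g x] rank_eq[OF yX wW(3)] by auto
    have fr: "frame (fib E w) (crank x) (coord w)" "frame (fib E w) (crank x) (coord x)"
      "frame (fib E ?v) (crank x) (coord ?v)" "frame (fib E ?v) (crank x) (coord ?y)"
      using frame_coord[OF wW(2) chart(2)[OF wW(2)]] frame_coord[OF x wW(1)]
        frame_coord[OF vX chart(2)[OF vX]] frame_coord[OF yX wW(3)] r by auto
    note al = act_lin[OF g wW(2)]
    have "rdet (crank x) (fib E w) (coord w) (coord ?y) (act E g \<circ> (\<lambda>v. v))
      = rdet (crank x) (fib E w) (coord x) (coord ?y) (act E g) * rdet (crank x) (fib E w) (coord w) (coord x) (\<lambda>v. v)"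
      by (rule rdet_comp[OF fr(1,2,4) lin_id(2) al])
    moreover have "rdet (crank x) (fib E w) (coord w) (coord ?y) ((\<lambda>v. v) \<circ> act E g)
      = rdet (crank x) (fib E ?v) (coord ?v) (coord ?y) (\<lambda>v. v) * rdet (crank x) (fib E w) (coord w) (coord ?v) (act E g)"
      by (rule rdet_comp[OF fr(1,3,4) al lin_id(2)])
    ultimately have "rdet (crank x) (fib E ?v) (coord ?v) (coord ?y) (\<lambda>v. v) * rdet (crank x) (fib E w) (coord w) (coord ?v) (act E g)
      = rdet (crank x) (fib E w) (coord x) (coord ?y) (act E g) * rdet (crank x) (fib E w) (coord w) (coord x) (\<lambda>v. v)"
      by (simp add: o_def)
    from arg_cong[OF this, of sgn] have "trans_sign ?y ?v * act_sign g w = act_sign g x * trans_sign x w"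
      using c[OF w] r by (simp add: trans_sign_def act_sign_def sgn_mult)
    moreover have "trans_sign ?y ?v \<in> {1, - 1}" by (rule trans_sign_values[OF yX wW(3)])
    ultimately show ?thesis by auto
  qed
  then show thesis using that V by blast
qed

text \<open>Both sides use the reference frames at \<open>x\<close>, at its image under
  \<open>h\<close> and at the final point, so no transition signs enter and the identity holds
  globally.\<close>

lemma act_sign_mult:
  assumes g: "g \<in> carrier G" and h: "h \<in> carrier G" and x: "x \<in> topspace X"
  shows "act_sign (g \<otimes>\<^bsub>G\<^esub> h) x = act_sign g (\<phi> h x) * act_sign h x"
proof -
  let ?y = "\<phi> h x" and ?w = "\<phi> (g \<otimes>\<^bsub>G\<^esub> h) x"
  have w: "?w = \<phi> g ?y" by (rule action_X(2)[OF h x g])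
  have X: "?y \<in> topspace X" "?w \<in> topspace X" using action_X(1) g h x w by auto
  have r: "crank ?y = crank x" "crank ?w = crank x" using rank_act[OF h x] rank_act[OF g X(1)] w by auto
  have fr: "frame (fib E x) (crank x) (coord x)" "frame (fib E ?y) (crank x) (coord ?y)"
    "frame (fib E ?w) (crank x) (coord ?w)"
    using frame_coord[OF x chart(2)[OF x]] frame_coord[OF X(1) chart(2)[OF X(1)]]
      frame_coord[OF X(2) chart(2)[OF X(2)]] r by auto
  have "rdet (crank x) (fib E x) (coord x) (coord ?w) (act E (g \<otimes>\<^bsub>G\<^esub> h))
      = rdet (crank x) (fib E x) (coord x) (coord ?w) (act E g \<circ> act E h)"
    by (rule rdet_cong[OF fr(1)]) (use fib_simps(2)[OF vb x] action_E(2)[OF h _ g] in auto)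
  also have "\<dots> = rdet (crank x) (fib E ?y) (coord ?y) (coord ?w) (act E g) * rdet (crank x) (fib E x) (coord x) (coord ?y) (act E h)"
    using rdet_comp[OF fr act_lin[OF h x]] act_lin[OF g X(1)] unfolding w by blast
  finally show ?thesis using r by (simp add: act_sign_def sgn_mult w)
qed

text \<open>At a fixed point the frames of source and target are the same, so the sign no longer
  depends on the chart.\<close>

lemma act_sign_fixed:
  assumes z: "z \<in> carrier G" and x: "x \<in> topspace X" "\<phi> z x = x"
  shows "act_sign z x = sgn (vdet (fib E x) (act E z))"
  using vdet_eq[OF frame_coord[OF x(1) chart(2)[OF x(1)]]] act_lin[OF z x(1)] x(2)
  by (simp add: act_sign_def)

text \<open>
  The translations by \<open>a\<close> and \<open>b\<close> act with constant orientation character along opposite edges of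
  a square, so \<open>z\<close>, which measures their failure to commute, preserves orientations.
\<close>

lemma vdet_commutator_pos:
  fixes P :: "real \<times> real \<Rightarrow> 'x"
  assumes P: "continuous_map euclidean X P"
    and abz: "a \<in> carrier G" "b \<in> carrier G" "z \<in> carrier G" "a \<otimes>\<^bsub>G\<^esub> b = z \<otimes>\<^bsub>G\<^esub> (b \<otimes>\<^bsub>G\<^esub> a)"
    and a: "\<And>p. \<phi> a (P p) = P (p + (1, 0))" and b: "\<And>p. \<phi> b (P p) = P (p + (0, 1))"
    and z: "\<And>p. \<phi> z (P p) = P p"
  shows "vdet (fib E (P p)) (act E z) > 0"
proof -
  interpret Group.group G by (rule group)
  have PX: "P p \<in> topspace X" for p using continuous_map_image_subset_topspace[OF P] by auto
  have ev: "\<forall>\<^sub>F q in nhds p. P q \<in> V" if "openin X V" "P p \<in> V" for p V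
  proof -
    have "open {q. P q \<in> V}"
      using openin_continuous_map_preimage[OF P that(1)] by simp
    then show ?thesis using that(2) eventually_nhds by blast
  qed
  \<comment> \<open>Pulled back along \<open>P\<close>, the signs live on
    \<open>real * real\<close>, where rectangles can be oriented.\<close>
  define k where "k p q = trans_sign (P p) (P q)" for p q
  have "sign_cocycle k"
    unfolding sign_cocycle_def
  proof
    fix p
    have "\<forall>\<^sub>F q in nhds p. P q \<in> cdom (P p)" by (rule ev) (use chart[OF PX] in auto)
    then show "\<forall>\<^sub>F q in nhds p. k p q \<in> {1, - 1} \<and> (\<forall>\<^sub>F w in nhds q. k p w = k p q * k q w)"
    proof eventually_elim
      case (elim q)
      obtain V where V: "openin X V" "P q \<in> V"
        "\<And>w. w \<in> V \<Longrightarrow> trans_sign (P p) w = trans_sign (P p) (P q) * trans_sign (P q) w"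
        using trans_sign_local[OF PX elim] by blast
      have "\<forall>\<^sub>F w in nhds q. k p w = k p q * k q w"
        using ev[OF V(1,2)] by eventually_elim (simp add: k_def V(3))
      then show ?case using trans_sign_values[OF PX elim] by (simp add: k_def)
    qed
  qed
  moreover have "\<forall>\<^sub>F q in nhds p. act_sign g (P q) = k (p + v) (q + v) * act_sign g (P p) * k p q"
    if g: "g \<in> carrier G" and v: "\<And>p. \<phi> g (P p) = P (p + v)" for g p v
  proof -
    obtain V where V: "openin X V" "P p \<in> V" "\<And>w. w \<in> V \<Longrightarrow>
        act_sign g w = trans_sign (\<phi> g (P p)) (\<phi> g w) * act_sign g (P p) * trans_sign (P p) w"
      using act_sign_local[OF g PX] by blast
    show ?thesis using ev[OF V(1,2)] by eventually_elim (simp add: k_def V(3) v)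
  qed
  note loc = this
  \<comment> \<open>The given point becomes the upper right corner of the square: in
    \<open>z (b a)\<close> the element \<open>z\<close> acts after \<open>b a\<close> has moved the
    lower left corner there.\<close>
  obtain s t where st: "p = (s + 1, t + 1)" by (metis diff_add_cancel prod.exhaust)
  have rel: "act_sign a (P (s, t + 1)) * act_sign b (P (s, t))
      = act_sign z (P p) * act_sign b (P (s + 1, t)) * act_sign a (P (s, t))"
  proof -
    have "act_sign (a \<otimes>\<^bsub>G\<^esub> b) (P (s, t)) = act_sign a (P (s, t + 1)) * act_sign b (P (s, t))"
      using act_sign_mult[OF abz(1,2) PX, of "(s, t)"] by (simp add: b)
    moreover have "act_sign (z \<otimes>\<^bsub>G\<^esub> (b \<otimes>\<^bsub>G\<^esub> a)) (P (s, t))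
        = act_sign z (\<phi> (b \<otimes>\<^bsub>G\<^esub> a) (P (s, t))) * (act_sign b (P (s + 1, t)) * act_sign a (P (s, t)))"
      using act_sign_mult[OF abz(3) _ PX, of "b \<otimes>\<^bsub>G\<^esub> a" "(s, t)"] act_sign_mult[OF abz(2,1) PX, of "(s, t)"] abz
      by (simp add: a)
    moreover have "\<phi> (b \<otimes>\<^bsub>G\<^esub> a) (P (s, t)) = P p"
      using action_X(2)[OF abz(1) PX abz(2), of "(s, t)"] by (simp add: a b st)
    ultimately show ?thesis using abz(4) by simp
  qed
  have "act_sign z (P p) = 1"
    by (rule commutator_sign[of k "\<lambda>p. act_sign a (P p)" "\<lambda>p. act_sign b (P p)" s t])
      (use \<open>sign_cocycle k\<close> loc[OF abz(1) a] loc[OF abz(2) b] act_sign_values[OF _ PX] abz rel in auto)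
  then show ?thesis using act_sign_fixed[OF abz(3) PX z] by (simp add: sgn_if split: if_splits)
qed

end

section \<open>Discs and the plane\<close>

lemma continuous_map_Euclidean_space_coordinate:
  "continuous_map (Euclidean_space n) euclideanreal (\<lambda>x. x k)"
  unfolding Euclidean_space_def
  by (intro continuous_map_from_subtopology continuous_map_product_projection) auto

lemma continuous_map_disc_coordinate: "continuous_map (disc n) euclideanreal (\<lambda>x. x k)"
  unfolding disc_def by (intro continuous_map_from_subtopology continuous_map_Euclidean_space_coordinate)

text \<open>In the product of copies of the real line the disc is a closed subset of the cube with
  sides [-1, 1], which is compact by the theorem of Tychonoff.\<close>

lemma compact_space_disc: "compact_space (disc n)"
proof -
  let ?D = "{x :: nat \<Rightarrow> real. (\<forall>i\<ge>n. x i = 0) \<and> (\<Sum>i<n. (x i)\<^sup>2) \<le> 1}"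
  have eq: "disc n = subtopology (powertop_real UNIV) ?D"
    unfolding disc_def Euclidean_space_def subtopology_subtopology
    by (rule arg_cong[of _ _ "subtopology _"]) auto
  have "compactin (powertop_real UNIV) (PiE UNIV (\<lambda>_. {-1..1}))"
    by (simp add: compactin_PiE)
  moreover have "?D \<subseteq> PiE UNIV (\<lambda>_. {-1..1})"
  proof
    fix x :: "nat \<Rightarrow> real" assume x: "x \<in> ?D"
    have "(x i)\<^sup>2 \<le> 1" for i
    proof (cases "i < n")
      case True
      then have "(x i)\<^sup>2 \<le> (\<Sum>i<n. (x i)\<^sup>2)" by (intro member_le_sum) auto
      then show ?thesis using x by simp
    qed (use x in auto)
    then have "\<bar>x i\<bar> \<le> 1" for i using abs_le_square_iff[of "x i" 1] by simp
    then show "x \<in> PiE UNIV (\<lambda>_. {-1..1})" by (auto simp: abs_le_iff minus_le_iff)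
  qed
  moreover have "closedin (powertop_real UNIV) ?D"
  proof -
    have "closed {x :: nat \<Rightarrow> real. \<forall>i. i \<ge> n \<longrightarrow> x i = 0}"
      by (intro closed_Collect_all closed_Collect_imp closed_Collect_eq open_Collect_const
          continuous_on_product_coordinates continuous_on_const)
    moreover have "closed {x :: nat \<Rightarrow> real. (\<Sum>i<n. (x i)\<^sup>2) \<le> 1}"
      by (intro closed_Collect_le continuous_on_sum continuous_on_power
          continuous_on_product_coordinates continuous_on_const)
    ultimately have "closed ?D" using closed_Int by (force simp: Collect_conj_eq)
    then show ?thesis by (simp add: euclidean_product_topology)
  qed
  ultimately have "compactin (powertop_real UNIV) ?D"
    using closed_compactin by blast
  then show ?thesis unfolding eq by (rule compact_space_subtopology)
qed

lemma disc_subsets: "disc_interior n \<subseteq> topspace (disc n)" "disc_boundary n \<subseteq> topspace (disc n)"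
  by (auto simp: disc_interior_def disc_boundary_def disc_def)

section \<open>The plane and its integral translations\<close>

abbreviation plane :: "(nat \<Rightarrow> real) topology" where
  "plane \<equiv> Euclidean_space 2"

lemma topspace_plane: "topspace plane = {x. \<forall>i\<ge>2. x i = 0}"
  by (auto simp: topspace_Euclidean_space)

lemma plane_eqI: "x \<in> topspace plane \<Longrightarrow> y \<in> topspace plane \<Longrightarrow> x 0 = y 0 \<Longrightarrow> x 1 = y 1 \<Longrightarrow> x = y"
proof (rule ext)
  fix i :: nat
  assume "x \<in> topspace plane" "y \<in> topspace plane" "x 0 = y 0" "x 1 = y 1"
  moreover have "i = 0 \<or> i = 1 \<or> i \<ge> 2" by arith
  ultimately show "x i = y i" by (auto simp: topspace_plane)
qed

text \<open>Bridge from \<open>real * real\<close>, where orientations are treated, to the sequences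
  that form \<open>Euclidean_space 2\<close>.\<close>

definition pt :: "real \<times> real \<Rightarrow> nat \<Rightarrow> real" where
  "pt p = (\<lambda>i. if i = 0 then fst p else if i = 1 then snd p else 0)"

lemma pt_simps [simp]: "pt p 0 = fst p" "pt p (Suc 0) = snd p" "pt p \<in> topspace plane"
  by (auto simp: pt_def topspace_plane)

lemma pt_coordinates: "x \<in> topspace plane \<Longrightarrow> pt (x 0, x 1) = x"
  by (rule plane_eqI) auto

lemma continuous_map_pt:
  assumes "continuous_map Y euclideanreal f" "continuous_map Y euclideanreal g"
  shows "continuous_map Y plane (\<lambda>y. pt (f y, g y))"
proof -
  have "(\<lambda>y. pt (f y, g y)) = (\<lambda>y i. if i < 2 then (if i = 0 then f y else g y) else 0)"
    by (auto simp: pt_def fun_eq_iff)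
  moreover have "continuous_map Y euclideanreal (\<lambda>y. if i = 0 then f y else g y)" for i :: nat
    using assms by (cases "i = 0") auto
  ultimately show ?thesis
    using continuous_map_componentwise_Euclidean_space[of Y 2 "\<lambda>y i. if i = 0 then f y else g y"] by simp
qed

lemma continuous_map_pt_euclidean: "continuous_map euclidean plane pt"
proof -
  have "continuous_map euclidean plane (\<lambda>p. pt (fst p, snd p))"
    by (rule continuous_map_pt) (auto intro!: continuous_intros)
  then show ?thesis by simp
qed

definition shift :: "int \<times> int \<Rightarrow> (nat \<Rightarrow> real) \<Rightarrow> nat \<Rightarrow> real" where
  "shift v x = (\<lambda>i. x i + pt (of_int (fst v), of_int (snd v)) i)"

lemma shift_simps [simp]:
  "shift v x 0 = x 0 + of_int (fst v)" "shift v x (Suc 0) = x (Suc 0) + of_int (snd v)"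
  "shift 0 x = x" "shift v (shift w x) = shift (v + w) x"
  by (auto simp: shift_def pt_def fun_eq_iff)

lemma shift_closed: "shift v x \<in> topspace plane \<longleftrightarrow> x \<in> topspace plane"
  by (auto simp: shift_def topspace_plane pt_def)

lemma shift_pt: "shift v (pt p) = pt (p + (of_int (fst v), of_int (snd v)))"
  by (auto simp: shift_def pt_def fun_eq_iff)

lemma continuous_map_shift: "continuous_map plane plane (shift v)"
  unfolding shift_def
  by (rule continuous_map_Euclidean_space_add) (auto simp: eta_contract_eq)

section \<open>The plane as a classifying space\<close>

text \<open>An extension of the lattice of integer pairs by a finite group. The plane is a cocompact
  classifying space for every such extension; the commutator relation enters only in
  \<open>central_commutator\<close>.\<close>

locale lattice_action =
  fixes G :: "('g, 'b) monoid_scheme" and c :: "'g \<Rightarrow> int \<times> int"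
  assumes group: "Group.group G"
    and c_mult: "\<And>g h. g \<in> carrier G \<Longrightarrow> h \<in> carrier G \<Longrightarrow> c (g \<otimes>\<^bsub>G\<^esub> h) = c g + c h"
    and c_surj: "\<And>v. \<exists>g\<in>carrier G. c g = v"
    and c_ker: "finite {g \<in> carrier G. c g = 0}"
begin

interpretation Group.group G by (rule group)

definition transl :: "'g \<Rightarrow> (nat \<Rightarrow> real) \<Rightarrow> nat \<Rightarrow> real" where
  "transl g = (\<lambda>x\<in>topspace plane. shift (c g) x)"

lemma c_one: "c \<one>\<^bsub>G\<^esub> = 0"
  using c_mult[of "\<one>\<^bsub>G\<^esub>" "\<one>\<^bsub>G\<^esub>"] by simp

lemma c_inv: "g \<in> carrier G \<Longrightarrow> c (inv\<^bsub>G\<^esub> g) = - c g"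
  using c_mult[of "inv\<^bsub>G\<^esub> g" g] c_one by (simp add: eq_neg_iff_add_eq_0)

lemma G_space_transl: "G_space G plane transl"
  unfolding G_space_def
proof (intro conjI ballI)
  show "group_action G (topspace plane) transl"
    unfolding group_action_iff[OF group] transl_def
    using c_mult c_one by (simp add: shift_closed)
  show "continuous_map plane plane (transl g)" for g
    unfolding transl_def using continuous_map_shift[of "c g"]
    by (rule continuous_map_eq) auto
qed

definition ker :: "'g set" where "ker = {g \<in> carrier G. c g = 0}"

lemma subgroup_ker: "subgroup ker G"
  by (rule subgroupI) (auto simp: ker_def c_inv c_mult intro: exI[of _ "\<one>\<^bsub>G\<^esub>"] c_one)

lemma lcoset_c: "g \<in> carrier G \<Longrightarrow> h \<in> g <#\<^bsub>G\<^esub> ker \<Longrightarrow> c h = c g"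
  by (auto simp: l_coset_def ker_def c_mult)

text \<open>Identifies the orbit \<open>G / ker\<close> with the lattice, so that equivariant cells
  become families of integer translates of one cell.\<close>

definition coset_c :: "'g set \<Rightarrow> int \<times> int" where
  "coset_c C = c (SOME g. g \<in> C)"

lemma coset_c: "g \<in> carrier G \<Longrightarrow> coset_c (g <#\<^bsub>G\<^esub> ker) = c g"
  unfolding coset_c_def
  by (rule lcoset_c, assumption, rule someI[of _ g], rule lcos_self[OF _ subgroup_ker])

lemma lcoset_eq:
  assumes "g \<in> carrier G" "h \<in> carrier G" "c g = c h"
  shows "g <#\<^bsub>G\<^esub> ker = h <#\<^bsub>G\<^esub> ker"
proof -
  have *: "g <#\<^bsub>G\<^esub> ker \<subseteq> h <#\<^bsub>G\<^esub> ker" if gh: "g \<in> carrier G" "h \<in> carrier G" "c g = c h" for g h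
  proof
    fix x assume "x \<in> g <#\<^bsub>G\<^esub> ker"
    then obtain k where k: "k \<in> ker" "x = g \<otimes>\<^bsub>G\<^esub> k" by (auto simp: l_coset_def)
    then have kc: "k \<in> carrier G" "c k = 0" by (auto simp: ker_def)
    have "x = h \<otimes>\<^bsub>G\<^esub> (inv\<^bsub>G\<^esub> h \<otimes>\<^bsub>G\<^esub> (g \<otimes>\<^bsub>G\<^esub> k))"
      using k gh kc by (simp add: m_assoc[symmetric])
    moreover have "inv\<^bsub>G\<^esub> h \<otimes>\<^bsub>G\<^esub> (g \<otimes>\<^bsub>G\<^esub> k) \<in> ker"
      using gh kc by (simp add: ker_def c_mult c_inv)
    ultimately show "x \<in> h <#\<^bsub>G\<^esub> ker" unfolding l_coset_def by blast
  qed
  show ?thesis using *[of g h] *[of h g] assms by auto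
qed

lemma coset_c_bij: "bij_betw coset_c (lcosets\<^bsub>G\<^esub> ker) UNIV"
proof (rule bij_betwI')
  fix C D assume "C \<in> lcosets\<^bsub>G\<^esub> ker" "D \<in> lcosets\<^bsub>G\<^esub> ker"
  then obtain g h where "g \<in> carrier G" "C = g <#\<^bsub>G\<^esub> ker" "h \<in> carrier G" "D = h <#\<^bsub>G\<^esub> ker"
    by (auto simp: LCOSETS_def)
  then show "(coset_c C = coset_c D) = (C = D)" using coset_c lcoset_eq by metis
next
  fix v :: "int \<times> int"
  obtain g where "g \<in> carrier G" "c g = v" using c_surj by blast
  then show "\<exists>C\<in>lcosets\<^bsub>G\<^esub> ker. v = coset_c C"
    using coset_c by (auto simp: LCOSETS_def)
qed simp

lemma coset_c_mult:
  assumes g: "g \<in> carrier G" and C: "C \<in> lcosets\<^bsub>G\<^esub> ker"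
  shows "g <#\<^bsub>G\<^esub> C \<in> lcosets\<^bsub>G\<^esub> ker" "coset_c (g <#\<^bsub>G\<^esub> C) = c g + coset_c C"
proof -
  obtain h where h: "h \<in> carrier G" "C = h <#\<^bsub>G\<^esub> ker" using C by (auto simp: LCOSETS_def)
  have "ker \<subseteq> carrier G" by (auto simp: ker_def)
  then have e: "g <#\<^bsub>G\<^esub> C = (g \<otimes>\<^bsub>G\<^esub> h) <#\<^bsub>G\<^esub> ker"
    using lcos_m_assoc g h by simp
  show "g <#\<^bsub>G\<^esub> C \<in> lcosets\<^bsub>G\<^esub> ker" "coset_c (g <#\<^bsub>G\<^esub> C) = c g + coset_c C"
    using g h coset_c c_mult unfolding e by (auto simp: LCOSETS_def)
qed

text \<open>Reduces attaching to finitely many ordinary cells \<open>q i\<close> and their integer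
  translates; every equivariant cell has isotropy \<open>ker\<close>. The final topology is the
  substantial part: it rests on compactness of the cells and local finiteness of their
  translates.\<close>

lemma attaches_cellsI:
  fixes I :: "(nat \<Rightarrow> real) set" and q :: "(nat \<Rightarrow> real) \<Rightarrow> (nat \<Rightarrow> real) \<Rightarrow> nat \<Rightarrow> real"
  assumes fin: "finite I" and AB: "A \<subseteq> B" and A: "closedin plane A" and BX: "B \<subseteq> topspace plane"
    and q: "\<And>i. i \<in> I \<Longrightarrow> continuous_map (disc n) plane (q i)"
    and qB: "\<And>i x v. i \<in> I \<Longrightarrow> x \<in> topspace (disc n) \<Longrightarrow> shift v (q i x) \<in> B"
    and qA: "\<And>i x v. i \<in> I \<Longrightarrow> x \<in> disc_boundary n \<Longrightarrow> shift v (q i x) \<in> A"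
    and qi: "\<And>i x v. i \<in> I \<Longrightarrow> x \<in> disc_interior n \<Longrightarrow> shift v (q i x) \<notin> A"
    and inj: "\<And>i j x y v w. i \<in> I \<Longrightarrow> j \<in> I \<Longrightarrow> x \<in> disc_interior n \<Longrightarrow> y \<in> disc_interior n \<Longrightarrow>
      shift v (q i x) = shift w (q j y) \<Longrightarrow> i = j \<and> v = w \<and> x = y"
    and surj: "\<And>y. y \<in> B \<Longrightarrow> y \<notin> A \<Longrightarrow> \<exists>i\<in>I. \<exists>x\<in>disc_interior n. \<exists>v. y = shift v (q i x)"
  shows "attaches_cells G plane transl n A B"
proof -
  let ?L = "lcosets\<^bsub>G\<^esub> ker"
  define Q where "Q i p = shift (coset_c (fst p)) (q i (snd p))" for i and p :: "'g set \<times> (nat \<Rightarrow> real)"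
  have qX: "q i x \<in> topspace plane" if "i \<in> I" "x \<in> topspace (disc n)" for i x
    using continuous_map_image_subset_topspace[OF q[OF that(1)]] that(2) by auto
  have Qc: "continuous_map (equiv_cell G ker n) plane (Q i)" if i: "i \<in> I" for i
  proof -
    have "continuous_map (equiv_cell G ker n) plane (\<lambda>p. q i (snd p))"
      using continuous_map_compose[OF continuous_map_snd q[OF i]] by (simp add: equiv_cell_def o_def)
    moreover have "continuous_map (equiv_cell G ker n) plane
        (\<lambda>p. pt (of_int (fst (coset_c (fst p))), of_int (snd (coset_c (fst p)))))"
    proof -
      have "continuous_map (discrete_topology ?L) plane (\<lambda>C. pt (of_int (fst (coset_c C)), of_int (snd (coset_c C))))"
        by (simp add: Pi_iff)
      from continuous_map_compose[OF continuous_map_fst this] show ?thesis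
        by (simp add: equiv_cell_def o_def)
    qed
    ultimately show ?thesis unfolding Q_def shift_def by (rule continuous_map_Euclidean_space_add)
  qed
  have top: "topspace (equiv_cell G ker n) = ?L \<times> topspace (disc n)" by (simp add: equiv_cell_def)
  have cells: "subgroup ker G \<and> continuous_map (equiv_cell G ker n) (subtopology plane B) (Q i) \<and>
     (\<forall>g\<in>carrier G. \<forall>C\<in>?L. \<forall>v\<in>topspace (disc n). Q i (g <#\<^bsub>G\<^esub> C, v) = transl g (Q i (C, v))) \<and>
     Q i ` (?L \<times> disc_boundary n) \<subseteq> A" if i: "i \<in> I" for i
  proof (intro conjI subgroup_ker ballI)
    show "continuous_map (equiv_cell G ker n) (subtopology plane B) (Q i)"
      unfolding continuous_map_in_subtopology using Qc[OF i] by (auto simp: top Q_def qB[OF i])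
    show "Q i (g <#\<^bsub>G\<^esub> C, v) = transl g (Q i (C, v))"
      if "g \<in> carrier G" "C \<in> ?L" "v \<in> topspace (disc n)" for g C v
      using that qX[OF i that(3)] by (simp add: Q_def transl_def shift_closed coset_c_mult)
    show "Q i ` (?L \<times> disc_boundary n) \<subseteq> A" by (auto simp: Q_def qA[OF i])
  qed
  have bij: "bij_betw (\<lambda>(i, p). Q i p) (SIGMA i:I. ?L \<times> disc_interior n) (B - A)"
  proof (rule bij_betw_imageI)
    have cinj: "C = D" if "coset_c C = coset_c D" "C \<in> ?L" "D \<in> ?L" for C D
      using coset_c_bij that by (auto simp: bij_betw_def inj_on_def)
    show "inj_on (\<lambda>(i, p). Q i p) (SIGMA i:I. ?L \<times> disc_interior n)"
    proof (rule inj_onI, clarify)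
      fix i C x j D y
      assume ij: "i \<in> I" "j \<in> I" and CD: "C \<in> ?L" "D \<in> ?L" and xy: "x \<in> disc_interior n" "y \<in> disc_interior n"
        and "Q i (C, x) = Q j (D, y)"
      then have "shift (coset_c C) (q i x) = shift (coset_c D) (q j y)" by (simp add: Q_def)
      from inj[OF ij xy this] show "i = j \<and> (C, x) = (D, y)" using cinj CD by blast
    qed
    show "(\<lambda>(i, p). Q i p) ` (SIGMA i:I. ?L \<times> disc_interior n) = B - A"
    proof (intro equalityI subsetI)
      fix y assume "y \<in> (\<lambda>(i, p). Q i p) ` (SIGMA i:I. ?L \<times> disc_interior n)"
      then show "y \<in> B - A" using disc_subsets(1) by (auto simp: Q_def qi qB subset_iff)
    next
      fix y assume "y \<in> B - A"
      then obtain i x v where y: "i \<in> I" "x \<in> disc_interior n" "y = shift v (q i x)" using surj by blast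
      obtain C where "C \<in> ?L" "coset_c C = v" using coset_c_bij unfolding bij_betw_def by (metis UNIV_I imageE)
      then show "y \<in> (\<lambda>(i, p). Q i p) ` (SIGMA i:I. ?L \<times> disc_interior n)"
        using y by (intro image_eqI[of _ _ "(i, C, x)"]) (auto simp: Q_def)
    qed
  qed
  have weak: "closedin (subtopology plane B) F \<longleftrightarrow> closedin (subtopology plane A) (F \<inter> A) \<and>
      (\<forall>i\<in>I. closedin (equiv_cell G ker n) {p \<in> topspace (equiv_cell G ker n). Q i p \<in> F})" (is "_ \<longleftrightarrow> ?R")
    if FB: "F \<subseteq> B" for F
  proof
    assume F: "closedin (subtopology plane B) F"
    then obtain F' where F': "closedin plane F'" "F = F' \<inter> B" by (auto simp: closedin_subtopology)
    then have "F \<inter> A = F' \<inter> A" using AB by auto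
    then have "closedin (subtopology plane A) (F \<inter> A)" using F' by (auto simp: closedin_subtopology)
    moreover have "closedin (equiv_cell G ker n) {p \<in> topspace (equiv_cell G ker n). Q i p \<in> F}" if "i \<in> I" for i
      using closedin_continuous_map_preimage[OF _ F] cells[OF that] by blast
    ultimately show ?R by blast
  next
    assume R: ?R
    have FA: "closedin plane (F \<inter> A)" using R A closedin_trans_full by blast
    \<comment> \<open>Outside \<open>A\<close>, the set \<open>F\<close> is covered by the pieces
      \<open>P (i, v)\<close>, each a continuous image of a compact subset of the disc. They are
      closed, and closedness of their infinite union follows from local finiteness.\<close>
    define P where "P = (\<lambda>(i, v). (\<lambda>x. shift v (q i x)) ` {x \<in> topspace (disc n). shift v (q i x) \<in> F})"
    have Pc: "closedin plane (P (i, v))" if i: "i \<in> I" for i v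
    proof -
      obtain C where C: "C \<in> ?L" "coset_c C = v" using coset_c_bij unfolding bij_betw_def by (metis UNIV_I imageE)
      have "continuous_map (disc n) (equiv_cell G ker n) (\<lambda>x. (C, x))"
        unfolding equiv_cell_def using C by (intro continuous_map_pairedI) auto
      then have "closedin (disc n) {x \<in> topspace (disc n). (C, x) \<in> {p \<in> topspace (equiv_cell G ker n). Q i p \<in> F}}"
        using R i by (intro closedin_continuous_map_preimage) auto
      moreover have "{x \<in> topspace (disc n). (C, x) \<in> {p \<in> topspace (equiv_cell G ker n). Q i p \<in> F}}
          = {x \<in> topspace (disc n). shift v (q i x) \<in> F}"
        using C by (auto simp: top Q_def)
      ultimately have "compactin (disc n) {x \<in> topspace (disc n). shift v (q i x) \<in> F}"
        using closedin_compact_space[OF compact_space_disc] by simp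
      moreover have "continuous_map (disc n) plane (\<lambda>x. shift v (q i x))"
        using continuous_map_compose[OF q[OF i] continuous_map_shift] by (simp add: o_def)
      ultimately have "compactin plane (P (i, v))" unfolding P_def using image_compactin by auto
      then show ?thesis using Hausdorff_Euclidean_space compactin_imp_closedin by blast
    qed
    have lf: "locally_finite_in plane (P ` (I \<times> UNIV))"
      unfolding locally_finite_in_def
    proof (intro conjI ballI)
      show "\<Union> (P ` (I \<times> UNIV)) \<subseteq> topspace plane"
      proof (rule Union_least)
        fix U assume "U \<in> P ` (I \<times> UNIV)"
        then obtain i v where "i \<in> I" "U = P (i, v)" by blast
        then show "U \<subseteq> topspace plane" using closedin_subset[OF Pc[of i v]] by simp
      qed
      fix y assume y: "y \<in> topspace plane"
      have "\<exists>M. \<forall>x\<in>topspace (disc n). \<bar>q i x k\<bar> \<le> M" if i: "i \<in> I" for i k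
      proof -
        have "compactin euclideanreal ((\<lambda>x. q i x k) ` topspace (disc n))"
          using continuous_map_compose[OF q[OF i] continuous_map_Euclidean_space_coordinate[of _ k]]
          by (intro image_compactin[of "disc n"]) (use compact_space_disc in \<open>auto simp: compact_space_def o_def\<close>)
        then have "bounded ((\<lambda>x. q i x k) ` topspace (disc n))" by (simp add: compact_imp_bounded)
        then show ?thesis by (auto simp: bounded_iff)
      qed
      then obtain M where M: "\<And>i k x. i \<in> I \<Longrightarrow> x \<in> topspace (disc n) \<Longrightarrow> \<bar>q i x k\<bar> \<le> M i k" by metis
      \<comment> \<open>If the translate by \<open>v\<close> of a cell meets the box of radius 1
        around \<open>y\<close>, then each coordinate of \<open>v\<close> is bounded by that of
        \<open>y\<close> plus 1 plus a bound for the cell; the sum over \<open>I\<close> bounds all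
        cells at once.\<close>
      define N where "N k = (\<Sum>i\<in>I. \<bar>M i k\<bar>) + \<bar>y k\<bar> + 1" for k
      define V where "V = {x \<in> topspace plane. x 0 \<in> ball (y 0) 1} \<inter> {x \<in> topspace plane. x 1 \<in> ball (y 1) 1}"
      have V: "openin plane V" unfolding V_def
        by (intro openin_Int openin_continuous_map_preimage[OF continuous_map_Euclidean_space_coordinate]) auto
      let ?Z = "\<lambda>k. {m :: int. \<bar>real_of_int m\<bar> \<le> N k}"
      have finZ: "finite (?Z k)" for k
      proof (rule finite_subset)
        show "?Z k \<subseteq> {- \<lceil>N k\<rceil>..\<lceil>N k\<rceil>}"
          by (auto simp: abs_le_iff le_ceiling_iff) linarith+
      qed simp
      have "{U \<in> P ` (I \<times> UNIV). U \<inter> V \<noteq> {}} \<subseteq> P ` (I \<times> (?Z 0 \<times> ?Z 1))"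
      proof
        fix U assume "U \<in> {U \<in> P ` (I \<times> UNIV). U \<inter> V \<noteq> {}}"
        then obtain i v where i: "i \<in> I" "U = P (i, v)" and "P (i, v) \<inter> V \<noteq> {}" by blast
        then obtain x where x: "x \<in> topspace (disc n)" "shift v (q i x) \<in> V" unfolding P_def by blast
        have Mi: "\<bar>q i x k\<bar> \<le> (\<Sum>i\<in>I. \<bar>M i k\<bar>)" for k
        proof -
          have "\<bar>M i k\<bar> \<le> (\<Sum>i\<in>I. \<bar>M i k\<bar>)" using i fin by (intro member_le_sum) auto
          then show ?thesis using M[OF i(1) x(1), of k] by linarith
        qed
        have "\<bar>q i x 0 + of_int (fst v) - y 0\<bar> < 1" "\<bar>q i x 1 + of_int (snd v) - y 1\<bar> < 1"
          using x(2) by (auto simp: V_def dist_real_def)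
        then have "fst v \<in> ?Z 0" "snd v \<in> ?Z 1" using Mi[of 0] Mi[of 1] by (auto simp: N_def)
        then show "U \<in> P ` (I \<times> (?Z 0 \<times> ?Z 1))" using i by (intro image_eqI[of _ _ "(i, v)"]) (auto simp: mem_Times_iff)
      qed
      moreover have "finite (P ` (I \<times> (?Z 0 \<times> ?Z 1)))" using fin finZ by simp
      ultimately have "finite {U \<in> P ` (I \<times> UNIV). U \<inter> V \<noteq> {}}" by (rule finite_subset)
      moreover have "y \<in> V" using y by (simp add: V_def)
      ultimately show "\<exists>V. openin plane V \<and> y \<in> V \<and> finite {U \<in> P ` (I \<times> UNIV). U \<inter> V \<noteq> {}}"
        using V by blast
    qed
    have "closedin plane (\<Union> (P ` (I \<times> UNIV)))"
      by (rule closedin_locally_finite_Union[OF _ lf]) (use Pc in auto)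
    then have "closedin plane (F \<inter> A \<union> \<Union> (P ` (I \<times> UNIV)))" using FA by (rule closedin_Un[rotated])
    moreover have "F \<inter> A \<union> \<Union> (P ` (I \<times> UNIV)) = F"
    proof (intro equalityI subsetI)
      fix y assume y: "y \<in> F"
      show "y \<in> F \<inter> A \<union> \<Union> (P ` (I \<times> UNIV))"
      proof (cases "y \<in> A")
        case False
        then obtain i x v where "i \<in> I" "x \<in> disc_interior n" "y = shift v (q i x)" using surj y FB by blast
        then have "y \<in> P (i, v)" using y disc_subsets(1) by (auto simp: P_def)
        then show ?thesis using \<open>i \<in> I\<close> by blast
      qed (use y in auto)
    qed (auto simp: P_def)
    ultimately have "closedin plane F" by simp
    then show "closedin (subtopology plane B) F" using FB by (rule closedin_subset_topspace)
  qed
  show ?thesis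
    unfolding attaches_cells_def
  proof (intro conjI AB, rule exI[of _ I], rule exI[of _ "\<lambda>_. ker"], rule exI[of _ Q], intro conjI)
    show "\<forall>i\<in>I. subgroup ker G \<and> continuous_map (equiv_cell G ker n) (subtopology plane B) (Q i) \<and>
     (\<forall>g\<in>carrier G. \<forall>C\<in>?L. \<forall>v\<in>topspace (disc n). Q i (g <#\<^bsub>G\<^esub> C, v) = transl g (Q i (C, v))) \<and>
     Q i ` (?L \<times> disc_boundary n) \<subseteq> A" using cells by blast
  qed (use bij weak in auto)
qed

end

section \<open>Cells of the plane\<close>

definition max_norm :: "real \<times> real \<Rightarrow> real" where
  "max_norm p = max \<bar>fst p\<bar> \<bar>snd p\<bar>"

text \<open>Cells are round while the fundamental domain is a square; this is the radial
  homeomorphism taking the Euclidean norm to the maximum norm, with inverse \<open>disc_map\<close>.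
  At the origin the scalar is \<open>0 / 0 = 0\<close>, and the value is 0 as it should be.\<close>

definition square_map :: "real \<times> real \<Rightarrow> real \<times> real" where
  "square_map p = (norm p / max_norm p) *\<^sub>R p"

definition disc_map :: "real \<times> real \<Rightarrow> real \<times> real" where
  "disc_map p = (max_norm p / norm p) *\<^sub>R p"

lemma max_norm_simps:
  "max_norm (a *\<^sub>R p) = \<bar>a\<bar> * max_norm p" "max_norm p \<ge> 0" "max_norm p = 0 \<longleftrightarrow> p = 0"
proof -
  have "mono (\<lambda>x. \<bar>a\<bar> * x)" by (simp add: mono_def mult_left_mono)
  from max_of_mono[OF this] show "max_norm (a *\<^sub>R p) = \<bar>a\<bar> * max_norm p"
    by (simp add: max_norm_def abs_mult)
qed (auto simp: max_norm_def prod_eq_iff max_def)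

lemma max_norm_square_map: "max_norm (square_map p) = norm p"
  using max_norm_simps(2,3)[of p] by (simp add: square_map_def max_norm_simps(1))

lemma norm_disc_map: "norm (disc_map p) = max_norm p"
  using max_norm_simps(2,3)[of p] by (cases "p = 0") (simp_all add: disc_map_def)

lemma square_disc_map: "square_map (disc_map p) = p"
proof (cases "p = 0")
  case False
  then have n: "norm p \<noteq> 0" "max_norm p \<noteq> 0" by (auto simp: max_norm_simps)
  have "square_map (disc_map p) = (max_norm p / max_norm (disc_map p)) *\<^sub>R disc_map p"
    by (simp add: square_map_def norm_disc_map)
  also have "max_norm (disc_map p) = max_norm p / norm p * max_norm p"
    by (simp add: disc_map_def max_norm_simps)
  finally show ?thesis using n by (simp add: disc_map_def)
qed (simp add: square_map_def disc_map_def)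

lemma disc_square_map: "disc_map (square_map p) = p"
proof (cases "p = 0")
  case False
  then have n: "norm p \<noteq> 0" "max_norm p \<noteq> 0" by (auto simp: max_norm_simps)
  have "disc_map (square_map p) = (norm p / norm (square_map p)) *\<^sub>R square_map p"
    by (simp add: disc_map_def max_norm_square_map)
  also have "norm (square_map p) = norm p / max_norm p * norm p"
    by (simp add: square_map_def max_norm_simps)
  finally show ?thesis using n by (simp add: square_map_def)
qed (simp add: square_map_def disc_map_def)

lemma continuous_on_square_map: "continuous_on UNIV square_map"
  unfolding continuous_on_eq_continuous_at[OF open_UNIV]
proof
  fix p :: "real \<times> real"
  show "isCont square_map p"
  proof (cases "p = 0")
    case False
    then have "max \<bar>fst p\<bar> \<bar>snd p\<bar> \<noteq> 0" using max_norm_simps(3)[of p] by (simp add: max_norm_def)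
    then show ?thesis
      unfolding square_map_def max_norm_def by (intro continuous_intros) auto
  next
    case True
    \<comment> \<open>At the origin the ratio of the two norms has no limit, but it stays below 2,
      which suffices for continuity.\<close>
    have "norm (square_map q) \<le> 2 * norm q" for q
    proof (cases "q = 0")
      case False
      have "norm q \<le> \<bar>fst q\<bar> + \<bar>snd q\<bar>"
        using sqrt_sum_squares_le_sum_abs[of "fst q" "snd q"] by (simp add: norm_prod_def)
      also have "\<dots> \<le> 2 * max_norm q" by (simp add: max_norm_def)
      finally have "norm q / max_norm q \<le> 2"
        using False max_norm_simps(2,3)[of q] by (simp add: pos_divide_le_eq less_le)
      then have "norm q / max_norm q * norm q \<le> 2 * norm q" by (intro mult_right_mono) auto
      then show ?thesis
        using max_norm_simps(2)[of q] by (simp add: square_map_def)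
    qed (simp add: square_map_def)
    then have "\<forall>\<^sub>F q in at 0. norm (square_map q) \<le> 2 * norm q" by (intro always_eventually allI)
    moreover have "((\<lambda>q :: real \<times> real. 2 * norm q) \<longlongrightarrow> 0) (at 0)"
      by (intro tendsto_mult_right_zero tendsto_norm_zero tendsto_ident_at)
    ultimately have "(square_map \<longlongrightarrow> 0) (at 0)" by (rule Lim_null_comparison)
    then show ?thesis unfolding True isCont_def by (simp add: square_map_def)
  qed
qed

text \<open>Integer translates of the open unit interval are disjoint; injectivity on open cells
  comes down to this.\<close>

lemma fractional_eq:
  fixes s t :: real
  assumes "0 < s" "s < 1" "0 < t" "t < 1" "s + of_int m = t + of_int n"
  shows "m = n" "s = t"
proof -
  have "real_of_int m < real_of_int (n + 1)" "real_of_int n < real_of_int (m + 1)" using assms by simp_all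
  then show mn: "m = n" by linarith
  show "s = t" using assms(5) unfolding mn by simp
qed

lemma fractional_not_Int: "0 < s \<Longrightarrow> s < 1 \<Longrightarrow> s + of_int m \<notin> (\<int> :: real set)"
proof
  assume "0 < s" "s < 1" "s + of_int m \<in> (\<int> :: real set)"
  then obtain n where "s + of_int m = real_of_int n" by (auto elim: Ints_cases)
  then have "real_of_int m < real_of_int n" "real_of_int n < real_of_int (m + 1)"
    using \<open>0 < s\<close> \<open>s < 1\<close> by simp_all
  then show False unfolding of_int_less_iff by simp
qed

lemma frac_eqs:
  fixes y :: real
  shows "y = frac y + of_int \<lfloor>y\<rfloor>" "y \<notin> \<int> \<Longrightarrow> 0 < frac y" "frac y < 1" "y \<in> \<int> \<Longrightarrow> y = of_int \<lfloor>y\<rfloor>"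
proof -
  show "y = frac y + of_int \<lfloor>y\<rfloor>" unfolding frac_def by simp
qed (auto simp: frac_lt_1 frac_gt_0_iff elim: Ints_cases)

lemma sum_lessThan_2: "(\<Sum>i<2. f i) = f 0 + f (1 :: nat)"
  by (simp add: numeral_2_eq_2)

section \<open>The tiling by unit squares as an equivariant cell structure\<close>

definition lattice_pts :: "(nat \<Rightarrow> real) set" where
  "lattice_pts = {x \<in> topspace plane. x 0 \<in> \<int>} \<inter> {x \<in> topspace plane. x 1 \<in> \<int>}"

definition grid :: "(nat \<Rightarrow> real) set" where
  "grid = {x \<in> topspace plane. x 0 \<in> \<int>} \<union> {x \<in> topspace plane. x 1 \<in> \<int>}"

lemma closedin_lattice_pts: "closedin plane lattice_pts" and closedin_grid: "closedin plane grid"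
  unfolding lattice_pts_def grid_def
  by (intro closedin_Int closedin_Un
      closedin_continuous_map_preimage[OF continuous_map_Euclidean_space_coordinate], simp_all add: closed_Ints)+

context lattice_action
begin

lemma cells_0: "attaches_cells G plane transl 0 {} lattice_pts"
\<comment> \<open>A single orbit of vertices; as an index \<open>pt 0\<close> is merely a label, as
  a value of \<open>q\<close> it is the base vertex.\<close>
proof (rule attaches_cellsI[where I = "{pt 0}" and q = "\<lambda>_ _. pt 0"])
  have i: "x = (\<lambda>_. 0)" if "x \<in> disc_interior 0" for x using that by (auto simp: disc_interior_def topspace_Euclidean_space)
  show "i = j \<and> v = w \<and> x = y" if "i \<in> {pt 0}" "j \<in> {pt 0}" "x \<in> disc_interior 0" "y \<in> disc_interior 0"
    "shift v (pt 0) = shift w (pt 0)" for i j :: "nat \<Rightarrow> real" and x y v w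
  proof -
    have "shift v (pt 0) k = shift w (pt 0) k" for k using that by simp
    from this[of 0] this[of 1] have "v = w" by (simp add: prod_eq_iff)
    then show ?thesis using that(1,2) i[OF that(3)] i[OF that(4)] by simp
  qed
  show "\<exists>i\<in>{pt 0}. \<exists>x\<in>disc_interior 0. \<exists>v. y = shift v (pt 0)" if y: "y \<in> lattice_pts" for y
  proof -
    have "y = shift (\<lfloor>y 0\<rfloor>, \<lfloor>y 1\<rfloor>) (pt 0)"
      using y by (intro plane_eqI) (auto simp: lattice_pts_def shift_closed elim!: Ints_cases)
    moreover have "(\<lambda>_. 0) \<in> disc_interior 0" by (simp add: disc_interior_def topspace_Euclidean_space)
    ultimately show ?thesis by (intro bexI exI) auto
  qed
qed (auto simp: lattice_pts_def shift_closed disc_boundary_def)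

lemma cells_1: "attaches_cells G plane transl (Suc 0) lattice_pts grid"
\<comment> \<open>Two orbits of edges, indexed by their direction vectors, which also enter the
  parametrisation; \<open>(1 + x 0) / 2\<close> carries [-1, 1] to [0, 1].\<close>
proof (rule attaches_cellsI[where I = "{pt (1, 0), pt (0, 1)}" and q = "\<lambda>i x. pt ((1 + x 0) / 2 * i 0, (1 + x 0) / 2 * i 1)"])
  let ?I = "{pt (1, 0), pt (0, 1)}" and ?q = "\<lambda>i x. pt ((1 + x 0) / 2 * i 0, (1 + x 0) / 2 * i 1)"
  have int: "0 < (1 + x 0) / 2" "(1 + x 0) / 2 < 1"
    if "x \<in> disc_interior (Suc 0)" for x
  proof -
    have "\<bar>x 0\<bar> < 1" using that abs_square_less_1[of "x 0"] by (simp add: disc_interior_def)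
    then show "0 < (1 + x 0) / 2" "(1 + x 0) / 2 < 1" by auto
  qed
  have zero: "x k = 0" if "x \<in> disc_interior (Suc 0)" "k \<noteq> 0" for x k
    using that by (simp add: disc_interior_def topspace_Euclidean_space)
  have bd: "x 0 = 1 \<or> x 0 = - 1" if "x \<in> disc_boundary (Suc 0)" for x
    using that by (simp add: disc_boundary_def power2_eq_1_iff)
  show "finite ?I" by simp
  show "lattice_pts \<subseteq> grid" "grid \<subseteq> topspace plane" by (auto simp: lattice_pts_def grid_def)
  show "closedin plane lattice_pts" by (rule closedin_lattice_pts)
  show "continuous_map (disc (Suc 0)) plane (?q i)" for i
    by (intro continuous_map_pt continuous_map_real_mult continuous_map_real_divide continuous_map_add
        continuous_map_disc_coordinate continuous_map_const[THEN iffD2]) auto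
  show "shift v (?q i x) \<in> grid" if "i \<in> ?I" for i x v
    using that by (auto simp: grid_def shift_closed)
  show "shift v (?q i x) \<in> lattice_pts" if "i \<in> ?I" "x \<in> disc_boundary (Suc 0)" for i x v
    using that bd[OF that(2)] by (auto simp: lattice_pts_def shift_closed)
  show "shift v (?q i x) \<notin> lattice_pts" if "i \<in> ?I" "x \<in> disc_interior (Suc 0)" for i x v
    using that fractional_not_Int[OF int(1,2)[OF that(2)]] by (auto simp: lattice_pts_def shift_closed)
  show "i = j \<and> v = w \<and> x = y" if i: "i \<in> ?I" "j \<in> ?I" and x: "x \<in> disc_interior (Suc 0)" "y \<in> disc_interior (Suc 0)"
    and eq: "shift v (?q i x) = shift w (?q j y)" for i j x y v w
  proof -
    note x1 = int[OF x(1)] and y1 = int[OF x(2)]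
    have k: "shift v (?q i x) k = shift w (?q j y) k" for k using eq by simp
    have e: "(1 + x 0) / 2 * i 0 + of_int (fst v) = (1 + y 0) / 2 * j 0 + of_int (fst w)"
      "(1 + x 0) / 2 * i 1 + of_int (snd v) = (1 + y 0) / 2 * j 1 + of_int (snd w)"
      using k[of 0] k[of 1] by simp_all
    have ij: "i = j"
    proof (rule ccontr)
      assume "i \<noteq> j"
      \<comment> \<open>For different directions, one coordinate is strictly fractional on one edge
        and integral on the other.\<close>
      then have "(1 + x 0) / 2 + of_int (fst v) = real_of_int (fst w) \<or> (1 + x 0) / 2 + of_int (snd v) = real_of_int (snd w)"
        using i e by auto
      then show False
        by (metis fractional_not_Int[OF x1(1,2)] Ints_of_int)
    qed
    have "v = w \<and> (1 + x 0) / 2 = (1 + y 0) / 2"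
      using i(2) e fractional_eq[OF x1(1,2) y1(1,2), of "fst v" "fst w"]
        fractional_eq[OF x1(1,2) y1(1,2), of "snd v" "snd w"]
      unfolding ij by (auto simp: prod_eq_iff)
    then have vw: "v = w" "x 0 = y 0" by simp_all
    have "x k = y k" for k
      using zero[OF x(1)] zero[OF x(2)] vw(2) by (cases "k = 0") simp_all
    then show ?thesis using ij vw(1) by blast
  qed
  show "\<exists>i\<in>?I. \<exists>x\<in>disc_interior (Suc 0). \<exists>v. y = shift v (?q i x)" if y: "y \<in> grid" "y \<notin> lattice_pts" for y
  proof -
    have yX: "y \<in> topspace plane" using y by (auto simp: grid_def)
    \<comment> \<open>Inverse of the edge parametrisation: solves
      \<open>(1 + x 0) / 2 = frac (y k)\<close>.\<close>
    define x where "x k = (\<lambda>l :: nat. if l = 0 then 2 * frac (y k) - 1 else 0)" for k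
    have x: "x k \<in> disc_interior (Suc 0)" if "y k \<notin> \<int>" for k
    proof -
      have "\<bar>2 * frac (y k) - 1\<bar> < 1" using frac_eqs(2,3)[of "y k"] that by (auto simp: abs_less_iff)
      then show ?thesis
        using abs_square_less_1[of "2 * frac (y k) - 1"]
        by (simp add: x_def disc_interior_def topspace_Euclidean_space)
    qed
    have "(y 0 \<in> \<int> \<and> y 1 \<notin> \<int>) \<or> (y 0 \<notin> \<int> \<and> y 1 \<in> \<int>)"
      using y by (auto simp: grid_def lattice_pts_def)
    then show ?thesis
    proof
      assume c: "y 0 \<in> \<int> \<and> y 1 \<notin> \<int>"
      then have "y = shift (\<lfloor>y 0\<rfloor>, \<lfloor>y 1\<rfloor>) (?q (pt (0, 1)) (x 1))"
        using frac_eqs(4)[of "y 0"] frac_eqs(1)[of "y 1"] yX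
        by (intro plane_eqI) (simp_all add: shift_closed x_def)
      then show ?thesis
        by - (rule bexI[of _ "pt (0, 1)"], rule bexI[of _ "x 1"], rule exI, assumption, use x[of 1] c in simp_all)
    next
      assume c: "y 0 \<notin> \<int> \<and> y 1 \<in> \<int>"
      then have "y = shift (\<lfloor>y 0\<rfloor>, \<lfloor>y 1\<rfloor>) (?q (pt (1, 0)) (x 0))"
        using frac_eqs(4)[of "y 1"] frac_eqs(1)[of "y 0"] yX
        by (intro plane_eqI) (simp_all add: shift_closed x_def)
      then show ?thesis
        by - (rule bexI[of _ "pt (1, 0)"], rule bexI[of _ "x 0"], rule exI, assumption, use x[of 0] c in simp_all)
    qed
  qed
qed

lemma cells_2: "attaches_cells G plane transl 2 grid (topspace plane)"
proof -
  define s where "s x = square_map (x 0, x 1)" for x :: "nat \<Rightarrow> real"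
  \<comment> \<open>The square with sides [-1, 1] is rescaled to the unit square with vertices in
    the lattice.\<close>
  define q where "q x = pt ((1 + fst (s x)) / 2, (1 + snd (s x)) / 2)" for x
  have nrm: "norm (x 0, x 1) < 1" if "x \<in> disc_interior 2" for x :: "nat \<Rightarrow> real"
    using that by (simp_all add: disc_interior_def sum_lessThan_2 norm_Pair)
  have int: "0 < (1 + fst (s x)) / 2" "(1 + fst (s x)) / 2 < 1" "0 < (1 + snd (s x)) / 2" "(1 + snd (s x)) / 2 < 1"
    if "x \<in> disc_interior 2" for x
  proof -
    have "max_norm (s x) < 1" using nrm[OF that] by (simp add: s_def max_norm_square_map)
    then show "0 < (1 + fst (s x)) / 2" "(1 + fst (s x)) / 2 < 1" "0 < (1 + snd (s x)) / 2" "(1 + snd (s x)) / 2 < 1"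
      by (auto simp: max_norm_def abs_less_iff)
  qed
  have s_cont: "continuous_map (disc 2) euclidean s"
  proof -
    have "continuous_map (disc 2) (prod_topology euclideanreal euclideanreal) (\<lambda>x. (x 0, x 1))"
      by (intro continuous_map_pairedI continuous_map_disc_coordinate)
    then have 1: "continuous_map (disc 2) euclidean (\<lambda>x. (x 0, x 1))" by simp
    have "continuous_map euclidean euclidean square_map" using continuous_on_square_map by simp
    from continuous_map_compose[OF 1 this] show ?thesis by (simp add: s_def[abs_def] o_def)
  qed
  show ?thesis
  proof (rule attaches_cellsI[where I = "{pt 0}" and q = "\<lambda>_. q"])
    show "finite {pt 0}" "grid \<subseteq> topspace plane" "closedin plane grid" "topspace plane \<subseteq> topspace plane"
      using closedin_grid by (auto simp: grid_def)
    have "continuous_map (disc 2) euclideanreal (\<lambda>x. fst (s x))" "continuous_map (disc 2) euclideanreal (\<lambda>x. snd (s x))"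
      using continuous_map_compose[OF s_cont, of euclideanreal fst] continuous_map_compose[OF s_cont, of euclideanreal snd]
      by (auto simp: o_def continuous_on_fst continuous_on_snd continuous_on_id)
    then show "continuous_map (disc 2) plane q"
      unfolding q_def
      by (intro continuous_map_pt continuous_map_real_divide continuous_map_add continuous_map_const[THEN iffD2]) auto
    show "shift v (q x) \<in> topspace plane" for v x by (simp add: shift_closed q_def)
    show "shift v (q x) \<in> grid" if "x \<in> disc_boundary 2" for v x
    proof -
      have "max_norm (s x) = 1"
        using that by (simp add: s_def max_norm_square_map disc_boundary_def sum_lessThan_2 norm_Pair)
      then have "fst (s x) = 1 \<or> fst (s x) = - 1 \<or> snd (s x) = 1 \<or> snd (s x) = - 1"
        by (auto simp: max_norm_def max_def abs_if split: if_splits)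
      then show ?thesis by (auto simp: grid_def shift_closed q_def)
    qed
    show "shift v (q x) \<notin> grid" if "x \<in> disc_interior 2" for v x
      using fractional_not_Int[OF int(1,2)[OF that]] fractional_not_Int[OF int(3,4)[OF that]]
      by (auto simp: grid_def q_def)
    show "i = j \<and> v = w \<and> x = y" if i: "i \<in> {pt 0}" "j \<in> {pt 0}" and x: "x \<in> disc_interior 2" "y \<in> disc_interior 2"
      and eq: "shift v (q x) = shift w (q y)" for i j :: "nat \<Rightarrow> real" and x y v w
    proof -
      have k: "shift v (q x) k = shift w (q y) k" for k using eq by simp
      have e: "(1 + fst (s x)) / 2 + of_int (fst v) = (1 + fst (s y)) / 2 + of_int (fst w)"
        "(1 + snd (s x)) / 2 + of_int (snd v) = (1 + snd (s y)) / 2 + of_int (snd w)"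
        using k[of 0] k[of 1] by (simp_all add: q_def)
      note f = fractional_eq[OF int(1,2)[OF x(1)] int(1,2)[OF x(2)] e(1)]
        fractional_eq[OF int(3,4)[OF x(1)] int(3,4)[OF x(2)] e(2)]
      have "s x = s y" using f by (simp add: prod_eq_iff)
      then have "disc_map (s x) = disc_map (s y)" by simp
      then have "(x 0, x 1) = (y 0, y 1)" unfolding s_def disc_square_map .
      then have "x = y" using x by (intro plane_eqI) (auto simp: disc_interior_def)
      then show ?thesis using i f by (simp add: prod_eq_iff)
    qed
    show "\<exists>i\<in>{pt 0}. \<exists>x\<in>disc_interior 2. \<exists>v. y = shift v (q x)"
      if y: "y \<in> topspace plane" "y \<notin> grid" for y
    proof -
      have n: "y 0 \<notin> \<int>" "y 1 \<notin> \<int>" using y by (auto simp: grid_def)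
      define u where "u = (2 * frac (y 0) - 1, 2 * frac (y 1) - 1)"
      define x where "x = pt (disc_map u)"
      have su: "s x = u" by (simp add: s_def x_def square_disc_map)
      have "max_norm u < 1"
        using frac_eqs(2)[OF n(1)] frac_eqs(2)[OF n(2)] frac_eqs(3)[of "y 0"] frac_eqs(3)[of "y 1"]
        by (simp add: max_norm_def u_def abs_less_iff)
      then have "norm (disc_map u) < 1" by (simp add: norm_disc_map)
      then have "x \<in> disc_interior 2"
        by (simp add: disc_interior_def sum_lessThan_2 x_def norm_prod_def)
      moreover have "y = shift (\<lfloor>y 0\<rfloor>, \<lfloor>y 1\<rfloor>) (q x)"
        using y frac_eqs(1)[of "y 0"] frac_eqs(1)[of "y 1"]
        by (intro plane_eqI) (simp_all add: shift_closed q_def su u_def)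
      ultimately show ?thesis by (intro bexI exI) auto
    qed
  qed
qed

lemma G_CW_complex_plane: "G_CW_complex G plane transl"
proof -
  define sk where "sk n = (if n = 0 then lattice_pts else if n = Suc 0 then grid else topspace plane)" for n
  have sk2: "sk 2 = topspace plane" by (simp add: sk_def)
  show ?thesis
    unfolding G_CW_complex_def
  proof (intro conjI G_space_transl exI[of _ sk] allI impI)
    have "sk n \<subseteq> topspace plane" for n by (auto simp: sk_def lattice_pts_def grid_def)
    then show "(\<Union>n. sk n) = topspace plane" using sk2 by blast
    show "attaches_cells G plane transl 0 {} (sk 0)" using cells_0 by (simp add: sk_def)
    show "attaches_cells G plane transl (Suc n) (sk n) (sk (Suc n))" for n
    proof -
      consider "n = 0" | "n = 1" | "n \<ge> 2" by linarith
      then show ?thesis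
      proof cases
        case 3
        then have "sk n = topspace plane" "sk (Suc n) = topspace plane" by (auto simp: sk_def)
        \<comment> \<open>The filtration is stationary from dimension 2 on, so no cells are
          attached.\<close>
        then show ?thesis by (auto intro!: attaches_cellsI[where I = "{}"])
      qed (use cells_1 cells_2 in \<open>simp_all add: sk_def numeral_2_eq_2\<close>)
    qed
    fix F :: "(nat \<Rightarrow> real) set" assume F: "F \<subseteq> topspace plane"
    show "closedin plane F = (\<forall>n. closedin (subtopology plane (sk n)) (F \<inter> sk n))"
    proof
      assume "closedin plane F"
      then show "\<forall>n. closedin (subtopology plane (sk n)) (F \<inter> sk n)"
        by (auto simp: closedin_subtopology)
    next
      assume "\<forall>n. closedin (subtopology plane (sk n)) (F \<inter> sk n)"
      then have "closedin (subtopology plane (sk 2)) (F \<inter> sk 2)" by blast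
      then show "closedin plane F" using F by (simp add: sk2 Int_absorb2)
    qed
  qed
qed

text \<open>The lattice is torsion free: squaring an element of \<open>H\<close> doubles the size of
  its image, so the maximal size is 0.\<close>

lemma finite_subgroup_c:
  assumes H: "H \<in> finite_subgroups G" and h: "h \<in> H"
  shows "c h = 0"
proof -
  have sub: "subgroup H G" and fin: "finite H" using H by (auto simp: finite_subgroups_def)
  let ?f = "\<lambda>h. \<bar>fst (c h)\<bar> + \<bar>snd (c h)\<bar>"
  define m where "m = Max (?f ` H)"
  have "m \<in> ?f ` H" unfolding m_def using fin h by (intro Max_in) auto
  then obtain k where k: "k \<in> H" "m = ?f k" by blast
  have "?f (k \<otimes>\<^bsub>G\<^esub> k) \<le> m"
    unfolding m_def using fin subgroup.m_closed[OF sub k(1) k(1)] by (intro Max_ge) auto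
  moreover have "c (k \<otimes>\<^bsub>G\<^esub> k) = c k + c k" using c_mult subgroup.mem_carrier[OF sub k(1)] by blast
  ultimately have "m \<le> 0" using k(2) by simp
  moreover have "?f h \<le> m" unfolding m_def using fin h by (intro Max_ge) auto
  ultimately have "fst (c h) = 0" "snd (c h) = 0" by linarith+
  then show ?thesis by (simp add: prod_eq_iff)
qed

text \<open>Finite subgroups lie in the kernel of \<open>c\<close> and act trivially, so every fixed
  point set is the whole plane.\<close>

lemma classifying_space_plane: "classifying_space_proper G plane transl"
  unfolding classifying_space_proper_def
proof (intro conjI ballI G_CW_complex_plane)
  fix x assume x: "x \<in> topspace plane"
  have "c g = 0" if "transl g x = x" for g
  proof -
    have "shift (c g) x k = x k" for k using fun_cong[OF that, of k] x by (simp add: transl_def)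
    from this[of 0] this[of 1] show ?thesis by (simp add: prod_eq_iff)
  qed
  then have "stabilizer G transl x \<subseteq> {g \<in> carrier G. c g = 0}" by (auto simp: stabilizer_def)
  then show "finite (stabilizer G transl x)" using c_ker by (rule finite_subset)
next
  fix H assume H: "H \<in> finite_subgroups G"
  have "fixed_points plane transl H = topspace plane"
    using finite_subgroup_c[OF H] by (auto simp: fixed_points_def transl_def)
  then show "contractible_space (subtopology plane (fixed_points plane transl H))"
    "fixed_points plane transl H \<noteq> {}"
    using contractible_Euclidean_space[of 2] pt_simps(3)[of 0] by (simp, blast)
qed

text \<open>The compact unit square meets every orbit: a group element lying over the negated
  integer parts moves a point to its fractional parts.\<close>

lemma cocompact_plane: "cocompact G plane transl"
proof -
  let ?o = "Group_Action.orbit G transl" and ?S = "pt ` ({0..1} \<times> {0..1})"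
  interpret group_action G "topspace plane" transl using G_space_transl by (simp add: G_space_def)
  have q: "quotient_map plane (orbit_space G plane transl) ?o" by (rule quotient_map_orbit_space)
  have "compactin plane ?S"
    by (rule image_compactin[OF _ continuous_map_pt_euclidean]) (simp add: compact_Times)
  then have "compactin (orbit_space G plane transl) (?o ` ?S)"
    by (rule image_compactin[OF _ quotient_imp_continuous_map[OF q]])
  moreover have "topspace (orbit_space G plane transl) \<subseteq> ?o ` ?S"
  proof
    fix Z assume "Z \<in> topspace (orbit_space G plane transl)"
    then obtain y where y: "y \<in> topspace plane" "Z = ?o y"
      using quotient_imp_surjective_map[OF q] by blast
    obtain g where g: "g \<in> carrier G" "c g = (- \<lfloor>y 0\<rfloor>, - \<lfloor>y 1\<rfloor>)" using c_surj by blast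
    let ?x = "pt (frac (y 0), frac (y 1))"
    have "transl g y = ?x"
      using y g by (intro plane_eqI) (simp_all add: transl_def shift_closed frac_def)
    then have x: "?x \<in> ?o y" using g(1) unfolding orbit_def by (metis (mono_tags, lifting) mem_Collect_eq)
    have xX: "?x \<in> topspace plane" by simp
    have "?o ?x = ?o y"
    proof (intro equalityI subsetI)
      show "z \<in> ?o y" if "z \<in> ?o ?x" for z
        using orbit_trans[OF y(1) xX _ x that] that element_image[OF _ xX] by (auto simp: orbit_def)
      show "z \<in> ?o ?x" if "z \<in> ?o y" for z
        using orbit_trans[OF xX y(1) _ orbit_sym[OF y(1) xX x] that] that element_image[OF _ y(1)]
        by (auto simp: orbit_def)
    qed
    moreover have "?x \<in> ?S" by (auto simp: frac_lt_1 less_imp_le)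
    ultimately show "Z \<in> ?o ` ?S" using y(2) by (metis imageI)
  qed
  ultimately show ?thesis
    unfolding cocompact_def compact_space_def
    by (metis compactin_subset_topspace subset_antisym)
qed

end

section \<open>An element of the limit that is not in the image\<close>

locale central_commutator = lattice_action +
  fixes a b z
  assumes abz: "a \<in> carrier G" "b \<in> carrier G" "z \<in> carrier G"
    and c_ab: "c a = (1, 0)" "c b = (0, 1)"
    and ker_z: "{g \<in> carrier G. c g = 0} = {\<one>\<^bsub>G\<^esub>, z}"
    and z_square: "z \<noteq> \<one>\<^bsub>G\<^esub>" "z \<otimes>\<^bsub>G\<^esub> z = \<one>\<^bsub>G\<^esub>"
    and z_central: "\<And>g. g \<in> carrier G \<Longrightarrow> z \<otimes>\<^bsub>G\<^esub> g = g \<otimes>\<^bsub>G\<^esub> z"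
    and commutator: "a \<otimes>\<^bsub>G\<^esub> b = z \<otimes>\<^bsub>G\<^esub> (b \<otimes>\<^bsub>G\<^esub> a)"
begin

interpretation Group.group G by (rule group)

abbreviation res :: "'a set \<Rightarrow> ('a, 'b) monoid_scheme" where
  "res H \<equiv> G\<lparr>carrier := H\<rparr>"

lemma group_res: "H \<in> finite_subgroups G \<Longrightarrow> Group.group (res H)"
  by (simp add: finite_subgroups_def subgroup_imp_group)

lemma finite_subgroup_cases: "H \<in> finite_subgroups G \<Longrightarrow> h \<in> H \<Longrightarrow> h = \<one>\<^bsub>G\<^esub> \<or> h = z"
  using finite_subgroup_c[of H h] ker_z by (auto simp: finite_subgroups_def dest: subgroup.mem_carrier)

lemma ker_finite_subgroup: "{\<one>\<^bsub>G\<^esub>, z} \<in> finite_subgroups G"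
  using subgroup_ker ker_z c_ker unfolding ker_def finite_subgroups_def by simp

text \<open>One formula serves every finite subgroup: the sign representation on
  \<open>{1, z}\<close> and the trivial line on the trivial group. On all of \<open>G\<close> it is
  not multiplicative.\<close>

definition sign_rep :: "('a, nat \<Rightarrow> real) rep" where
  "sign_rep = (Rn 1, \<lambda>h. \<lambda>v\<in>carrier (Rn 1). if h = z then (\<lambda>i. - v i) else v)"

lemma real_rep_sign:
  assumes H: "H \<in> finite_subgroups G"
  shows "real_rep (res H) sign_rep"
proof -
  let ?s = "\<lambda>h. \<lambda>v\<in>carrier (Rn 1). if h = z then (\<lambda>i. - v i) else v"
  have neg: "(\<lambda>i. - v i) \<in> carrier (Rn 1)" if "v \<in> carrier (Rn 1)" for v
    using that by (simp add: carrier_Rn)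
  have "?s h \<in> lin (Rn 1) (Rn 1)" for h
    unfolding lin_iff by (auto simp: Rn_simps carrier_Rn)
  moreover have "?s (g \<otimes>\<^bsub>G\<^esub> h) v = ?s g (?s h v)" if "g \<in> H" "h \<in> H" "v \<in> carrier (Rn 1)" for g h v
    using finite_subgroup_cases[OF H that(1)] finite_subgroup_cases[OF H that(2)] z_square abz(3) neg that(3)
    by (elim disjE) simp_all
  ultimately show ?thesis
    unfolding sign_rep_def real_rep_iff[OF group_res[OF H]]
    using frame_Rn[of 1] z_square(1) by (intro conjI ballI) (blast, simp_all)
qed

lemma rep_det_sign: "rep_det z sign_rep < 0"
proof -
  let ?T = "\<lambda>v\<in>carrier (Rn 1). (\<lambda>i. - v i)"
  have "?T \<in> lin (Rn 1) (Rn 1)"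
    unfolding lin_iff by (auto simp: Rn_simps carrier_Rn)
  then have "vdet (Rn 1) ?T = rdet 1 (Rn 1) (\<lambda>v. v) (\<lambda>v. v) ?T" by (rule vdet_eq[OF frame_Rn])
  also have "\<dots> = ldet 1 (\<lambda>v i. - v i)"
    unfolding rdet_def
    by (rule ldet_cong) (use frame_inv(3)[OF frame_Rn, of _ 1] in auto)
  also have "\<dots> = - 1"
    by (simp add: ldet_def lmat_def det_single std_def)
  finally show ?thesis by (simp add: rep_det_def sign_rep_def)
qed

text \<open>The formal difference of the sign representation and zero, at every finite
  subgroup.\<close>

definition sign_family :: "'a set \<Rightarrow> (('a, nat \<Rightarrow> real) rep set \<times> ('a, nat \<Rightarrow> real) rep set) set" where
  "sign_family = (\<lambda>H\<in>finite_subgroups G.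
     groth_rel (RM (res H)) `` {(rep_class (res H) sign_rep, \<one>\<^bsub>RM (res H)\<^esub>)})"

text \<open>Finite subgroups are central, so conjugation by \<open>g\<close> fixes \<open>H\<close>
  pointwise and the pullback of \<open>sign_rep\<close> is \<open>sign_rep\<close> again; it remains
  to see that a morphism forces \<open>H\<close> into \<open>K\<close>.\<close>

lemma sign_family_compatible:
  assumes H: "H \<in> finite_subgroups G" and K: "K \<in> finite_subgroups G"
    and f: "f \<in> orbit_cat_hom G H K" and g: "g \<in> carrier G" and fH: "f H = g <#\<^bsub>G\<^esub> K"
  shows "RO_map G H g (sign_family K) = sign_family H"
proof -
  let ?\<phi> = "\<lambda>h. inv\<^bsub>G\<^esub> g \<otimes>\<^bsub>G\<^esub> h \<otimes>\<^bsub>G\<^esub> g"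
  have sub: "subgroup H G" "subgroup K G" using H K by (auto simp: finite_subgroups_def)
  have Hc: "h \<in> carrier G" if "h \<in> H" for h using subgroup.mem_carrier[OF sub(1) that] .
  have \<phi>: "?\<phi> h = h" if "h \<in> H" for h
    using finite_subgroup_cases[OF H that] z_central[OF g] g abz(3) by (auto simp: m_assoc) (simp add: m_assoc[symmetric])
  \<comment> \<open>The coset \<open>H\<close> is fixed by each of its elements \<open>h\<close>, so
    by equivariance \<open>h\<close> fixes its image \<open>g K\<close>. Hence the conjugate of
    \<open>h\<close> by \<open>g\<close>, which is \<open>h\<close> itself, lies in
    \<open>K\<close>.\<close>
  have HK: "h \<in> K" if h: "h \<in> H" for h
  proof -
    have "H = \<one>\<^bsub>G\<^esub> <#\<^bsub>G\<^esub> H" using lcos_mult_one subgroup.subset[OF sub(1)] by simp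
    then have "H \<in> lcosets\<^bsub>G\<^esub> H" unfolding LCOSETS_def by blast
    then have "f (h <#\<^bsub>G\<^esub> H) = h <#\<^bsub>G\<^esub> f H" using f Hc[OF h] by (simp add: orbit_cat_hom_def)
    moreover have "h <#\<^bsub>G\<^esub> H = H" using coset_join3[OF Hc[OF h] sub(1) h] .
    ultimately have e: "h <#\<^bsub>G\<^esub> (g <#\<^bsub>G\<^esub> K) = g <#\<^bsub>G\<^esub> K" using fH by simp
    have "g \<in> g <#\<^bsub>G\<^esub> K" by (rule lcos_self[OF g sub(2)])
    then have "h \<otimes>\<^bsub>G\<^esub> g \<in> h <#\<^bsub>G\<^esub> (g <#\<^bsub>G\<^esub> K)"
      unfolding l_coset_def[of _ h] by blast
    then obtain k where k: "k \<in> K" "h \<otimes>\<^bsub>G\<^esub> g = g \<otimes>\<^bsub>G\<^esub> k" unfolding e by (auto simp: l_coset_def)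
    have kc: "k \<in> carrier G" using subgroup.mem_carrier[OF sub(2) k(1)] .
    have "?\<phi> h = k" using k(2) g kc Hc[OF h] by (simp add: m_assoc inv_solve_left')
    then show "h \<in> K" using \<phi>[OF h] k(1) by simp
  qed
  have hom: "?\<phi> \<in> hom (res H) (res K)"
  proof (rule homI)
    show "?\<phi> h \<in> carrier (res K)" if "h \<in> carrier (res H)" for h using that \<phi> HK by simp
    show "?\<phi> (h \<otimes>\<^bsub>res H\<^esub> h') = ?\<phi> h \<otimes>\<^bsub>res K\<^esub> ?\<phi> h'" if "h \<in> carrier (res H)" "h' \<in> carrier (res H)" for h h'
      using that \<phi> subgroup.m_closed[OF sub(1)] by simp
  qed
  note gr = group_res[OF H] group_res[OF K]
  have "RO_map G H g (sign_family K) = groth_map (RM (res H)) (pullback_class (res H) ?\<phi>) (sign_family K)"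
    by (simp add: RO_map_def pullback_class_def[abs_def])
  also have "\<dots> = groth_rel (RM (res H)) `` {(pullback_class (res H) ?\<phi> (rep_class (res K) sign_rep), \<one>\<^bsub>RM (res H)\<^esub>)}"
    unfolding sign_family_def restrict_apply'[OF K]
    using groth_map_class[OF comm_monoid_RM[OF gr(2)] comm_monoid_RM[OF gr(1)] pullback_class_hom(1)[OF gr hom]
        RM_carrierI[OF gr(2) real_rep_sign[OF K]] monoid.one_closed] comm_monoid_RM[OF gr(2)]
    by (simp add: pullback_class_hom(2)[OF gr hom] comm_monoid_def)
  also have "pullback_class (res H) ?\<phi> (rep_class (res K) sign_rep) = rep_class (res H) (rep_pullback ?\<phi> sign_rep)"
    by (rule pullback_class_eq[OF gr hom real_rep_sign[OF K]])
  also have "\<dots> = rep_class (res H) sign_rep"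
  proof (rule rep_class_eq[OF gr(1) real_rep_pullback[OF gr hom real_rep_sign[OF K]]])
    show "rep_iso (res H) (rep_pullback ?\<phi> sign_rep) sign_rep"
      unfolding rep_iso_def rep_pullback_def sign_rep_def prod.case
      using \<phi> by (intro bexI[of _ "\<lambda>v. v"]) (auto simp: lin_id bij_betw_def)
  qed
  finally show ?thesis using H by (simp add: sign_family_def)
qed

lemma sign_family_in_lim: "sign_family \<in> lim_RO G"
  unfolding lim_RO_def
proof (intro CollectI conjI ballI impI PiE_I)
  fix H assume H: "H \<in> finite_subgroups G"
  interpret M: comm_monoid "RM (res H)" by (rule comm_monoid_RM[OF group_res[OF H]])
  show "sign_family H \<in> carrier (RO (res H))"
    using H RM_carrierI[OF group_res[OF H] real_rep_sign[OF H]]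
    by (simp add: sign_family_def RO_def groth_def quotientI)
next
  show "sign_family H = undefined" if "H \<notin> finite_subgroups G" for H
    using that by (simp add: sign_family_def)
qed (rule sign_family_compatible)

lemma transl_pt: "transl g (pt p) = pt (p + (of_int (fst (c g)), of_int (snd (c g))))"
  by (simp add: transl_def shift_pt)

lemma vdet_z_pos:
  assumes E: "G_vector_bundle G plane transl E" and x: "x \<in> topspace plane"
  shows "vdet (fib E x) (act E z) > 0"
proof -
  interpret G_bundle G plane transl E by (rule G_bundle.intro[OF group G_space_transl E])
  have "c z = 0" using ker_z by blast
  then have "0 < vdet (fib E (pt (x 0, x 1))) (act E z)"
    by (intro vdet_commutator_pos[OF continuous_map_pt_euclidean abz commutator])
      (simp_all add: transl_pt c_ab zero_prod_def[symmetric])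
  then show ?thesis using pt_coordinates[OF x] by simp
qed

lemma fibre_class_det_pos:
  assumes e: "e \<in> carrier (gvb_monoid G plane transl)"
    and R: "R \<in> fibre_class G plane transl {\<one>\<^bsub>G\<^esub>, z} e"
  shows "rep_det z R > 0"
proof -
  let ?K = "res {\<one>\<^bsub>G\<^esub>, z}"
  obtain E x where E: "E \<in> e" and x: "x \<in> fixed_points plane transl {\<one>\<^bsub>G\<^esub>, z}"
    and R: "R \<in> rep_class ?K (fibre_rep E x)"
    using R unfolding fibre_class_def by blast
  have EG: "G_vector_bundle G plane transl E" using e E by (auto simp: gvb_monoid_def gvb_class_def)
  have xX: "x \<in> topspace plane" "transl z x = x" using x by (auto simp: fixed_points_def)
  interpret G_bundle G plane transl E by (rule G_bundle.intro[OF group G_space_transl EG])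
  obtain W \<sigma> where RW: "R = (W, \<sigma>)" by (metis prod.exhaust)
  have real: "real_rep ?K (W, \<sigma>)" and iso: "rep_iso ?K (fibre_rep E x) (W, \<sigma>)"
    using R by (auto simp: rep_class_def RW)
  note r = real[unfolded real_rep_iff[OF group_res[OF ker_finite_subgroup]]]
  obtain m k where fr: "frame W m k" using r by blast
  note V = fib_simps(1)[OF vb xX(1)]
  note fx = frame_coord[OF xX(1) chart(2)[OF xX(1)]]
  have al: "act E z \<in> lin (fib E x) (fib E x)" using act_lin[OF abz(3) xX(1)] xX(2) by simp
  \<comment> \<open>\<open>fibre_rep\<close> restricts the action to the fibre; conjugating by the
    identity shows that the determinant sees only values on the carrier.\<close>
  let ?r = "restrict (act E z) (carrier (fib E x))"
  have rl: "?r \<in> lin (fib E x) (fib E x)" by (rule lin_cong[OF V _ al]) simp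
  have "vdet (fib E x) ?r = vdet W (\<sigma> z)"
    by (rule vdet_rep_iso[OF iso[unfolded fibre_rep_def] _ fr V]) (simp, rule rl, use r in simp)
  moreover have "vdet (fib E x) ?r = vdet (fib E x) (act E z)"
    by (rule vdet_conj[OF fx fx lin_id(2) _ rl al]) (auto simp: bij_betw_def)
  ultimately show ?thesis using vdet_z_pos[OF EG xX(1)] by (simp add: rep_det_def RW)
qed

lemma sign_family_not_in_image:
  assumes \<xi>: "\<xi> \<in> carrier (KO G plane transl)"
  shows "sign_family \<noteq> eps G plane transl \<xi>"
proof
  assume eq: "sign_family = eps G plane transl \<xi>"
  let ?H = "{\<one>\<^bsub>G\<^esub>, z}" and ?M = "gvb_monoid G plane transl"
  let ?K = "res ?H"
  let ?F = "fibre_class G plane transl ?H"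
  note K = ker_finite_subgroup
  note gr = group_res[OF K]
  interpret M: comm_monoid "RM ?K" by (rule comm_monoid_RM[OF gr])
  \<comment> \<open>A representative lies in its own class. Reading that class as the value of
    \<open>eps\<close> puts it into one of the sets united by \<open>groth_map\<close>, which
    supplies bundle classes \<open>x\<close> and \<open>y\<close> whose formal difference maps to
    it.\<close>
  have "(rep_class ?K sign_rep, \<one>\<^bsub>RM ?K\<^esub>) \<in> sign_family ?H"
    using K RM_carrierI[OF gr real_rep_sign[OF K]] by (simp add: sign_family_def groth_rel_iff) blast
  also have "sign_family ?H = groth_map (RM ?K) ?F \<xi>" using K eq by (simp add: eps_def)
  finally obtain x y where xy: "(x, y) \<in> \<xi>"
    and rel: "((?F x, ?F y), (rep_class ?K sign_rep, \<one>\<^bsub>RM ?K\<^esub>)) \<in> groth_rel (RM ?K)"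
    unfolding groth_map_def by blast
  have M: "x \<in> carrier ?M" "y \<in> carrier ?M"
    using \<xi> xy by (auto simp: KO_def groth_def quotient_def groth_rel_iff)
  show False
    by (rule groth_det_contradiction[OF gr _ rel _ _ real_rep_sign[OF K] rep_det_sign])
      (simp, erule fibre_class_det_pos[OF M(1)], erule fibre_class_det_pos[OF M(2)])
qed

end

section \<open>The group\<close>

text \<open>
  The extension of \<open>\<int>\<^sup>2\<close> by \<open>\<int>/2\<close> with cocycle \<open>((m, n), (m', n')) \<mapsto> n m' mod 2\<close>, the quotient of the
  integral Heisenberg group by the square of its central generator.
\<close>

definition heis_mult :: "int \<times> int \<times> bool \<Rightarrow> int \<times> int \<times> bool \<Rightarrow> int \<times> int \<times> bool" where
  "heis_mult = (\<lambda>(m, n, s) (m', n', s'). (m + m', n + n', s \<noteq> (s' \<noteq> odd (n * m'))))"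

text \<open>Transported to the natural numbers along \<open>to_nat\<close>, since the theorem
  asserts a group on \<open>nat\<close>.\<close>

definition heis :: "nat monoid" where
  "heis = \<lparr>carrier = range (to_nat :: int \<times> int \<times> bool \<Rightarrow> nat),
     mult = \<lambda>x y. to_nat (heis_mult (from_nat x) (from_nat y)), one = to_nat (0 :: int, 0 :: int, False)\<rparr>"

definition heis_c :: "nat \<Rightarrow> int \<times> int" where
  "heis_c x = (case from_nat x of (m, n, s :: bool) \<Rightarrow> (m, n))"

lemma group_heis: "Group.group heis"
proof (rule groupI)
  fix x y w assume "x \<in> carrier heis" "y \<in> carrier heis" "w \<in> carrier heis"
  then obtain m n s m' n' s' m'' n'' s'' where e:
    "x = to_nat (m :: int, n :: int, s :: bool)" "y = to_nat (m' :: int, n' :: int, s' :: bool)"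
    "w = to_nat (m'' :: int, n'' :: int, s'' :: bool)"
    unfolding heis_def by (auto simp: image_iff)
  show "x \<otimes>\<^bsub>heis\<^esub> y \<otimes>\<^bsub>heis\<^esub> w = x \<otimes>\<^bsub>heis\<^esub> (y \<otimes>\<^bsub>heis\<^esub> w)"
    by (auto simp: heis_def heis_mult_def e algebra_simps)
next
  fix x assume "x \<in> carrier heis"
  then obtain m n s where e: "x = to_nat (m :: int, n :: int, s :: bool)" unfolding heis_def by auto
  show "\<one>\<^bsub>heis\<^esub> \<otimes>\<^bsub>heis\<^esub> x = x" by (simp add: heis_def heis_mult_def e)
  \<comment> \<open>Besides negating the lattice part, the inverse must compensate the cocycle value
    of \<open>(- n) * m\<close>, which has the parity of \<open>n * m\<close>.\<close>
  show "\<exists>y\<in>carrier heis. y \<otimes>\<^bsub>heis\<^esub> x = \<one>\<^bsub>heis\<^esub>"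
    by (rule bexI[of _ "to_nat (- m, - n, s \<noteq> odd (n * m))"]) (auto simp: heis_def heis_mult_def e)
qed (auto simp: heis_def)

lemma central_commutator_heis:
  "central_commutator heis heis_c (to_nat (1 :: int, 0 :: int, False)) (to_nat (0 :: int, 1 :: int, False))
     (to_nat (0 :: int, 0 :: int, True))"
proof (intro central_commutator.intro lattice_action.intro central_commutator_axioms.intro group_heis)
  have k: "{g \<in> carrier heis. heis_c g = 0} = {\<one>\<^bsub>heis\<^esub>, to_nat (0 :: int, 0 :: int, True)}"
  proof (intro equalityI subsetI)
    fix x assume "x \<in> {g \<in> carrier heis. heis_c g = 0}"
    then obtain m n s where "x = to_nat (m :: int, n :: int, s :: bool)" "m = 0" "n = 0"
      by (auto simp: heis_def heis_c_def zero_prod_def)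
    then show "x \<in> {\<one>\<^bsub>heis\<^esub>, to_nat (0 :: int, 0 :: int, True)}" by (cases s) (auto simp: heis_def)
  qed (auto simp: heis_def heis_c_def zero_prod_def)
  then show "{g \<in> carrier heis. heis_c g = 0} = {\<one>\<^bsub>heis\<^esub>, to_nat (0 :: int, 0 :: int, True)}"
    "finite {g \<in> carrier heis. heis_c g = 0}" by simp_all
  show "\<exists>g\<in>carrier heis. heis_c g = v" for v
    by (rule bexI[of _ "to_nat (fst v, snd v, False)"]) (auto simp: heis_def heis_c_def)
qed (auto simp: heis_def heis_c_def heis_mult_def)

lemma infinite_heis: "infinite (carrier heis)"
  unfolding heis_def by (simp add: finite_image_iff inj_to_nat finite_prod)

text \<open>The type of total spaces has the cardinality of the continuum, as has the plane, so it
  contains a copy of every \<open>G\<close>-vector bundle; failure of surjectivity is not an effect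
  of choosing this type.\<close>

theorem mainTheorem2:
  shows "\<exists>(G :: nat monoid) (X :: (nat \<Rightarrow> real) topology) (\<phi> :: nat \<Rightarrow> (nat \<Rightarrow> real) \<Rightarrow> nat \<Rightarrow> real).
    group G \<and> infinite (carrier G) \<and>
    classifying_space_proper G X \<phi> \<and> cocompact G X \<phi> \<and>
    \<not> (lim_RO G
         \<subseteq> (eps G X \<phi> ::
               ((nat, nat \<Rightarrow> real, (nat \<Rightarrow> real) \<times> (nat \<Rightarrow> real)) gvb set
                 \<times> (nat, nat \<Rightarrow> real, (nat \<Rightarrow> real) \<times> (nat \<Rightarrow> real)) gvb set) set
               \<Rightarrow> nat set \<Rightarrow> ((nat, nat \<Rightarrow> real) rep set \<times> (nat, nat \<Rightarrow> real) rep set) set)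
            ` carrier (KO G X \<phi>))"
proof -
  interpret central_commutator heis heis_c "to_nat (1 :: int, 0 :: int, False)"
    "to_nat (0 :: int, 1 :: int, False)" "to_nat (0 :: int, 0 :: int, True)"
    by (rule central_commutator_heis)
  show ?thesis
    using group_heis infinite_heis classifying_space_plane cocompact_plane sign_family_in_lim
      sign_family_not_in_image by blast
qed

end
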